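(* Let $\mathcal S$ be a strongly connected graph directed iterated function system of similarities on $\mathbb{R}^d$ with attractor $\{F_1,\dots,F_q\}$ and vertex set $\mathcal V=\{1,\dots,q\}$. Assume that the sets $F_i$ are not contained in any $(d-1)$-dimensional hyperplane. \begin{enumerate} \item[1)] If $\mathcal S$ satisfies the graph directed weak separation property (GDWSP), then for all $i\in\mathcal V$ we have $\mathcal H^s(F_i)>0$, where $s=\dim_H F_i$ (which is independent of $i$), and $\dim_H F_i=\dim_A F_i$. \item[2)] If $\mathcal S$ does not satisfy the GDWSP, then for each $i\in\mathcal V$ there is a weak tangent of $F_i$ containing $W_i+F_i$, where $W_i$ is the parallelotope associated to a maximal subset of linearly independent $i$-overlapping directions for $\mathcal S$. Moreover, $V_{\mathcal S,i}$ is a vector space, and for any vector subspace $V$ of $V_{\mathcal S,i}$ we have $$\dim_A F_i=\dim V+\dim_A\pi_{V^\perp}(F_i).$$ Moreover, $\dim V_{\mathcal S,i}<\dim_A F_i$ whenever $\dim V_{\mathcal S,i}<d$. Also, $\dim V_{\mathcal S,i}=\dim V_{\mathcal S,j}$ for all $i,j\in\mathcal V$. \end{enumerate}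
   Context: Graph directed IFS: $\Gamma$ is a directed graph with vertex set $\mathcal V=\{1,\dots,q\}$ and a finite set $\mathcal E$ of directed edges such that from each vertex at least one edge starts; $\mathcal E_{i,j}$ is the set of edges from $i$ to $j$. To each $e\in\mathcal E$ is associated a contracting similarity $S_e(x)=r_eO_ex+d_e$ of $\mathbb{R}^d$, $0<r_e<1$, $O_e$ orthogonal, $d_e\in\mathbb{R}^d$. The attractor is the unique $q$-tuple of nonempty compact sets with $F_i=\bigcup_{j=1}^q\bigcup_{e\in\mathcal E_{i,j}}S_e(F_j)$. $\mathcal E^k_{i,j}$ is the set of sequences $(e_1,\dots,e_k)$ of edges forming a path from $i$ to $j$, $\mathcal E^\ast_{i,j}=\bigcup_{k\ge1}\mathcal E^k_{i,j}$, and for $\mathbf e=(e_1,\dots,e_k)$, $S_{\mathbf e}=S_{e_1}\circ\cdots\circ S_{e_k}$. Strongly connected means $\mathcal E^\ast_{i,j}\ne\emptyset$ for all $i,j\in\mathcal V$. Under strong connectedness, $\dim_H F_i$ does not depend on $i$, and if some $F_i$ is not contained in a $(d-1)$-dimensional hyperplane, then none is. GDWSP: let $\mathcal F_{i,i}=\{S_{\mathbf e}^{-1}\circ S_{\mathbf f}:\mathbf e,\mathbf f\in\mathcal E^\ast_{i,i}\}$. $\mathcal S$ satisfies the GDWSP if for some (equivalently, for all) $i\in\mathcal V$ the identity $I$ is an isolated point of $\mathcal F_{i,i}$ in the topology of pointwise convergence. $i$-overlapping directions: $\|\cdot\|_\infty$ is the sup norm on $[0,1]^d$, $\|\cdot\|_{\mathrm{op}}$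 the Euclidean operator norm, $B(x,R)$ the closed ball. If the GDWSP fails, $\omega\in S^{d-1}$ is an $i$-overlapping direction for $\mathcal S$ if there are $\mathbf e_k,\mathbf f_k\in\mathcal E^\ast_{i,i}$ such that $\Phi_k:=S_{\mathbf e_k}^{-1}\circ S_{\mathbf f_k}-I$ satisfies $0<\|\Phi_k\|_\infty\to0$, and $a\in F_i$, $\rho>0$ such that $\omega=\lim_{k\to\infty}\Phi_k(a)/\|\Phi_k(a)\|$ and $\rho\|D\Phi_k\|_{\mathrm{op}}\le\|\Phi_k(a_k)\|$ for all $k$, where $a_k$ is any point of $B(a,\rho)$ minimizing $\|\Phi_k(x)\|$ over $x\in B(a,\rho)$. $V_{\mathcal S,i}$ is the set of scalar multiples of $i$-overlapping directions. The parallelotope associated to linearly independent unit vectors $\omega^1,\dots,\omega^s$ is $\{t_1\omega^1+\dots+t_s\omega^s:0\le t_j\le1\}$. $A+B=\{a+b:a\in A,b\in B\}$. $\pi_V$ is the orthogonal projection onto the subspace $V$. Weak tangent: for nonempty compact $E,\hat E\subset\mathbb{R}^d$, $\hat E$ is a weak tangent of $E$ if there are a compact set $X\subset\mathbb{R}^d$ containing both $E$ and $\hat E$ and similarity maps $T_k:\mathbb{R}^d\to\mathbb{R}^d$ such that $T_k(E)\cap X\to\hat E$ in the Hausdorff metric as $k\to\infty$. $\mathcal H^s$ is $s$-dimensional Hausdorff measure, $\dim_H$ Hausdorff dimension. Assouad dimension: $N_r(E)$ is the minimum number of closed balls of radius $r$ needed to cover $E$, and $\dim_A E$ is the infimum of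 the $\alpha$ for which there is a constant $c$ such that $\sup_{x\in E}N_r(B(x,R)\cap E)\le c(R/r)^\alpha$ for all $0<r<R$. *)

theory Defs
  imports "HOL-Analysis.Analysis" "Graph_Theory.Graph_Theory"
begin

section \<open>Dimensions\<close>

text \<open>The term \<open>(diam U)\<^sup>s\<close> with the usual conventions: the empty set contributes 0, and
  a nonempty set contributes 1 if \<open>s = 0\<close> (whereas \<^term>\<open>0 powr 0 = (0::real)\<close> in HOL).\<close>
definition diam_pow :: "real \<Rightarrow> 'a::metric_space set \<Rightarrow> ennreal" where
  "diam_pow s U = (if U = {} then 0 else if s = 0 then 1 else ennreal (diameter U powr s))"

text \<open>Boundedness is required because \<^const>\<open>diameter\<close> is a real number, with no meaningful value
  on unbounded sets.\<close>
definition hausdorff_premeasure :: "real \<Rightarrow> real \<Rightarrow> 'a::metric_space set \<Rightarrow> ennreal" where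
  "hausdorff_premeasure \<delta> s E =
     (INF U \<in> {U :: nat \<Rightarrow> 'a set. E \<subseteq> (\<Union>n. U n) \<and> (\<forall>n. bounded (U n) \<and> diameter (U n) \<le> \<delta>)}.
        \<Sum>n. diam_pow s (U n))"

definition hausdorff_measure :: "real \<Rightarrow> 'a::metric_space set \<Rightarrow> ennreal" where
  "hausdorff_measure s E = (SUP \<delta> \<in> {0<..}. hausdorff_premeasure \<delta> s E)"

text \<open>Real-valued, hence meaningful only where some \<open>s\<close> is admissible; this is always the case in
  a Euclidean space. The same applies to the Assouad dimension below.\<close>
definition hausdorff_dim :: "'a::metric_space set \<Rightarrow> real" where
  "hausdorff_dim E = Inf {s. 0 \<le> s \<and> hausdorff_measure s E = 0}"

definition covering_number :: "real \<Rightarrow> 'a::metric_space set \<Rightarrow> nat" where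
  "covering_number r E = (LEAST n. \<exists>C. finite C \<and> card C = n \<and> E \<subseteq> (\<Union>c\<in>C. cball c r))"

definition assouad_dim :: "'a::metric_space set \<Rightarrow> real" where
  "assouad_dim E = Inf {\<alpha>. 0 \<le> \<alpha> \<and>
     (\<exists>c::real. \<forall>r R. 0 < r \<and> r < R \<longrightarrow>
        (\<forall>x\<in>E. real (covering_number r (cball x R \<inter> E)) \<le> c * (R / r) powr \<alpha>))}"


section \<open>Similarities, orthogonal projections, weak tangents\<close>

definition similarity_with :: "real \<Rightarrow> ('a::euclidean_space \<Rightarrow> 'a) \<Rightarrow> bool" where
  "similarity_with r f \<longleftrightarrow> (\<exists>Q b. orthogonal_transformation Q \<and> f = (\<lambda>x. r *\<^sub>R Q x + b))"

definition similarity_map :: "('a::euclidean_space \<Rightarrow> 'a) \<Rightarrow> bool" where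
  "similarity_map f \<longleftrightarrow> (\<exists>r>0. similarity_with r f)"

definition contracting_similarity :: "('a::euclidean_space \<Rightarrow> 'a) \<Rightarrow> bool" where
  "contracting_similarity f \<longleftrightarrow> (\<exists>r. 0 < r \<and> r < 1 \<and> similarity_with r f)"

definition orth_proj :: "'a::euclidean_space set \<Rightarrow> 'a \<Rightarrow> 'a" where
  "orth_proj V x = (THE y. y \<in> V \<and> x - y \<in> V\<^sup>\<bottom>)"

text \<open>The Hausdorff metric; only used for nonempty compact sets.\<close>
definition hausdorff_dist :: "'a::metric_space set \<Rightarrow> 'a set \<Rightarrow> real" where
  "hausdorff_dist A B = max (SUP a\<in>A. infdist a B) (SUP b\<in>B. infdist b A)"

definition weak_tangent :: "'a::euclidean_space set \<Rightarrow> 'a set \<Rightarrow> bool" where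
  "weak_tangent E K \<longleftrightarrow>
     compact E \<and> E \<noteq> {} \<and> compact K \<and> K \<noteq> {} \<and>
     (\<exists>X T. compact X \<and> E \<subseteq> X \<and> K \<subseteq> X \<and>
        (\<forall>k::nat. similarity_map (T k) \<and> T k ` E \<inter> X \<noteq> {}) \<and>
        (\<lambda>k. hausdorff_dist (T k ` E \<inter> X) K) \<longlonglongrightarrow> 0)"


section \<open>Graph directed iterated function systems\<close>

definition graph_directed_ifs ::
  "('v, 'e) pre_digraph \<Rightarrow> ('e \<Rightarrow> 'a::euclidean_space \<Rightarrow> 'a) \<Rightarrow> bool" where
  "graph_directed_ifs G S \<longleftrightarrow>
     fin_digraph G \<and> verts G \<noteq> {} \<and> (\<forall>i\<in>verts G. \<exists>e\<in>arcs G. tail G e = i) \<and>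
     (\<forall>e\<in>arcs G. contracting_similarity (S e))"

definition edges_between :: "('v, 'e) pre_digraph \<Rightarrow> 'v \<Rightarrow> 'v \<Rightarrow> 'e set" where
  "edges_between G i j = {e \<in> arcs G. tail G e = i \<and> head G e = j}"

text \<open>The attractor is the unique tuple with this property; uniqueness concerns the values
  \<open>F i\<close> for vertices \<open>i\<close> only.\<close>
definition is_attractor ::
  "('v, 'e) pre_digraph \<Rightarrow> ('e \<Rightarrow> 'a::euclidean_space \<Rightarrow> 'a) \<Rightarrow> ('v \<Rightarrow> 'a set) \<Rightarrow> bool" where
  "is_attractor G S F \<longleftrightarrow>
     (\<forall>i\<in>verts G. compact (F i) \<and> F i \<noteq> {} \<and>
        F i = (\<Union>j\<in>verts G. \<Union>e\<in>edges_between G i j. S e ` F j))"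

text \<open>The set \<open>\<E>\<^sup>*\<^sub>i\<^sub>j\<close>: edge paths of length at least one. (The library notion
  \<^const>\<open>strongly_connected\<close> would also admit the path of length zero from \<open>i\<close> to \<open>i\<close>.)\<close>
definition paths :: "('v, 'e) pre_digraph \<Rightarrow> 'v \<Rightarrow> 'v \<Rightarrow> 'e list set" where
  "paths G i j = {p. pre_digraph.awalk G i p j \<and> p \<noteq> []}"

definition ifs_strongly_connected :: "('v, 'e) pre_digraph \<Rightarrow> bool" where
  "ifs_strongly_connected G \<longleftrightarrow> (\<forall>i\<in>verts G. \<forall>j\<in>verts G. paths G i j \<noteq> {})"

definition path_map :: "('e \<Rightarrow> 'a \<Rightarrow> 'a) \<Rightarrow> 'e list \<Rightarrow> 'a \<Rightarrow> 'a" where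
  "path_map S p = foldr (\<lambda>e f. S e \<circ> f) p id"

definition return_maps ::
  "('v, 'e) pre_digraph \<Rightarrow> ('e \<Rightarrow> 'a \<Rightarrow> 'a) \<Rightarrow> 'v \<Rightarrow> ('a \<Rightarrow> 'a) set" where
  "return_maps G S i = {inv (path_map S e) \<circ> path_map S f | e f. e \<in> paths G i i \<and> f \<in> paths G i i}"

text \<open>The topology on the function type \<^typ>\<open>'a \<Rightarrow> 'a\<close> is the product topology, i.e. that of
  pointwise convergence.\<close>
definition gdwsp ::
  "('v, 'e) pre_digraph \<Rightarrow> ('e \<Rightarrow> 'a::euclidean_space \<Rightarrow> 'a) \<Rightarrow> bool" where
  "gdwsp G S \<longleftrightarrow> (\<exists>i\<in>verts G. id isolated_in return_maps G S i)"


section \<open>Overlapping directions\<close>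

definition cube_sup_norm :: "('a::euclidean_space \<Rightarrow> 'a) \<Rightarrow> real" where
  "cube_sup_norm \<Phi> = (SUP x\<in>cbox 0 One. norm (\<Phi> x))"

text \<open>\<open>\<Phi> k\<close> is an affine map, so the point at which its derivative is taken is immaterial.\<close>
definition overlapping_direction ::
  "('v, 'e) pre_digraph \<Rightarrow> ('e \<Rightarrow> 'a::euclidean_space \<Rightarrow> 'a) \<Rightarrow> ('v \<Rightarrow> 'a set) \<Rightarrow> 'v \<Rightarrow> 'a \<Rightarrow> bool"
  where
  "overlapping_direction G S F i \<omega> \<longleftrightarrow> norm \<omega> = 1 \<and>
     (\<exists>(e :: nat \<Rightarrow> 'e list) (f :: nat \<Rightarrow> 'e list) (\<Phi> :: nat \<Rightarrow> 'a \<Rightarrow> 'a).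
        (\<forall>k. e k \<in> paths G i i \<and> f k \<in> paths G i i \<and>
             \<Phi> k = (\<lambda>x. (inv (path_map S (e k)) \<circ> path_map S (f k)) x - x)) \<and>
        (\<forall>k. 0 < cube_sup_norm (\<Phi> k)) \<and> (\<lambda>k. cube_sup_norm (\<Phi> k)) \<longlonglongrightarrow> 0 \<and>
        (\<exists>a\<in>F i. \<exists>\<rho>>0.
           (\<lambda>k. \<Phi> k a /\<^sub>R norm (\<Phi> k a)) \<longlonglongrightarrow> \<omega> \<and>
           (\<exists>y :: nat \<Rightarrow> 'a. \<forall>k.
              is_arg_min (\<lambda>x. norm (\<Phi> k x)) (\<lambda>x. x \<in> cball a \<rho>) (y k) \<and>
              \<rho> * onorm (frechet_derivative (\<Phi> k) (at a)) \<le> norm (\<Phi> k (y k)))))"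

definition overlap_space ::
  "('v, 'e) pre_digraph \<Rightarrow> ('e \<Rightarrow> 'a::euclidean_space \<Rightarrow> 'a) \<Rightarrow> ('v \<Rightarrow> 'a set) \<Rightarrow> 'v \<Rightarrow> 'a set" where
  "overlap_space G S F i = {c *\<^sub>R \<omega> | c \<omega>. overlapping_direction G S F i \<omega>}"

definition maximal_independent_directions ::
  "('v, 'e) pre_digraph \<Rightarrow> ('e \<Rightarrow> 'a::euclidean_space \<Rightarrow> 'a) \<Rightarrow> ('v \<Rightarrow> 'a set) \<Rightarrow> 'v \<Rightarrow> 'a set \<Rightarrow> bool"
  where
  "maximal_independent_directions G S F i \<Omega> \<longleftrightarrow>
     \<Omega> \<subseteq> Collect (overlapping_direction G S F i) \<and> independent \<Omega> \<and>
     (\<forall>\<Omega>'. \<Omega> \<subseteq> \<Omega>' \<and> \<Omega>' \<subseteq> Collect (overlapping_direction G S F i) \<and> independent \<Omega>' \<longrightarrow> \<Omega>' = \<Omega>)"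

definition parallelotope :: "'a::euclidean_space set \<Rightarrow> 'a set" where
  "parallelotope \<Omega> = {\<Sum>\<omega>\<in>\<Omega>. t \<omega> *\<^sub>R \<omega> | t. \<forall>\<omega>\<in>\<Omega>. 0 \<le> t \<omega> \<and> t \<omega> \<le> 1}"

end

theory Submission
  imports Defs
begin

text \<open>Fix a vertex \<open>i\<close>. The maps of the closed paths at \<open>i\<close> form a semigroup \<open>L\<close> of contracting
  similarities of \<open>F = F\<^sub>i\<close>, and the return maps are the maps \<open>A\<^sup>-\<^sup>1 \<circ> B\<close> with \<open>A\<close>, \<open>B\<close> in \<open>L\<close>.

  If the identity is isolated among them, boundedly many elements of \<open>L\<close> of a given scale act near a
  given ball. Covering numbers of \<open>F\<close> are then multiplicative up to constants, and local covering numbers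
  are comparable to global ones, so that all dimensions agree and the Hausdorff measure is positive.

  Otherwise let \<open>I + \<Phi>\<close> be a return map close to the identity. Conjugating it by an element of \<open>L\<close> of
  small ratio and with nearly trivial rotation, near a point where \<open>\<Phi>\<close> is nearly constant, gives almost a
  translation. Composing such maps shows that all translations by vectors in the span \<open>V\<close> of the overlapping
  directions are limits of return maps, and this persists after conjugation by \<open>L\<close>. If \<open>A\<^sup>-\<^sup>1 F\<close> is
  a magnified copy of \<open>F\<close> and \<open>C\<^sup>-\<^sup>1 \<circ> D\<close> conjugated by \<open>A\<close> is nearly the translation by \<open>w\<close>, then the larger copy
  \<open>(C \<circ> A)\<^sup>-\<^sup>1 F\<close> nearly contains \<open>F + w\<close>. So magnified copies of \<open>F\<close> approximate \<open>W + F\<close> for all bounded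
  \<open>W \<subseteq> V\<close>; for a large ball \<open>W\<close> this contains a product of a ball of \<open>V\<close> with the projection of \<open>F\<close> to \<open>V\<^sup>\<bottom>\<close>,
  which is the lower bound in the dimension formula. Since \<open>V\<close> is invariant under the rotations of \<open>L\<close>, that
  projection contains a Cantor set unless it is a point.\<close>

section \<open>Covering numbers\<close>

text \<open>The base point and the radius in the definition of an overlapping direction are awkward
  to carry along. They disappear in \<open>translation_space\<close>: it consists of the vectors all
  of whose multiples are approximated by return maps under conjugation by every element of L, and
  the overlapping directions turn out to be exactly its unit vectors. Linearity, invariance under
  rotations and equality of the dimensions at different vertices are then proved for this space;
  conjugation along paths between two vertices carries one such space into the other.

  The obstacle in producing translations is that L contains neither inverses nor the identity.
  Rotations are therefore undone only approximately, by maps from a finite set, so that the loss of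
  scale stays bounded. This bound is what allows a prescribed translation to be reached in boundedly
  many steps.

  The dimension formula is proved for the whole sets of admissible exponents, so that it does not
  matter whether an infimum is attained. In the separated case positivity of the Hausdorff measure
  comes from counting alone; no measure on F is constructed.\<close>

lemma covering_number_le:
  assumes "finite C" "E \<subseteq> (\<Union>c\<in>C. cball c r)" "card C \<le> n"
  shows "covering_number r E \<le> n"
proof -
  have "covering_number r E \<le> card C"
    unfolding covering_number_def by (rule Least_le) (intro exI[of _ C] conjI refl assms)
  then show ?thesis using assms(3) by linarith
qed

lemma covering_number_attained:
  fixes E :: "'a::euclidean_space set"
  assumes "bounded E" "0 < r"
  shows "\<exists>C. finite C \<and> card C = covering_number r E \<and> E \<subseteq> (\<Union>c\<in>C. cball c r)"
proof -
  have "compact (closure E)" using assms(1) by (simp add: compact_closure)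
  then have "\<exists>k. finite k \<and> closure E \<subseteq> (\<Union>x\<in>k. ball x r)"
    using assms(2) by (simp add: compact_eq_totally_bounded)
  then obtain k where k: "finite k" "closure E \<subseteq> (\<Union>x\<in>k. ball x r)" by blast
  have "E \<subseteq> (\<Union>c\<in>k. cball c r)"
    using closure_subset[of E] k(2) UN_mono[OF order.refl ball_subset_cball] by (rule order_trans[OF order_trans])
  then have "\<exists>n C. finite C \<and> card C = n \<and> E \<subseteq> (\<Union>c\<in>C. cball c r)"
    using k(1) by metis
  then show ?thesis unfolding covering_number_def by (rule LeastI_ex)
qed

lemma covering_number_mono:
  fixes E :: "'a::euclidean_space set"
  assumes "E \<subseteq> E'" "bounded E'" "0 < r'" "r' \<le> r"
  shows "covering_number r E \<le> covering_number r' E'"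
proof -
  obtain C where C: "finite C" "card C = covering_number r' E'" "E' \<subseteq> (\<Union>c\<in>C. cball c r')"
    using covering_number_attained[OF assms(2,3)] by metis
  have "(\<Union>c\<in>C. cball c r') \<subseteq> (\<Union>c\<in>C. cball c r)"
    using assms(4) by (auto intro: order_trans)
  with C assms(1) show ?thesis by (intro covering_number_le[of C]) auto
qed

lemma covering_number_pos:
  fixes E :: "'a::euclidean_space set"
  assumes "bounded E" "E \<noteq> {}" "0 < r"
  shows "1 \<le> covering_number r E"
proof -
  obtain C where C: "finite C" "card C = covering_number r E" "E \<subseteq> (\<Union>c\<in>C. cball c r)"
    using covering_number_attained[OF assms(1,3)] by metis
  then have "C \<noteq> {}" using assms(2) by auto
  with C show ?thesis by (metis One_nat_def Suc_leI card_gt_0_iff)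
qed

lemma covering_number_Lipschitz_image:
  fixes E :: "'a::euclidean_space set" and f :: "'a \<Rightarrow> 'b::euclidean_space"
  assumes "bounded E" "0 < r" "\<And>x y. dist (f x) (f y) \<le> l * dist x y" "0 \<le> l"
  shows "covering_number (l * r) (f ` E) \<le> covering_number r E"
proof -
  obtain C where C: "finite C" "card C = covering_number r E" "E \<subseteq> (\<Union>c\<in>C. cball c r)"
    using covering_number_attained[OF assms(1,2)] by metis
  have "f ` E \<subseteq> (\<Union>c\<in>f ` C. cball c (l * r))"
  proof clarsimp
    fix x assume "x \<in> E"
    then obtain c where c: "c \<in> C" "dist c x \<le> r" using C(3) by auto
    have "dist (f c) (f x) \<le> l * r"
      using assms(3)[of c x] mult_left_mono[OF c(2) assms(4)] by linarith
    then show "\<exists>c\<in>C. dist (f c) (f x) \<le> l * r" using c by blast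
  qed
  then show ?thesis
    using C(1,2) card_image_le[OF C(1), of f] by (intro covering_number_le[of "f ` C"]) auto
qed

lemma covering_number_UN_le:
  fixes E :: "'i \<Rightarrow> 'a::euclidean_space set"
  assumes "finite I" "\<And>i. i \<in> I \<Longrightarrow> bounded (E i)" "0 < r" "A \<subseteq> (\<Union>i\<in>I. E i)"
  shows "covering_number r A \<le> (\<Sum>i\<in>I. covering_number r (E i))"
proof -
  have "\<exists>C. finite C \<and> card C = covering_number r (E i) \<and> E i \<subseteq> (\<Union>c\<in>C. cball c r)" if "i \<in> I" for i
    by (rule covering_number_attained[OF assms(2)[OF that] assms(3)])
  then have "\<forall>i\<in>I. \<exists>C. finite C \<and> card C = covering_number r (E i) \<and> E i \<subseteq> (\<Union>c\<in>C. cball c r)"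
    by (rule ballI)
  from bchoice[OF this] obtain C where C: "\<And>i. i \<in> I \<Longrightarrow> finite (C i)"
    "\<And>i. i \<in> I \<Longrightarrow> card (C i) = covering_number r (E i)"
    "\<And>i. i \<in> I \<Longrightarrow> E i \<subseteq> (\<Union>c\<in>C i. cball c r)"
    by metis
  have "A \<subseteq> (\<Union>c\<in>(\<Union>i\<in>I. C i). cball c r)"
    using assms(4) C(3) by blast
  moreover have "card (\<Union>i\<in>I. C i) \<le> (\<Sum>i\<in>I. covering_number r (E i))"
    using card_UN_le[OF assms(1), of C] C(2) by simp
  ultimately show ?thesis
    using C(1) assms(1) by (intro covering_number_le[of "\<Union>i\<in>I. C i"]) auto
qed

section \<open>Separated sets\<close>

text \<open>The strict inequality matches closed balls: a point that cannot be added to a maximal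
  \<open>r\<close>-separated set lies in a closed \<open>r\<close>-ball about one of its points, and
  \<open>2 * r\<close>-separated points never share a closed \<open>r\<close>-ball.\<close>

definition separated :: "real \<Rightarrow> 'a::metric_space set \<Rightarrow> bool" where
  "separated r P \<longleftrightarrow> (\<forall>x\<in>P. \<forall>y\<in>P. x \<noteq> y \<longrightarrow> r < dist x y)"

lemma separated_card_le:
  fixes E :: "'a::euclidean_space set"
  assumes "P \<subseteq> E" "separated (2 * r) P" "bounded E" "0 < r"
  shows "finite P" "card P \<le> covering_number r E"
proof -
  obtain C where C: "finite C" "card C = covering_number r E" "E \<subseteq> (\<Union>c\<in>C. cball c r)"
    using covering_number_attained[OF assms(3,4)] by metis
  have "\<forall>p\<in>P. \<exists>c\<in>C. dist c p \<le> r" using C(3) assms(1) by fastforce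
  then obtain g where g: "\<And>p. p \<in> P \<Longrightarrow> g p \<in> C \<and> dist (g p) p \<le> r" by metis
  have inj: "inj_on g P"
  proof (rule inj_onI, rule ccontr)
    fix x y assume xy: "x \<in> P" "y \<in> P" "g x = g y" "x \<noteq> y"
    have "dist x y \<le> dist (g x) x + dist (g y) y"
      using dist_triangle2[of x y "g x"] xy(3) by (simp add: dist_commute)
    then show False using g xy assms(2) unfolding separated_def by (smt (verit))
  qed
  have sub: "g ` P \<subseteq> C" using g by blast
  show "finite P" using inj sub C(1) by (metis finite_imageD finite_subset)
  show "card P \<le> covering_number r E" using card_inj_on_le[OF inj sub C(1)] C(2) by simp
qed

text \<open>The covering number at half the scale bounds the size of separated subsets, so that a
  largest one exists; it covers, since otherwise a further point could be added.\<close>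

lemma maximal_separated:
  fixes E :: "'a::euclidean_space set"
  assumes "bounded E" "0 < r"
  obtains P where "P \<subseteq> E" "finite P" "separated r P" "E \<subseteq> (\<Union>p\<in>P. cball p r)"
    "covering_number r E \<le> card P"
proof -
  define S where "S = {P. P \<subseteq> E \<and> finite P \<and> separated r P}"
  have bd: "\<forall>P. P \<in> S \<longrightarrow> card P < Suc (covering_number (r/2) E)"
    using separated_card_le[of _ E "r/2"] assms by (auto simp: S_def less_Suc_eq_le)
  have "{} \<in> S" by (simp add: S_def separated_def)
  then obtain P where P: "P \<in> S" "\<And>Q. Q \<in> S \<Longrightarrow> card Q \<le> card P"
    using ex_has_greatest_nat[of "\<lambda>P. P \<in> S", OF _ bd] by metis
  have "E \<subseteq> (\<Union>p\<in>P. cball p r)"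
  proof (rule ccontr)
    assume "\<not> ?thesis"
    then obtain x where x: "x \<in> E" "\<And>p. p \<in> P \<Longrightarrow> r < dist p x" by force
    then have "x \<notin> P" using assms(2) by force
    moreover have "insert x P \<in> S"
      using P(1) x by (auto simp: S_def separated_def dist_commute)
    ultimately show False using P(2)[of "insert x P"] P(1) by (simp add: S_def)
  qed
  then show thesis
    using that[of P] P(1) covering_number_le[of P E r "card P"] by (auto simp: S_def)
qed

section \<open>Coverings and separated sets in balls of a subspace\<close>

lemma orthonormal_coords:
  fixes B :: "'a::euclidean_space set"
  assumes "pairwise orthogonal B" "\<forall>b\<in>B. norm b = 1" "finite B" "b \<in> B"
  shows "(\<Sum>b\<in>B. g b *\<^sub>R b) \<bullet> b = g b"
proof -
  have "(\<Sum>c\<in>B. g c *\<^sub>R c) \<bullet> b = (\<Sum>c\<in>B. if c = b then g c else 0)"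
    unfolding inner_sum_left
  proof (rule sum.cong)
    fix c assume "c \<in> B"
    show "g c *\<^sub>R c \<bullet> b = (if c = b then g c else 0)"
    proof (cases "c = b")
      case True
      then show ?thesis using assms(2,4) by (simp add: norm_eq_1)
    next
      case False
      then show ?thesis using assms(1,4) \<open>c \<in> B\<close> by (simp add: pairwise_def orthogonal_def)
    qed
  qed simp
  then show ?thesis using assms(3,4) by simp
qed

lemma subspace_orthonormal_basis:
  fixes V :: "'a::euclidean_space set"
  assumes "subspace V"
  obtains B where "finite B" "B \<subseteq> V" "pairwise orthogonal B" "\<forall>b\<in>B. norm b = 1"
    "card B = dim V" "\<forall>x\<in>V. x = (\<Sum>b\<in>B. (x \<bullet> b) *\<^sub>R b)"
proof -
  obtain B where B: "B \<subseteq> V" "pairwise orthogonal B" "\<And>x. x \<in> B \<Longrightarrow> norm x = 1"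
    "independent B" "card B = dim V" "span B = V"
    using orthonormal_basis_subspace[OF assms] by blast
  have fin: "finite B" using B(4) by (simp add: independent_imp_finite)
  have "x = (\<Sum>b\<in>B. (x \<bullet> b) *\<^sub>R b)" if x: "x \<in> V" for x
  proof -
    obtain g where g: "x = (\<Sum>b\<in>B. g b *\<^sub>R b)"
      using x B(6) span_finite[OF fin] by auto
    have "(\<Sum>b\<in>B. (x \<bullet> b) *\<^sub>R b) = (\<Sum>b\<in>B. g b *\<^sub>R b)"
      by (rule sum.cong) (use B(3) in \<open>auto simp: g orthonormal_coords[OF B(2) _ fin]\<close>)
    then show ?thesis using g by simp
  qed
  then show thesis using that[of B] B fin by blast
qed

text \<open>A grid in orthonormal coordinates of V, of mesh comparable to \<open>r\<close>, has at
  most a multiple of \<open>R / r\<close> relevant values per axis.\<close>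

lemma subspace_ball_cover:
  fixes V :: "'a::euclidean_space set"
  assumes "subspace V"
  obtains K where "0 < K" "\<And>R r. \<lbrakk>0 < r; r \<le> R\<rbrakk> \<Longrightarrow>
    \<exists>C. finite C \<and> real (card C) \<le> K * (R / r) ^ dim V \<and> V \<inter> cball 0 R \<subseteq> (\<Union>c\<in>C. cball c r)"
proof -
  obtain B where B: "finite B" "B \<subseteq> V" "pairwise orthogonal B" "\<forall>b\<in>B. norm b = 1"
    "card B = dim V" "\<forall>x\<in>V. x = (\<Sum>b\<in>B. (x \<bullet> b) *\<^sub>R b)"
    using subspace_orthonormal_basis[OF assms] .
  define m where "m = card B"
  \<comment> \<open>There are at most \<open>2 * (R / h) + 3\<close> grid values per axis, and
    \<open>R / r \<ge> 1\<close> absorbs the summand 3.\<close>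
  define K where "K = (2 * (real m + 1) + 3) ^ m"
  have "\<exists>C. finite C \<and> real (card C) \<le> K * (R / r) ^ dim V \<and> V \<inter> cball 0 R \<subseteq> (\<Union>c\<in>C. cball c r)"
    if r: "0 < r" "r \<le> R" for r R
  proof -
    \<comment> \<open>Each of the m coordinates is rounded by at most h, which adds up to less than
      r; m + 1 in place of m also serves the zero subspace.\<close>
    define h where "h = r / (real m + 1)"
    have h: "0 < h" using r by (simp add: h_def)
    define Q where "Q = \<lceil>R / h\<rceil>"
    have "0 \<le> R / h" using h r by simp
    then have Q0: "0 \<le> Q" unfolding Q_def by linarith
    define N where "N = {- Q .. Q}"
    define C where "C = (\<lambda>f. \<Sum>b\<in>B. (h * of_int (f b)) *\<^sub>R b) ` (B \<rightarrow>\<^sub>E N)"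
    have fin: "finite C" unfolding C_def N_def using B(1) by (intro finite_imageI finite_PiE) auto
    have "card C \<le> card (B \<rightarrow>\<^sub>E N)"
      unfolding C_def using B(1) by (intro card_image_le finite_PiE) (auto simp: N_def)
    also have "\<dots> = card N ^ m" using B(1) by (simp add: card_PiE m_def)
    finally have cC: "real (card C) \<le> real (card N) ^ m"
      by (metis of_nat_le_iff of_nat_power)
    have "real (card N) = 2 * of_int Q + 1"
      using Q0 by (simp add: N_def)
    also have "\<dots> \<le> 2 * (R / h) + 3" unfolding Q_def by linarith
    also have "\<dots> = 2 * (real m + 1) * (R / r) + 3" by (simp add: h_def)
    also have "\<dots> \<le> 2 * (real m + 1) * (R / r) + 3 * (R / r)"
      using r by (simp add: le_divide_eq)
    also have "\<dots> = (2 * (real m + 1) + 3) * (R / r)" by (simp only: distrib_right)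
    finally have "real (card N) ^ m \<le> ((2 * (real m + 1) + 3) * (R / r)) ^ m"
      by (intro power_mono) auto
    also have "\<dots> = K * (R / r) ^ dim V"
      by (simp only: K_def power_mult_distrib m_def B(5))
    finally have "real (card C) \<le> K * (R / r) ^ dim V" using cC by linarith
    moreover have "V \<inter> cball 0 R \<subseteq> (\<Union>c\<in>C. cball c r)"
    proof
      fix x assume x: "x \<in> V \<inter> cball 0 R"
      define f where "f = (\<lambda>b\<in>B. \<lfloor>(x \<bullet> b) / h\<rfloor>)"
      have "f \<in> B \<rightarrow>\<^sub>E N"
      proof
        fix b assume b: "b \<in> B"
        have "\<bar>x \<bullet> b\<bar> \<le> R"
          using Cauchy_Schwarz_ineq2[of x b] B(4)[rule_format, OF b] x by auto
        then have "- (R / h) \<le> (x \<bullet> b) / h" "(x \<bullet> b) / h \<le> R / h"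
          using h by (auto simp: divide_simps)
        then show "f b \<in> N" using b by (simp add: f_def N_def Q_def) linarith
      qed (simp add: f_def)
      moreover have "dist (\<Sum>b\<in>B. (h * of_int (f b)) *\<^sub>R b) x \<le> r"
      proof -
        have "dist (\<Sum>b\<in>B. (h * of_int (f b)) *\<^sub>R b) x
            = norm (\<Sum>b\<in>B. (h * of_int (f b) - x \<bullet> b) *\<^sub>R b)"
          unfolding dist_norm by (subst (2) B(6)[rule_format]) (use x in \<open>auto simp: scaleR_left_diff_distrib sum_subtractf\<close>)
        also have "\<dots> \<le> (\<Sum>b\<in>B. norm ((h * of_int (f b) - x \<bullet> b) *\<^sub>R b))"
          by (rule norm_sum)
        also have "\<dots> \<le> (\<Sum>b\<in>B. h)"
        proof (rule sum_mono)
          fix b assume b: "b \<in> B"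
          have "of_int (f b) \<le> (x \<bullet> b) / h" "(x \<bullet> b) / h \<le> of_int (f b) + 1"
            using b by (auto simp: f_def)
          then have "h * of_int (f b) \<le> x \<bullet> b" "x \<bullet> b \<le> h * of_int (f b) + h"
            using h by (auto simp: field_simps)
          then show "norm ((h * of_int (f b) - x \<bullet> b) *\<^sub>R b) \<le> h"
            using B(4)[rule_format, OF b] by simp
        qed
        also have "\<dots> \<le> r" using r by (simp add: h_def m_def[symmetric] field_simps)
        finally show ?thesis .
      qed
      ultimately show "x \<in> (\<Union>c\<in>C. cball c r)" by (auto simp: C_def)
    qed
    ultimately show ?thesis using fin by blast
  qed
  moreover have "0 < K" by (simp add: K_def)
  ultimately show thesis using that by blast
qed

text \<open>A grid of spacing \<open>2 * r\<close>, with so few values per axis that the coordinates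
  add up to at most R. If R is small it is the origin alone, which the factor \<kappa> allows
  for.\<close>

lemma subspace_ball_separated:
  fixes V :: "'a::euclidean_space set"
  assumes "subspace V"
  obtains \<kappa> where "0 < \<kappa>" "\<And>R r. \<lbrakk>0 < r; 0 < R\<rbrakk> \<Longrightarrow>
    \<exists>P. finite P \<and> P \<subseteq> V \<inter> cball 0 R \<and> separated r P \<and> \<kappa> * (R / r) ^ dim V \<le> real (card P)"
proof -
  obtain B where B: "finite B" "B \<subseteq> V" "pairwise orthogonal B" "\<forall>b\<in>B. norm b = 1"
    "card B = dim V" "\<forall>x\<in>V. x = (\<Sum>b\<in>B. (x \<bullet> b) *\<^sub>R b)"
    using subspace_orthonormal_basis[OF assms] .
  define m where "m = card B"
  define \<kappa> where "\<kappa> = (1 / (2 * (real m + 1))) ^ m"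
  have "\<exists>P. finite P \<and> P \<subseteq> V \<inter> cball 0 R \<and> separated r P \<and> \<kappa> * (R / r) ^ dim V \<le> real (card P)"
    if r: "0 < r" "0 < R" for r R
  proof -
    define n where "n = nat \<lfloor>R / (2 * r * (real m + 1))\<rfloor>"
    have n1: "real n \<le> R / (2 * r * (real m + 1))" "R / (2 * r * (real m + 1)) \<le> real n + 1"
      using r by (auto simp: n_def)
    define v where "v = (\<lambda>f. \<Sum>b\<in>B. (2 * r * real (f b)) *\<^sub>R b)"
    define P where "P = v ` (B \<rightarrow>\<^sub>E {0..n})"
    have co: "v f \<bullet> b = 2 * r * real (f b)" if "b \<in> B" for f b
      unfolding v_def using orthonormal_coords[OF B(3,4,1) that] .
    have sep: "r < dist (v f) (v g)" if fg: "f \<in> B \<rightarrow>\<^sub>E {0..n}" "g \<in> B \<rightarrow>\<^sub>E {0..n}" "f \<noteq> g" for f g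
    proof -
      obtain b where b: "b \<in> B" "f b \<noteq> g b" using fg by (metis PiE_ext)
      have "1 \<le> \<bar>real (f b) - real (g b)\<bar>" using b(2) by linarith
      then have "2 * r \<le> 2 * r * \<bar>real (f b) - real (g b)\<bar>" using r by simp
      also have "\<dots> = \<bar>(v f - v g) \<bullet> b\<bar>"
        using r by (simp add: inner_diff_left co[OF b(1)] right_diff_distrib[symmetric] abs_mult)
      also have "\<dots> \<le> norm (v f - v g)"
        using Cauchy_Schwarz_ineq2[of "v f - v g" b] B(4)[rule_format, OF b(1)] by simp
      finally show ?thesis using r by (simp add: dist_norm)
    qed
    have "inj_on v (B \<rightarrow>\<^sub>E {0..n})"
    proof (rule inj_onI, rule ccontr)
      fix f g assume "f \<in> B \<rightarrow>\<^sub>E {0..n}" "g \<in> B \<rightarrow>\<^sub>E {0..n}" "v f = v g" "f \<noteq> g"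
      then show False using sep[of f g] r by simp
    qed
    then have "card P = (n + 1) ^ m"
      unfolding P_def using B(1) by (simp add: card_image card_PiE m_def)
    moreover have "\<kappa> * (R / r) ^ dim V \<le> real ((n + 1) ^ m)"
    proof -
      have "\<kappa> * (R / r) ^ dim V = (R / (2 * r * (real m + 1))) ^ m"
        by (simp add: \<kappa>_def m_def B(5) power_mult_distrib[symmetric] field_simps)
      also have "\<dots> \<le> (real n + 1) ^ m"
        using n1 r by (intro power_mono) auto
      finally show ?thesis by (simp add: add.commute)
    qed
    moreover have "P \<subseteq> V \<inter> cball 0 R"
    proof
      fix x assume "x \<in> P"
      then obtain f where f: "f \<in> B \<rightarrow>\<^sub>E {0..n}" "x = v f" by (auto simp: P_def)
      have "x \<in> V" unfolding f(2) v_def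
        using B(2) assms by (intro subspace_sum subspace_scale) auto
      moreover have "norm x \<le> R"
      proof -
        have "norm x \<le> (\<Sum>b\<in>B. norm ((2 * r * real (f b)) *\<^sub>R b))"
          unfolding f(2) v_def by (rule norm_sum)
        also have "\<dots> \<le> (\<Sum>b\<in>B. 2 * r * real n)"
          using f(1) B(4) r by (intro sum_mono) (auto simp: PiE_iff)
        also have "\<dots> = real m * (2 * r * real n)" by (simp add: m_def)
        also have "\<dots> \<le> (real m + 1) * (2 * r * real n)"
          using r by (intro mult_right_mono) auto
        also have "\<dots> = real n * (2 * r * (real m + 1))" by simp
        also have "\<dots> \<le> R" using n1(1) r by (simp add: le_divide_eq mult_less_0_iff split: if_splits)
        finally show ?thesis .
      qed
      ultimately show "x \<in> V \<inter> cball 0 R" by simp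
    qed
    moreover have "separated r P" using sep by (auto simp: separated_def P_def)
    moreover have "finite P" unfolding P_def using B(1) by (intro finite_imageI finite_PiE) auto
    ultimately show ?thesis by metis
  qed
  moreover have "0 < \<kappa>" by (simp add: \<kappa>_def)
  ultimately show thesis using that by blast
qed

lemma covering_number_cball:
  "\<exists>K>0. \<forall>(x::'a::euclidean_space) R r. 0 < r \<and> r \<le> R \<longrightarrow>
    real (covering_number r (cball x R)) \<le> K * (R / r) ^ DIM('a)"
proof -
  obtain K where K: "0 < K" "\<And>R r. \<lbrakk>0 < r; r \<le> R\<rbrakk> \<Longrightarrow> \<exists>C::'a set. finite C \<and>
      real (card C) \<le> K * (R / r) ^ dim (UNIV::'a set) \<and> UNIV \<inter> cball 0 R \<subseteq> (\<Union>c\<in>C. cball c r)"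
    using subspace_ball_cover[of "UNIV::'a set"] by auto
  show ?thesis
  proof (intro exI[of _ K] conjI K(1) allI impI)
    fix x :: 'a and R r :: real assume "0 < r \<and> r \<le> R"
    then have r: "0 < r" "r \<le> R" by auto
    obtain C :: "'a set" where C: "finite C" "real (card C) \<le> K * (R / r) ^ DIM('a)"
      "cball 0 R \<subseteq> (\<Union>c\<in>C. cball c r)"
      using K(2)[OF r] by auto
    have "cball x R = (+) x ` cball 0 R" by simp
    also have "covering_number (1 * r) \<dots> \<le> covering_number r (cball (0::'a) R)"
      using r by (intro covering_number_Lipschitz_image) auto
    also have "\<dots> \<le> card C" using C by (intro covering_number_le) auto
    finally show "real (covering_number r (cball x R)) \<le> K * (R / r) ^ DIM('a)"
      using C(2) by simp
  qed
qed

text \<open>Each ball of a cover is covered anew, at constant cost. Factors above 1 follow by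
  monotonicity, hence the minimum with 1 in the proof.\<close>

lemma covering_number_rescale:
  fixes c :: real
  assumes "0 < c"
  shows "\<exists>K>0. \<forall>(E :: 'a::euclidean_space set) r. bounded E \<and> 0 < r \<longrightarrow>
    real (covering_number (c * r) E) \<le> K * real (covering_number r E)"
proof -
  obtain K where K: "0 < K" "\<forall>(x::'a) R r. 0 < r \<and> r \<le> R \<longrightarrow>
      real (covering_number r (cball x R)) \<le> K * (R / r) ^ DIM('a)"
    using covering_number_cball by blast
  define c' where "c' = min c 1"
  have c': "0 < c'" "c' \<le> c" "c' \<le> 1" using assms by (auto simp: c'_def)
  show ?thesis
  proof (intro exI[of _ "K * (1 / c') ^ DIM('a)"] conjI allI impI)
    fix E :: "'a set" and r :: real assume "bounded E \<and> 0 < r"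
    then have E: "bounded E" "0 < r" by auto
    obtain C where C: "finite C" "card C = covering_number r E" "E \<subseteq> (\<Union>c\<in>C. cball c r)"
      using covering_number_attained[OF E] by metis
    have "real (covering_number (c * r) E) \<le> real (covering_number (c' * r) E)"
      using covering_number_mono[of E E "c' * r" "c * r"] E c' by (auto intro: mult_right_mono)
    also have "\<dots> \<le> real (\<Sum>x\<in>C. covering_number (c' * r) (cball x r))"
      using E c' C by (intro of_nat_mono covering_number_UN_le) auto
    also have "\<dots> \<le> (\<Sum>x\<in>C. K * (1 / c') ^ DIM('a))"
    proof (simp only: of_nat_sum, rule sum_mono)
      fix x assume "x \<in> C"
      have "c' * r \<le> r" using E c' by (simp add: mult_left_le_one_le)
      then show "real (covering_number (c' * r) (cball x r)) \<le> K * (1 / c') ^ DIM('a)"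
        using K(2)[rule_format, of "c' * r" r x] E c' by simp
    qed
    also have "\<dots> = K * (1 / c') ^ DIM('a) * real (covering_number r E)"
      using C(2) by simp
    finally show "real (covering_number (c * r) E) \<le> K * (1 / c') ^ DIM('a) * real (covering_number r E)" .
  qed (use K c' in auto)
qed

section \<open>Similarities\<close>

text \<open>Ratio and rotation are functions of the map itself, so that no witnesses need to be
  carried along; the values are meaningful only for similarities.\<close>

definition sim_ratio :: "('a::euclidean_space \<Rightarrow> 'a) \<Rightarrow> real" where
  "sim_ratio A = norm (A (SOME b. b \<in> Basis) - A 0)"

definition sim_lin :: "('a::euclidean_space \<Rightarrow> 'a) \<Rightarrow> 'a \<Rightarrow> 'a" where
  "sim_lin A x = (A x - A 0) /\<^sub>R sim_ratio A"

lemma sim_ratio_eq: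
  fixes Q :: "'a::euclidean_space \<Rightarrow> 'a"
  assumes "0 < r" "orthogonal_transformation Q"
  shows "sim_ratio (\<lambda>x. r *\<^sub>R Q x + b) = r" "sim_lin (\<lambda>x. r *\<^sub>R Q x + b) = Q"
proof -
  have "(SOME b. b \<in> Basis) \<in> (Basis :: 'a set)" by (meson someI_ex nonempty_Basis ex_in_conv)
  then have "norm (SOME b. b \<in> (Basis :: 'a set)) = 1" by simp
  moreover have "Q 0 = 0" using assms(2) by (simp add: orthogonal_transformation_def linear_0)
  ultimately show 1: "sim_ratio (\<lambda>x. r *\<^sub>R Q x + b) = r"
    using assms by (simp add: sim_ratio_def orthogonal_transformation)
  show "sim_lin (\<lambda>x. r *\<^sub>R Q x + b) = Q"
    unfolding sim_lin_def 1 using assms \<open>Q 0 = 0\<close> by auto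
qed

lemma similarity_mapE:
  assumes "similarity_map A"
  obtains Q b where "0 < sim_ratio A" "orthogonal_transformation (sim_lin A)"
    "\<And>x. A x = sim_ratio A *\<^sub>R sim_lin A x + b"
proof -
  obtain r Q b where "0 < r" "orthogonal_transformation Q" "A = (\<lambda>x. r *\<^sub>R Q x + b)"
    using assms by (auto simp: similarity_map_def similarity_with_def)
  then show thesis using that[of b] sim_ratio_eq[of r Q b] by simp
qed

lemma
  assumes "similarity_map A"
  shows sim_ratio_pos: "0 < sim_ratio A"
    and sim_lin_orthogonal: "orthogonal_transformation (sim_lin A)"
    and linear_sim_lin: "linear (sim_lin A)"
    and norm_sim_lin: "norm (sim_lin A x) = norm x"
    and sim_diff: "A x - A y = sim_ratio A *\<^sub>R sim_lin A (x - y)"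
    and sim_apply: "A x = A y + sim_ratio A *\<^sub>R sim_lin A (x - y)"
    and sim_dist: "dist (A x) (A y) = sim_ratio A * dist x y"
proof -
  obtain b where *: "0 < sim_ratio A" "orthogonal_transformation (sim_lin A)"
    "\<And>x. A x = sim_ratio A *\<^sub>R sim_lin A x + b"
    using similarity_mapE[OF assms] by metis
  show "0 < sim_ratio A" "orthogonal_transformation (sim_lin A)" by fact+
  then show l: "linear (sim_lin A)" and n: "norm (sim_lin A x) = norm x" for x
    by (auto simp: orthogonal_transformation)
  show d: "A x - A y = sim_ratio A *\<^sub>R sim_lin A (x - y)" for x y
    by (simp add: *(3)[of x] *(3)[of y] linear_diff[OF l] scaleR_diff_right)
  show "A x = A y + sim_ratio A *\<^sub>R sim_lin A (x - y)" using d[of x y] by (simp add: algebra_simps)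
  show "dist (A x) (A y) = sim_ratio A * dist x y"
    using *(1) by (simp add: dist_norm d n)
qed

lemma similarity_mapI:
  assumes "0 < r" "orthogonal_transformation Q" "\<And>x. A x = r *\<^sub>R Q x + b"
  shows "similarity_map A" "sim_ratio A = r" "sim_lin A = Q"
proof -
  have A: "A = (\<lambda>x. r *\<^sub>R Q x + b)" using assms(3) by auto
  show "similarity_map A" using assms A by (auto simp: similarity_map_def similarity_with_def)
  show "sim_ratio A = r" "sim_lin A = Q" using sim_ratio_eq[OF assms(1,2)] A by auto
qed

lemma
  assumes "similarity_map A" "similarity_map B"
  shows similarity_map_comp: "similarity_map (A \<circ> B)"
    and sim_ratio_comp: "sim_ratio (A \<circ> B) = sim_ratio A * sim_ratio B"
    and sim_lin_comp: "sim_lin (A \<circ> B) = sim_lin A \<circ> sim_lin B"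
proof -
  obtain b where b: "0 < sim_ratio A" "orthogonal_transformation (sim_lin A)"
    "\<And>x. A x = sim_ratio A *\<^sub>R sim_lin A x + b"
    using similarity_mapE[OF assms(1)] by metis
  obtain c where c: "0 < sim_ratio B" "orthogonal_transformation (sim_lin B)"
    "\<And>x. B x = sim_ratio B *\<^sub>R sim_lin B x + c"
    using similarity_mapE[OF assms(2)] by metis
  have l: "linear (sim_lin A)" using linear_sim_lin[OF assms(1)] .
  have o: "orthogonal_transformation (sim_lin A \<circ> sim_lin B)"
    using b(2) c(2) by (auto simp: orthogonal_transformation_def intro: linear_compose)
  have e: "(A \<circ> B) x = (sim_ratio A * sim_ratio B) *\<^sub>R (sim_lin A \<circ> sim_lin B) x
      + (sim_ratio A *\<^sub>R sim_lin A c + b)" for x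
    unfolding comp_def c(3)[of x] b(3)[of "_ + _"]
    by (simp add: linear_add[OF l] linear_scale[OF l] scaleR_add_right)
  show "similarity_map (A \<circ> B)" "sim_ratio (A \<circ> B) = sim_ratio A * sim_ratio B"
    "sim_lin (A \<circ> B) = sim_lin A \<circ> sim_lin B"
    using similarity_mapI[where A = "A \<circ> B", OF mult_pos_pos[OF b(1) c(1)] o e] by blast+
qed

lemma
  shows similarity_map_id: "similarity_map (id :: 'a::euclidean_space \<Rightarrow> 'a)"
    and sim_ratio_id: "sim_ratio (id :: 'a \<Rightarrow> 'a) = 1"
proof -
  have o: "orthogonal_transformation (id :: 'a \<Rightarrow> 'a)"
    by (simp add: orthogonal_transformation_def linear_id)
  have e: "(id :: 'a \<Rightarrow> 'a) x = 1 *\<^sub>R id x + 0" for x by simp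
  show "similarity_map (id :: 'a \<Rightarrow> 'a)" "sim_ratio (id :: 'a \<Rightarrow> 'a) = 1"
    using similarity_mapI[where A = "id :: 'a \<Rightarrow> 'a", OF zero_less_one o e] by blast+
qed

lemma bij_orthogonal_transformation:
  "orthogonal_transformation (Q :: 'a::euclidean_space \<Rightarrow> 'a) \<Longrightarrow> bij Q"
  by (simp add: bij_def orthogonal_transformation_inj orthogonal_transformation_surj)

lemma bij_similarity_map:
  assumes "similarity_map A" shows "bij A"
proof -
  obtain b where b: "0 < sim_ratio A" "orthogonal_transformation (sim_lin A)"
    "\<And>x. A x = sim_ratio A *\<^sub>R sim_lin A x + b"
    using similarity_mapE[OF assms] by metis
  have "inj A" by (rule injI) (use sim_dist[OF assms] b(1) in \<open>metis dist_eq_0_iff mult_eq_0_iff less_irrefl\<close>)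
  moreover have "surj A"
  proof (rule surjI)
    fix y
    show "A (inv (sim_lin A) ((y - b) /\<^sub>R sim_ratio A)) = y"
      using b(1) by (simp add: b(3)[of "inv _ _"] surj_f_inv_f[OF orthogonal_transformation_surj[OF b(2)]])
  qed
  ultimately show ?thesis by (simp add: bij_def)
qed

lemma
  assumes "similarity_map A"
  shows sim_inv_apply [simp]: "inv A (A x) = x"
    and sim_apply_inv [simp]: "A (inv A x) = x"
    and norm_inv_sim_lin: "norm (inv (sim_lin A) x) = norm x"
    and inv_sim_lin_apply: "inv (sim_lin A) (sim_lin A x) = x"
    and sim_lin_inv_apply: "sim_lin A (inv (sim_lin A) x) = x"
    and linear_inv_sim_lin: "linear (inv (sim_lin A))"
proof -
  show "inv A (A x) = x" "A (inv A x) = x"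
    using bij_similarity_map[OF assms] by (simp_all add: bij_def surj_f_inv_f)
  have b: "bij (sim_lin A)" using bij_orthogonal_transformation sim_lin_orthogonal[OF assms] by blast
  then show 1: "inv (sim_lin A) (sim_lin A x) = x" and 2: "sim_lin A (inv (sim_lin A) x) = x" for x
    by (simp_all add: bij_def surj_f_inv_f)
  show "norm (inv (sim_lin A) x) = norm x" using norm_sim_lin[OF assms, of "inv (sim_lin A) x"] 2 by simp
  show "linear (inv (sim_lin A))"
    using sim_lin_orthogonal[OF assms] orthogonal_transformation_inv orthogonal_transformation_linear by blast
qed

lemma
  assumes "similarity_map A"
  shows similarity_map_inv: "similarity_map (inv A)"
    and sim_ratio_inv: "sim_ratio (inv A) = 1 / sim_ratio A"
proof -
  have o: "orthogonal_transformation (inv (sim_lin A))"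
    using sim_lin_orthogonal[OF assms] orthogonal_transformation_inv by blast
  have e: "inv A x = (1 / sim_ratio A) *\<^sub>R inv (sim_lin A) x + inv A 0" for x
  proof -
    have "inv (sim_lin A) x = sim_ratio A *\<^sub>R (inv A x - inv A 0)"
      using arg_cong[OF sim_diff[OF assms, of "inv A x" "inv A 0"], of "inv (sim_lin A)"] assms
      by (simp add: linear_scale[OF linear_inv_sim_lin[OF assms]] inv_sim_lin_apply[OF assms])
    then show ?thesis using sim_ratio_pos[OF assms] by simp
  qed
  show "similarity_map (inv A)" "sim_ratio (inv A) = 1 / sim_ratio A"
    using similarity_mapI[OF _ o e] sim_ratio_pos[OF assms] by auto
qed

lemma inv_sim_comp:
  assumes "similarity_map A" "similarity_map B"
  shows "inv (A \<circ> B) = inv B \<circ> inv A"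
  using assms by (simp add: o_inv_distrib bij_similarity_map)

lemma contracting_similarity_iff:
  "contracting_similarity A \<longleftrightarrow> similarity_map A \<and> sim_ratio A < 1"
proof
  assume "contracting_similarity A"
  then obtain r Q b where "0 < r" "r < 1" "orthogonal_transformation Q" "A = (\<lambda>x. r *\<^sub>R Q x + b)"
    by (auto simp: contracting_similarity_def similarity_with_def)
  then show "similarity_map A \<and> sim_ratio A < 1" using similarity_mapI[of r Q A b] by auto
next
  assume A: "similarity_map A \<and> sim_ratio A < 1"
  then show "contracting_similarity A"
    by (metis contracting_similarity_def similarity_with_def similarity_mapE ext)
qed

lemma bounded_similarity_image:
  assumes "similarity_map A" "bounded E"
  shows "bounded (A ` E)"
proof -
  obtain x B where x: "\<forall>y\<in>E. dist x y \<le> B" using assms(2) by (auto simp: bounded_def)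
  have "\<forall>y\<in>A`E. dist (A x) y \<le> sim_ratio A * B"
    using x sim_ratio_pos[OF assms(1)] by (auto simp: sim_dist[OF assms(1)])
  then show ?thesis unfolding bounded_def by blast
qed

lemma covering_number_similarity:
  assumes "similarity_map A" "bounded E" "0 < r"
  shows "covering_number (sim_ratio A * r) (A ` E) = covering_number r E"
proof (rule antisym)
  show "covering_number (sim_ratio A * r) (A ` E) \<le> covering_number r E"
    using sim_ratio_pos[OF assms(1)] assms by (intro covering_number_Lipschitz_image) (auto simp: sim_dist)
  have "bounded (A ` E)" using bounded_similarity_image[OF assms(1,2)] .
  then have "covering_number (sim_ratio (inv A) * (sim_ratio A * r)) (inv A ` A ` E)
      \<le> covering_number (sim_ratio A * r) (A ` E)"
    using sim_ratio_pos[OF assms(1)] sim_ratio_pos[OF similarity_map_inv[OF assms(1)]] assms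
      sim_dist[OF similarity_map_inv[OF assms(1)]]
    by (intro covering_number_Lipschitz_image) auto
  moreover have "inv A ` A ` E = E"
    using bij_similarity_map[OF assms(1)] by (simp add: bij_def image_inv_f_f)
  moreover have "sim_ratio (inv A) * (sim_ratio A * r) = r"
    using sim_ratio_pos[OF assms(1)] by (simp add: sim_ratio_inv[OF assms(1)])
  ultimately show "covering_number r E \<le> covering_number (sim_ratio A * r) (A ` E)" by simp
qed

section \<open>Semigroups of contracting similarities\<close>

text \<open>The blow-up mechanism: a displacement \<open>w\<close> at \<open>U x\<close>, seen
  through \<open>inv U\<close>, is divided by the ratio of U and rotated back.\<close>

lemma sim_inv_add:
  assumes "similarity_map U"
  shows "inv U (U x + w) = x + (1 / sim_ratio U) *\<^sub>R inv (sim_lin U) w"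
proof -
  have "U (x + (1 / sim_ratio U) *\<^sub>R inv (sim_lin U) w) = U x + w"
    using sim_ratio_pos[OF assms] assms
    by (simp add: sim_apply[OF assms, of "x + _" x] linear_scale[OF linear_sim_lin] sim_lin_inv_apply)
  then show ?thesis using sim_inv_apply[OF assms] by metis
qed

lemma
  assumes "similarity_map A"
  shows similarity_map_funpow: "similarity_map (A ^^ n)"
    and sim_ratio_funpow: "sim_ratio (A ^^ n) = sim_ratio A ^ n"
proof (induction n)
  case 0
  {case 1 then show ?case by (simp add: similarity_map_id flip: id_def)}
  {case 2 then show ?case by (simp add: sim_ratio_id flip: id_def)}
next
  case (Suc n)
  {case 1 show ?case unfolding funpow.simps(2) by (rule similarity_map_comp[OF assms Suc(1)])}
  {case 2 show ?case unfolding funpow.simps(2) by (simp only: sim_ratio_comp[OF assms Suc(1)] Suc(2) power_Suc)}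
qed

text \<open>For the closed paths at \<open>i\<close>, a piece \<open>S\<^sub>p(F\<^sub>j)\<close> of \<open>F\<^sub>i\<close> is contained in \<open>A(B\<^sup>-\<^sup>1(F\<^sub>i))\<close>, where \<open>A\<close> and \<open>B\<close> arise by
  continuing \<open>p\<close> and some path from \<open>i\<close> to \<open>j\<close> by the same path back to \<open>i\<close>. Hence the form of the assumption
  \<open>cover\<close>, which refers to the single set \<^term>\<open>F\<close> only.\<close>
locale loop_semigroup =
  fixes L :: "('a::euclidean_space \<Rightarrow> 'a) set" and F :: "'a set"
  assumes sim: "A \<in> L \<Longrightarrow> similarity_map A"
    and ratio_less_1: "A \<in> L \<Longrightarrow> sim_ratio A < 1"
    and comp_in: "A \<in> L \<Longrightarrow> B \<in> L \<Longrightarrow> A \<circ> B \<in> L"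
    and compact_F: "compact F"
    and F_nonempty: "F \<noteq> {}"
    and maps_F: "A \<in> L \<Longrightarrow> x \<in> F \<Longrightarrow> A x \<in> F"
    and cover: "\<exists>\<B> c. finite \<B> \<and> \<B> \<subseteq> L \<and> 0 < c \<and> (\<forall>a\<in>F. \<forall>\<delta>. 0 < \<delta> \<and> \<delta> \<le> 1 \<longrightarrow>
      (\<exists>A\<in>L. \<exists>B\<in>\<B>. \<exists>z. c * \<delta> \<le> sim_ratio A \<and> sim_ratio A \<le> \<delta> \<and> B z \<in> F \<and> A z = a))"
begin

lemma ratio_pos: "A \<in> L \<Longrightarrow> 0 < sim_ratio A"
  using sim sim_ratio_pos by blast

lemma L_nonempty: "L \<noteq> {}"
proof -
  obtain \<B> and c :: real where "\<forall>a\<in>F. \<forall>\<delta>. 0 < \<delta> \<and> \<delta> \<le> 1 \<longrightarrow>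
      (\<exists>A\<in>L. \<exists>B\<in>\<B>. \<exists>z. c * \<delta> \<le> sim_ratio A \<and> sim_ratio A \<le> \<delta> \<and> B z \<in> F \<and> A z = a)"
    using cover by blast
  then show ?thesis using F_nonempty by (metis empty_iff ex_in_conv order.refl zero_less_one)
qed

lemma bounded_F: "bounded F"
  using compact_F compact_imp_bounded by blast

lemma F_bound: "\<exists>M>0. \<forall>x\<in>F. norm x \<le> M"
  using bounded_F bounded_pos by blast

lemma funpow_in: "A \<in> L \<Longrightarrow> 0 < n \<Longrightarrow> A ^^ n \<in> L"
proof (induction n)
  case (Suc n)
  then show ?case
    unfolding funpow.simps(2) by (cases "n = 0") (simp_all only: funpow.simps comp_id comp_in)
qed simp

text \<open>The bound is uniform in A: a point of F stays in F, and A contracts the distance to it.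
  This allows an outer map to be fixed before the inner ones are known.\<close>

lemma norm_L_le:
  assumes "A \<in> L" "\<forall>x\<in>F. norm x \<le> M"
  shows "norm (A x) \<le> norm x + 2 * M"
proof -
  obtain p where p: "p \<in> F" using F_nonempty by blast
  have 1: "norm (A x) \<le> norm (A p) + dist (A x) (A p)"
    by (metis dist_norm norm_triangle_sub)
  have 2: "dist (A x) (A p) \<le> dist x p"
    using ratio_less_1[OF assms(1)] by (simp add: sim_dist[OF sim[OF assms(1)]] mult_left_le_one_le
        ratio_pos[OF assms(1)] less_imp_le)
  have 3: "dist x p \<le> norm x + norm p" by (simp add: dist_norm norm_triangle_ineq4)
  have "norm p \<le> M" "norm (A p) \<le> M" using assms p maps_F[OF assms(1) p] by auto
  then show ?thesis using 1 2 3 by linarith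
qed

text \<open>The point z supplied by \<open>cover\<close> may lie outside F, but
  \<open>B z \<in> F\<close> with B from a finite set keeps it at bounded distance from F. Hence A
  maps all of F close to \<open>A z = a\<close>.\<close>

lemma small_piece:
  "\<exists>c>0. \<forall>a\<in>F. \<forall>\<delta>. 0 < \<delta> \<and> \<delta> \<le> 1 \<longrightarrow>
     (\<exists>A\<in>L. c * \<delta> \<le> sim_ratio A \<and> sim_ratio A \<le> \<delta> \<and> (\<forall>x\<in>F. dist (A x) a \<le> \<delta>))"
proof -
  obtain \<B> c where B: "finite \<B>" "\<B> \<subseteq> L" "0 < c" "\<forall>a\<in>F. \<forall>\<delta>. 0 < \<delta> \<and> \<delta> \<le> 1 \<longrightarrow>
      (\<exists>A\<in>L. \<exists>B\<in>\<B>. \<exists>z. c * \<delta> \<le> sim_ratio A \<and> sim_ratio A \<le> \<delta> \<and> B z \<in> F \<and> A z = a)"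
    using cover by metis
  obtain M where M: "0 < M" "\<forall>x\<in>F. norm x \<le> M" using F_bound by blast
  define \<beta> where "\<beta> = Min (insert 1 (sim_ratio ` \<B>))"
  have \<beta>: "0 < \<beta>" "\<And>B. B \<in> \<B> \<Longrightarrow> \<beta> \<le> sim_ratio B"
    using B(1,2) ratio_pos by (auto simp: \<beta>_def)
  \<comment> \<open>An upper bound for the distance from z to the points of F; applying
    \<open>cover\<close> at the scale \<open>\<delta> / q\<close> compensates for it.\<close>
  define q where "q = 1 + 2 * M / \<beta>"
  have q: "1 \<le> q" "2 * M / \<beta> \<le> q" using \<beta>(1) M(1) by (auto simp: q_def)
  have "\<exists>A\<in>L. c / q * \<delta> \<le> sim_ratio A \<and> sim_ratio A \<le> \<delta> \<and> (\<forall>x\<in>F. dist (A x) a \<le> \<delta>)"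
    if a: "a \<in> F" and d: "0 < \<delta>" "\<delta> \<le> 1" for a \<delta>
  proof -
    have dq: "0 < \<delta> / q" "\<delta> / q \<le> \<delta>" using d q(1) by (auto simp: divide_le_eq)
    then have "\<delta> / q \<le> 1" using d by linarith
    then obtain A B z where A: "A \<in> L" "B \<in> \<B>" "c * (\<delta> / q) \<le> sim_ratio A" "sim_ratio A \<le> \<delta> / q"
      "B z \<in> F" "A z = a" using B(4) a dq by blast
    have "dist (A x) a \<le> \<delta>" if x: "x \<in> F" for x
    proof -
      have BL: "B \<in> L" using A B by blast
      have "\<beta> * dist x z \<le> sim_ratio B * dist x z"
        using \<beta>(2)[OF A(2)] by (intro mult_right_mono) auto
      also have "\<dots> = dist (B x) (B z)" by (simp add: sim_dist[OF sim[OF BL]])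
      also have "\<dots> \<le> norm (B x) + norm (B z)" by (simp add: dist_norm norm_triangle_ineq4)
      also have "\<dots> \<le> 2 * M" using bspec[OF M(2) maps_F[OF BL x]] bspec[OF M(2) A(5)] by linarith
      finally have "dist x z \<le> 2 * M / \<beta>" using \<beta>(1) by (simp add: le_divide_eq mult.commute)
      then have "dist x z \<le> q" using q by linarith
      have "dist (A x) a = sim_ratio A * dist x z"
        using A(6) sim_dist[OF sim[OF A(1)], of x z] by simp
      also have "\<dots> \<le> (\<delta> / q) * q"
        using A(4) \<open>dist x z \<le> q\<close> dq by (intro mult_mono) auto
      finally show ?thesis using q by simp
    qed
    then show ?thesis using A dq by (intro bexI[of _ A]) auto
  qed
  moreover have "0 < c / q" using B(3) q(1) by simp
  ultimately show ?thesis by blast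
qed

lemma small_piece_ball:
  assumes "a \<in> F" "0 < \<delta>"
  shows "\<exists>P\<in>L. \<forall>x. norm x \<le> R \<longrightarrow> dist (P x) a \<le> \<delta>"
proof -
  obtain M where M: "0 < M" "\<forall>x\<in>F. norm x \<le> M" using F_bound by blast
  define d where "d = min 1 (\<delta> / (\<bar>R\<bar> + M + 1))"
  have d: "0 < d" "d \<le> 1" "d * (\<bar>R\<bar> + M + 1) \<le> \<delta>"
    using assms M by (auto simp: d_def min_def le_divide_eq add_pos_nonneg)
  then obtain P where P: "P \<in> L" "sim_ratio P \<le> d" "\<forall>x\<in>F. dist (P x) a \<le> d"
    using small_piece assms(1) by blast
  obtain p where p: "p \<in> F" using F_nonempty by blast
  have "dist (P x) a \<le> \<delta>" if x: "norm x \<le> R" for x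
  proof -
    have "dist (P x) a \<le> dist (P x) (P p) + dist (P p) a" by (rule dist_triangle)
    also have "dist (P x) (P p) = sim_ratio P * dist x p" by (rule sim_dist[OF sim[OF P(1)]])
    also have "\<dots> \<le> d * (\<bar>R\<bar> + M)"
    proof (intro mult_mono)
      show "dist x p \<le> \<bar>R\<bar> + M"
        using norm_triangle_ineq4[of x p] M(2) p x by (fastforce simp: dist_norm)
    qed (use P d in auto)
    also have "dist (P p) a \<le> d" using P(3) p by blast
    finally show ?thesis using d(3) by (simp add: algebra_simps)
  qed
  then show ?thesis using P(1) by blast
qed

text \<open>The rotation parts of \<^term>\<open>L\<close> form a relatively compact semigroup of isometries, hence inverses
  can be approximated within \<^term>\<open>L\<close>, and by finitely many elements.\<close>

lemma finite_inverse_net: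
  assumes "0 < \<eta>"
  shows "\<exists>I. finite I \<and> I \<subseteq> L \<and> (\<forall>Y\<in>L. \<exists>X\<in>I. \<forall>x. norm (sim_lin X (sim_lin Y x) - x) \<le> \<eta> * norm x)"
proof -
  define \<epsilon> where "\<epsilon> = \<eta> / (4 * DIM('a))"
  have \<epsilon>: "0 < \<epsilon>" using assms by (simp add: \<epsilon>_def)
  have "compact (cball 0 1 :: 'a set)" by simp
  then have "\<exists>k. finite k \<and> cball 0 1 \<subseteq> (\<Union>x\<in>k. ball (x::'a) \<epsilon>)"
    using \<epsilon> by (simp add: compact_eq_totally_bounded)
  then obtain N where N: "finite N" "cball 0 1 \<subseteq> (\<Union>x\<in>N. ball (x::'a) \<epsilon>)" by blast
  have "\<exists>c\<in>N. dist c y < \<epsilon>" if "norm y \<le> 1" for y :: 'a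
    using N(2) that by (auto simp: subset_iff)
  then obtain g where g: "\<And>y. norm y \<le> 1 \<Longrightarrow> g y \<in> N \<and> dist (g y) y < \<epsilon>" by metis
  \<comment> \<open>Encodes a rotation by approximate images of the basis vectors. There are
    finitely many codes, and equal codes mean close rotations.\<close>
  define \<phi> where "\<phi> X = (\<lambda>b\<in>(Basis::'a set). g (sim_lin X b))" for X :: "'a \<Rightarrow> 'a"
  have phi_in: "\<phi> X \<in> Basis \<rightarrow>\<^sub>E N" if "X \<in> L" for X
    using g norm_sim_lin[OF sim[OF that]] by (auto simp: \<phi>_def)
  have fin: "finite (Basis \<rightarrow>\<^sub>E N)" using N(1) by (intro finite_PiE) auto
  have close: "norm (sim_lin X x - sim_lin Z x) \<le> \<eta> / 2 * norm x"
    if XZ: "X \<in> L" "Z \<in> L" "\<phi> X = \<phi> Z" for X Z x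
  proof -
    have lX: "linear (sim_lin X)" and lZ: "linear (sim_lin Z)" using linear_sim_lin sim XZ by blast+
    have "norm (sim_lin X x - sim_lin Z x)
        = norm (\<Sum>b\<in>Basis. (x \<bullet> b) *\<^sub>R (sim_lin X b - sim_lin Z b))"
      by (subst (1 2) euclidean_representation[of x, symmetric])
        (simp only: linear_sum[OF lX] linear_sum[OF lZ] linear_scale[OF lX] linear_scale[OF lZ]
          scaleR_diff_right sum_subtractf)
    also have "\<dots> \<le> (\<Sum>b\<in>(Basis::'a set). norm x * (2 * \<epsilon>))"
    proof (rule sum_norm_le)
      fix b :: 'a assume b: "b \<in> Basis"
      have "norm (sim_lin X b) \<le> 1" "norm (sim_lin Z b) \<le> 1" "g (sim_lin X b) = g (sim_lin Z b)"
        using norm_sim_lin[OF sim] XZ(1,2) b fun_cong[OF XZ(3), of b] by (auto simp: \<phi>_def)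
      then have "dist (g (sim_lin X b)) (sim_lin X b) < \<epsilon>" "dist (g (sim_lin X b)) (sim_lin Z b) < \<epsilon>"
        using g by metis+
      then have "norm (sim_lin X b - sim_lin Z b) \<le> 2 * \<epsilon>"
        using dist_triangle2[of "sim_lin X b" "sim_lin Z b" "g (sim_lin X b)"]
        by (simp add: dist_commute dist_norm)
      moreover have "\<bar>x \<bullet> b\<bar> \<le> norm x" by (rule Basis_le_norm[OF b])
      ultimately show "norm ((x \<bullet> b) *\<^sub>R (sim_lin X b - sim_lin Z b)) \<le> norm x * (2 * \<epsilon>)"
        by (simp add: mult_mono)
    qed
    also have "\<dots> = \<eta> / 2 * norm x" by (simp add: \<epsilon>_def)
    finally show ?thesis .
  qed
  \<comment> \<open>One representative per code that occurs; this makes the resulting set finite and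
    independent of Y.\<close>
  define rep where "rep f = (SOME X. X \<in> L \<and> \<phi> X = f)" for f
  have rep: "rep (\<phi> X) \<in> L" "\<phi> (rep (\<phi> X)) = \<phi> X" if "X \<in> L" for X
    unfolding rep_def using someI[of "\<lambda>Z. Z \<in> L \<and> \<phi> Z = \<phi> X" X] that by auto
  define I where "I = rep ` \<phi> ` L"
  have "finite (\<phi> ` L)" using phi_in by (intro finite_subset[OF _ fin]) auto
  then have "finite I" by (simp add: I_def)
  moreover have "I \<subseteq> L" using rep by (auto simp: I_def)
  moreover have "\<exists>X\<in>I. \<forall>x. norm (sim_lin X (sim_lin Y x) - x) \<le> \<eta> * norm x" if Y: "Y \<in> L" for Y
  proof -
    \<comment> \<open>By the pigeonhole principle two powers of Y have the same code. The exponents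
      are even and positive: after one factor Y is split off from their difference, a positive power
      remains, as is necessary since L does not contain the identity.\<close>
    have Yn: "Y ^^ (2 * m + 2) \<in> L" for m by (rule funpow_in[OF Y]) simp
    have "finite ((\<lambda>m. \<phi> (Y ^^ (2 * m + 2))) ` UNIV)"
      using phi_in[OF Yn] by (intro finite_subset[OF _ fin]) auto
    then have "\<not> inj (\<lambda>m. \<phi> (Y ^^ (2 * m + 2)))" using finite_imageD by fastforce
    then obtain m m' where m: "m < m'" "\<phi> (Y ^^ (2 * m + 2)) = \<phi> (Y ^^ (2 * m' + 2))"
      by (metis (mono_tags, lifting) injI linorder_neqE_nat)
    define n where "n = 2 * (m' - m) - 1"
    have n: "0 < n" using m(1) by (simp add: n_def)
    define Z where "Z = Y ^^ n"
    have Z: "Z \<in> L" using funpow_in[OF Y n] by (simp add: Z_def)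
    have e: "Y ^^ (2 * m' + 2) = Z \<circ> Y \<circ> Y ^^ (2 * m + 2)"
    proof -
      have "Z \<circ> Y = Y ^^ (n + 1)" by (simp only: Z_def funpow_add One_nat_def funpow.simps comp_id)
      moreover have "2 * m' + 2 = (n + 1) + (2 * m + 2)" using m(1) by (simp add: n_def)
      ultimately show ?thesis by (metis funpow_add)
    qed
    have le: "sim_lin (Y ^^ (2 * m' + 2)) x = sim_lin Z (sim_lin Y (sim_lin (Y ^^ (2 * m + 2)) x))" for x
      unfolding e using sim_lin_comp[OF sim[OF comp_in[OF Z Y]] sim[OF Yn]]
        sim_lin_comp[OF sim[OF Z] sim[OF Y]] by simp
    have Zc: "norm (sim_lin Z (sim_lin Y x) - x) \<le> \<eta> / 2 * norm x" for x
    proof -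
      define y where "y = inv (sim_lin (Y ^^ (2 * m + 2))) x"
      have y: "sim_lin (Y ^^ (2 * m + 2)) y = x" "norm y = norm x"
        using sim_lin_inv_apply[OF sim[OF Yn]] norm_inv_sim_lin[OF sim[OF Yn]] by (auto simp: y_def)
      show ?thesis
        using close[OF Yn Yn m(2), of y] y unfolding le[of y] by (simp add: norm_minus_commute)
    qed
    define X where "X = rep (\<phi> Z)"
    have X: "X \<in> I" "X \<in> L" "\<phi> X = \<phi> Z" using Z rep by (auto simp: X_def I_def)
    have "norm (sim_lin X (sim_lin Y x) - x) \<le> \<eta> * norm x" for x
    proof -
      have "norm (sim_lin X (sim_lin Y x) - x) \<le> norm (sim_lin X (sim_lin Y x) - sim_lin Z (sim_lin Y x))
          + norm (sim_lin Z (sim_lin Y x) - x)"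
        using norm_triangle_ineq[of "sim_lin X (sim_lin Y x) - sim_lin Z (sim_lin Y x)" "sim_lin Z (sim_lin Y x) - x"]
        by simp
      also have "\<dots> \<le> \<eta> / 2 * norm (sim_lin Y x) + \<eta> / 2 * norm x"
        using close[OF X(2) Z X(3), of "sim_lin Y x"] Zc[of x] by linarith
      finally show ?thesis using norm_sim_lin[OF sim[OF Y], of x] by simp
    qed
    then show ?thesis using X(1) by blast
  qed
  ultimately show ?thesis by blast
qed

subsection \<open>Translations in the closure of the return maps\<close>

text \<open>The composition of two return maps is not a return map, but it becomes one when the first is conjugated;
  quantifying over the conjugating map \<open>A\<close> makes the following set closed under addition.\<close>
definition limit_translations :: "'a set" where
  "limit_translations = {w. \<forall>A\<in>L. \<forall>\<eta>>0. \<forall>R. \<exists>C\<in>L. \<exists>D\<in>L. \<forall>x. norm x \<le> R \<longrightarrow>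
     norm (inv A (inv C (D (A x))) - x - w) \<le> \<eta>}"

lemma limit_translationsD:
  assumes "w \<in> limit_translations" "A \<in> L" "0 < \<eta>"
  shows "\<exists>C\<in>L. \<exists>D\<in>L. \<forall>x. norm x \<le> R \<longrightarrow> norm (inv A (inv C (D (A x))) - x - w) \<le> \<eta>"
  using assms unfolding limit_translations_def by blast

lemma inv_comp_apply: "A \<in> L \<Longrightarrow> B \<in> L \<Longrightarrow> inv (A \<circ> B) x = inv B (inv A x)"
  by (simp add: inv_sim_comp sim)

lemma limit_translations_0: "0 \<in> limit_translations"
proof -
  obtain C where "C \<in> L" using L_nonempty by blast
  then show ?thesis
    unfolding limit_translations_def by (auto intro!: bexI[of _ C] simp: sim)
qed

text \<open>The quantifier over A is used here: \<open>w1\<close> is approximated with the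
  conjugating map \<open>C2 \<circ> A\<close>, so that the inner \<open>C2\<close> cancels against
  \<open>inv C2\<close> and the composition is again a single return map, conjugated by A.\<close>

lemma limit_translations_add:
  assumes w1: "w1 \<in> limit_translations" and w2: "w2 \<in> limit_translations"
  shows "w1 + w2 \<in> limit_translations"
  unfolding limit_translations_def
proof (intro CollectI ballI allI impI)
  fix A and \<eta> R :: real assume A: "A \<in> L" and \<eta>: "0 < \<eta>"
  obtain C2 D2 where 2: "C2 \<in> L" "D2 \<in> L"
    "\<forall>x. norm x \<le> R \<longrightarrow> norm (inv A (inv C2 (D2 (A x))) - x - w2) \<le> \<eta> / 2"
    using limit_translationsD[OF w2 A, of "\<eta> / 2" R] \<eta> by auto
  have C2A: "C2 \<circ> A \<in> L" using 2 A comp_in by blast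
  define R' where "R' = R + norm w2 + \<eta>"
  obtain C1 D1 where 1: "C1 \<in> L" "D1 \<in> L"
    "\<forall>x. norm x \<le> R' \<longrightarrow> norm (inv (C2 \<circ> A) (inv C1 (D1 ((C2 \<circ> A) x))) - x - w1) \<le> \<eta> / 2"
    using limit_translationsD[OF w1 C2A, of "\<eta> / 2" R'] \<eta> by auto
  have "norm (inv A (inv (C1 \<circ> C2) ((D1 \<circ> D2) (A x))) - x - (w1 + w2)) \<le> \<eta>" if x: "norm x \<le> R" for x
  proof -
    define y where "y = inv A (inv C2 (D2 (A x)))"
    have e2: "norm (y - x - w2) \<le> \<eta> / 2" using 2 x by (auto simp: y_def)
    have "norm y \<le> norm x + norm w2 + norm (y - x - w2)"
      using norm_triangle_ineq[of "x + w2" "y - x - w2"] norm_triangle_ineq[of x w2] by simp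
    then have "norm y \<le> R'" using e2 x \<eta> by (simp add: R'_def)
    moreover have "inv (C2 \<circ> A) (inv C1 (D1 ((C2 \<circ> A) y))) = inv A (inv (C1 \<circ> C2) ((D1 \<circ> D2) (A x)))"
      using 1 2 A by (simp add: inv_comp_apply y_def sim)
    ultimately have "norm (inv A (inv (C1 \<circ> C2) ((D1 \<circ> D2) (A x))) - y - w1) \<le> \<eta> / 2"
      using 1(3) by metis
    then show ?thesis
      using norm_triangle_ineq[of "inv A (inv (C1 \<circ> C2) ((D1 \<circ> D2) (A x))) - y - w1" "y - x - w2"] e2
      by (simp add: algebra_simps)
  qed
  then show "\<exists>C\<in>L. \<exists>D\<in>L. \<forall>x. norm x \<le> R \<longrightarrow> norm (inv A (inv C (D (A x))) - x - (w1 + w2)) \<le> \<eta>"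
    using 1 2 comp_in by blast
qed

text \<open>Exchanging C and D inverts the map. Being close to a translation on a ball containing
  the unit vectors forces the ratio to be at least \<open>1 / 2\<close>, so that the inverse at most
  doubles the error.\<close>

lemma limit_translations_uminus:
  assumes w: "w \<in> limit_translations"
  shows "- w \<in> limit_translations"
  unfolding limit_translations_def
proof (intro CollectI ballI allI impI)
  fix A and \<eta> R :: real assume A: "A \<in> L" and \<eta>: "0 < \<eta>"
  \<comment> \<open>The value \<open>1 / 4\<close> yields the lower bound for the ratio,
    \<open>\<eta> / 2\<close> pays for the doubled error.\<close>
  define \<eta>' where "\<eta>' = min (\<eta> / 2) (1 / 4)"
  have \<eta>': "0 < \<eta>'" "\<eta>' \<le> \<eta> / 2" "\<eta>' \<le> 1/4" using \<eta> by (auto simp: \<eta>'_def)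
  define R' where "R' = \<bar>R\<bar> + norm w + 1"
  obtain C D where CD: "C \<in> L" "D \<in> L"
    "\<forall>x. norm x \<le> R' \<longrightarrow> norm (inv A (inv C (D (A x))) - x - w) \<le> \<eta>'"
    using limit_translationsD[OF w A \<eta>'(1)] by blast
  define g where "g = inv A \<circ> inv C \<circ> D \<circ> A"
  have g: "similarity_map g"
    unfolding g_def using A CD by (intro similarity_map_comp similarity_map_inv sim) auto
  have g': "norm (g x - x - w) \<le> \<eta>'" if "norm x \<le> R'" for x using CD(3) that by (simp add: g_def)
  have gi: "inv A (inv D (C (A (g x)))) = x" for x using A CD by (simp add: g_def sim)
  have ratio: "1 / 2 \<le> sim_ratio g"
  proof -
    obtain b :: 'a where b: "b \<in> Basis" using nonempty_Basis by blast
    have "norm (g b - g 0 - b) \<le> 2 * \<eta>'"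
      using g'[of b] g'[of 0] norm_triangle_ineq4[of "g b - b - w" "g 0 - 0 - w"] b
      by (simp add: R'_def algebra_simps)
    then have "1 - 2 * \<eta>' \<le> norm (g b - g 0)"
      using norm_triangle_ineq2[of b "g b - g 0"] b by (simp add: norm_minus_commute) 
    also have "\<dots> = sim_ratio g" using sim_dist[OF g, of b 0] b by (simp add: dist_norm)
    finally show ?thesis using \<eta>'(3) by linarith
  qed
  have "norm (inv A (inv D (C (A x))) - x - - w) \<le> \<eta>" if x: "norm x \<le> R" for x
  proof -
    define y where "y = inv A (inv D (C (A x)))"
    have gy: "g y = x" using A CD by (simp add: g_def y_def sim)
    define z where "z = x - w"
    have "norm z \<le> R'" using norm_triangle_ineq4[of x w] x by (simp add: z_def R'_def)
    then have "norm (g z - x) \<le> \<eta>'" using g'[of z] by (simp add: z_def)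
    then have "sim_ratio g * dist z y \<le> \<eta>'" using sim_dist[OF g, of z y] gy by (simp add: dist_norm)
    moreover have "1 / 2 * dist z y \<le> sim_ratio g * dist z y" using ratio by (intro mult_right_mono) auto
    ultimately have "dist z y \<le> \<eta>" using \<eta>'(2) by linarith
    then show ?thesis by (simp add: z_def y_def dist_norm norm_minus_commute algebra_simps)
  qed
  then show "\<exists>C\<in>L. \<exists>D\<in>L. \<forall>x. norm x \<le> R \<longrightarrow> norm (inv A (inv C (D (A x))) - x - - w) \<le> \<eta>"
    using CD by blast
qed

lemma limit_translations_return:
  assumes "w \<in> limit_translations" "0 < \<eta>"
  shows "\<exists>C\<in>L. \<exists>D\<in>L. \<forall>x. norm x \<le> R \<longrightarrow> norm (inv C (D x) - x - w) \<le> \<eta>"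
proof -
  obtain A where A: "A \<in> L" using L_nonempty by blast
  obtain C D where CD: "C \<in> L" "D \<in> L"
    "\<forall>x. norm x \<le> R \<longrightarrow> norm (inv A (inv C (D (A x))) - x - w) \<le> \<eta>"
    using limit_translationsD[OF assms(1) A assms(2)] by blast
  then show ?thesis
    using A comp_in by (intro bexI[of _ "C \<circ> A"] bexI[of _ "D \<circ> A"]) (auto simp: inv_comp_apply)
qed

text \<open>The lower bound \<open>c\<close> is uniform in \<open>A\<close>, so that boundedly many of these maps compose to
  approximate the translation by a prescribed multiple of \<^term>\<open>w\<close>, with the same relative error.\<close>
definition near_translations :: "'a \<Rightarrow> bool" where
  "near_translations w \<longleftrightarrow> (\<forall>\<eta>>0. \<forall>\<epsilon>>0. \<forall>R. \<exists>c>0. \<forall>A\<in>L. \<exists>v. c \<le> v \<and> v \<le> \<epsilon> \<and>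
     (\<exists>C\<in>L. \<exists>D\<in>L. \<forall>x. norm x \<le> R \<longrightarrow> norm (inv A (inv C (D (A x))) - x - v *\<^sub>R w) \<le> \<eta> * v))"

text \<open>A walk along \<open>w\<close> with steps of length between c and \<epsilon>, stopped
  within \<epsilon> of the goal. Since the error of each step is relative to its length, the total
  error is at most \<open>\<eta>' * t\<close>, however many steps are taken.\<close>

lemma near_translations_imp:
  assumes w: "near_translations w" and t: "0 \<le> t"
  shows "t *\<^sub>R w \<in> limit_translations"
  unfolding limit_translations_def
proof (intro CollectI ballI allI impI)
  fix A and \<eta> R :: real assume A: "A \<in> L" and \<eta>: "0 < \<eta>"
  define \<eta>' where "\<eta>' = \<eta> / (2 * (t + 1))"
  define \<epsilon> where "\<epsilon> = \<eta> / (2 * (norm w + 1))"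
  have pos: "0 < \<eta>'" "0 < \<epsilon>" using t \<eta> by (auto simp: \<eta>'_def \<epsilon>_def add_nonneg_pos)
  have \<eta>'t: "\<eta>' * t \<le> \<eta> / 2" using t \<eta> by (simp add: \<eta>'_def field_simps)
  have \<epsilon>w: "\<epsilon> * norm w \<le> \<eta> / 2" 
  proof -
    have "norm w / (norm w + 1) \<le> 1" by (simp add: divide_le_eq add_nonneg_pos)
    then have "\<eta> / 2 * (norm w / (norm w + 1)) \<le> \<eta> / 2 * 1" using \<eta> by (intro mult_left_mono) auto
    then show ?thesis by (simp add: \<epsilon>_def)
  qed
  define R' where "R' = R + t * norm w + \<eta>"
  obtain c where c: "0 < c" "\<forall>A\<in>L. \<exists>v. c \<le> v \<and> v \<le> \<epsilon> \<and>
     (\<exists>C\<in>L. \<exists>D\<in>L. \<forall>x. norm x \<le> R' \<longrightarrow> norm (inv A (inv C (D (A x))) - x - v *\<^sub>R w) \<le> \<eta>' * v)"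
    using w[unfolded near_translations_def, THEN spec, THEN mp, OF pos(1), THEN spec, THEN mp,
        OF pos(2), THEN spec, of R'] by metis
  \<comment> \<open>The minimum records that n steps have either advanced by at least
    \<open>n * c\<close> or come within \<epsilon> of the goal, after which the walk stands
    still.\<close>
  have step: "\<exists>s. 0 \<le> s \<and> s \<le> t \<and> min (real n * c) (t - \<epsilon>) \<le> s \<and>
     (\<exists>C\<in>L. \<exists>D\<in>L. \<forall>x. norm x \<le> R \<longrightarrow> norm (inv A (inv C (D (A x))) - x - s *\<^sub>R w) \<le> \<eta>' * s)" for n
  proof (induction n)
    case 0
    obtain C where "C \<in> L" using L_nonempty by blast
    then show ?case using t A pos by (intro exI[of _ 0]) (auto intro!: bexI[of _ C] simp: sim)
  next
    case (Suc n)
    then obtain s C D where s: "0 \<le> s" "s \<le> t" "min (real n * c) (t - \<epsilon>) \<le> s" "C \<in> L" "D \<in> L"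
      "\<forall>x. norm x \<le> R \<longrightarrow> norm (inv A (inv C (D (A x))) - x - s *\<^sub>R w) \<le> \<eta>' * s"
      by blast
    show ?case
    proof (cases "t - \<epsilon> \<le> s")
      case True
      then show ?thesis using s by (intro exI[of _ s]) auto
    next
      case False
      have CA: "C \<circ> A \<in> L" using s A comp_in by blast
      obtain v C1 D1 where v: "c \<le> v" "v \<le> \<epsilon>" "C1 \<in> L" "D1 \<in> L"
        "\<forall>x. norm x \<le> R' \<longrightarrow> norm (inv (C \<circ> A) (inv C1 (D1 ((C \<circ> A) x))) - x - v *\<^sub>R w) \<le> \<eta>' * v"
        using c(2) CA by blast
      have "norm (inv A (inv (C1 \<circ> C) ((D1 \<circ> D) (A x))) - x - (s + v) *\<^sub>R w) \<le> \<eta>' * (s + v)"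
        if x: "norm x \<le> R" for x
      proof -
        define y where "y = inv A (inv C (D (A x)))"
        have e: "norm (y - x - s *\<^sub>R w) \<le> \<eta>' * s" using s(6) x by (simp add: y_def)
        have "norm y \<le> norm x + norm (s *\<^sub>R w) + norm (y - x - s *\<^sub>R w)"
          using norm_triangle_ineq[of "x + s *\<^sub>R w" "y - x - s *\<^sub>R w"] norm_triangle_ineq[of x "s *\<^sub>R w"] by simp
        moreover have "norm (s *\<^sub>R w) \<le> t * norm w" using s(1,2) by (simp add: mult_right_mono)
        moreover have "\<eta>' * s \<le> \<eta>" using mult_left_mono[OF s(2), of \<eta>'] pos \<eta>'t \<eta> by linarith
        ultimately have "norm y \<le> R'" using e x unfolding R'_def by linarith
        moreover have "inv (C \<circ> A) (inv C1 (D1 ((C \<circ> A) y))) = inv A (inv (C1 \<circ> C) ((D1 \<circ> D) (A x)))"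
          using v s A by (simp add: inv_comp_apply y_def sim)
        ultimately have "norm (inv A (inv (C1 \<circ> C) ((D1 \<circ> D) (A x))) - y - v *\<^sub>R w) \<le> \<eta>' * v"
          using v(5) by metis
        then show ?thesis
          using norm_triangle_ineq[of "inv A (inv (C1 \<circ> C) ((D1 \<circ> D) (A x))) - y - v *\<^sub>R w" "y - x - s *\<^sub>R w"] e
          by (simp add: algebra_simps)
      qed
      moreover have "C1 \<circ> C \<in> L" "D1 \<circ> D \<in> L" using v s comp_in by blast+
      moreover have "0 \<le> s + v" "s + v \<le> t" "min (real (Suc n) * c) (t - \<epsilon>) \<le> s + v"
        using s v c False by (auto simp: algebra_simps min_def split: if_splits)
      ultimately show ?thesis by blast
    qed
  qed
  obtain n where n: "t < real n * c" using reals_Archimedean3[OF c(1)] by blast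
  obtain s C D where s: "0 \<le> s" "s \<le> t" "min (real n * c) (t - \<epsilon>) \<le> s" "C \<in> L" "D \<in> L"
      "\<forall>x. norm x \<le> R \<longrightarrow> norm (inv A (inv C (D (A x))) - x - s *\<^sub>R w) \<le> \<eta>' * s"
    using step[of n] by blast
  have "norm (inv A (inv C (D (A x))) - x - t *\<^sub>R w) \<le> \<eta>" if x: "norm x \<le> R" for x
  proof -
    have "norm (inv A (inv C (D (A x))) - x - t *\<^sub>R w)
        \<le> norm (inv A (inv C (D (A x))) - x - s *\<^sub>R w) + norm ((s - t) *\<^sub>R w)"
      using norm_triangle_ineq[of "inv A (inv C (D (A x))) - x - s *\<^sub>R w" "(s - t) *\<^sub>R w"]
      by (simp add: algebra_simps)
    also have "\<dots> \<le> \<eta>' * s + \<epsilon> * norm w"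
    proof (intro add_mono)
      have "t - s \<le> \<epsilon>" using s(3) n s pos by (auto simp: min_def split: if_splits)
      then show "norm ((s - t) *\<^sub>R w) \<le> \<epsilon> * norm w" using s by (simp add: mult_right_mono)
    qed (use s x in auto)
    also have "\<dots> \<le> \<eta>' * t + \<epsilon> * norm w" using s pos by simp
    finally show ?thesis using \<eta>'t \<epsilon>w by linarith
  qed
  then show "\<exists>C\<in>L. \<exists>D\<in>L. \<forall>x. norm x \<le> R \<longrightarrow> norm (inv A (inv C (D (A x))) - x - t *\<^sub>R w) \<le> \<eta>"
    using s by blast
qed

text \<open>The condition on a minimum over a ball is replaced by a Lipschitz constant relative to
  the displacement at \<open>a\<close>. This form is implied by the original one and can also be
  reached by choosing a dominating point of F.\<close>

definition overlap_at :: "'a \<Rightarrow> real \<Rightarrow> 'a \<Rightarrow> bool" where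
  "overlap_at a K \<omega> \<longleftrightarrow> (\<forall>\<epsilon>>0. \<exists>C\<in>L. \<exists>D\<in>L. let \<Phi> = (\<lambda>x. inv C (D x) - x) in
     0 < norm (\<Phi> a) \<and> norm (\<Phi> a) \<le> \<epsilon> \<and> norm (\<Phi> a - norm (\<Phi> a) *\<^sub>R \<omega>) \<le> \<epsilon> * norm (\<Phi> a) \<and>
     (\<forall>x. norm (\<Phi> x - \<Phi> a) \<le> K * norm (\<Phi> a) * norm (x - a)))"

text \<open>Conjugating a return map \<open>I + \<Phi>\<close> by a composition \<^term>\<open>U = P \<circ> X \<circ> B ^^ n \<circ> A\<close>
  blows up \<open>\<Phi>\<close>: \<^term>\<open>P\<close> localises near \<^term>\<open>a\<close>, the power of \<^term>\<open>B\<close> adjusts the scale and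
  \<^term>\<open>X\<close> makes the rotation of \<^term>\<open>U\<close> nearly trivial.\<close>

lemma overlap_at_near_translations:
  assumes a: "a \<in> F" and K: "0 \<le> K" and \<omega>: "norm \<omega> = 1" and ov: "overlap_at a K \<omega>"
  shows "near_translations \<omega>"
  unfolding near_translations_def
proof (intro allI impI)
  fix \<eta> \<epsilon> R :: real assume \<eta>: "0 < \<eta>" and \<epsilon>: "0 < \<epsilon>"
  obtain M where M: "0 < M" "\<forall>x\<in>F. norm x \<le> M" using F_bound by blast
  define \<delta> where "\<delta> = \<eta> / (4 * (K + 1))"
  have \<delta>: "0 < \<delta>" "K * \<delta> \<le> \<eta> / 4" using \<eta> K by (auto simp: \<delta>_def field_simps)
  obtain P where P: "P \<in> L" "\<forall>x. norm x \<le> R + 2 * M \<longrightarrow> dist (P x) a \<le> \<delta>"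
    using small_piece_ball[OF a \<delta>(1)] by blast
  obtain B where B: "B \<in> L" using L_nonempty by blast
  define b where "b = sim_ratio B"
  have b: "0 < b" "b < 1" using B ratio_pos ratio_less_1 by (auto simp: b_def)
  obtain I where I: "finite I" "I \<subseteq> L"
    "\<forall>Y\<in>L. \<exists>X\<in>I. \<forall>x. norm (sim_lin X (sim_lin Y x) - x) \<le> \<eta> / 4 * norm x"
    using finite_inverse_net[of "\<eta> / 4"] \<eta> by auto
  define m where "m = Min (insert 1 (sim_ratio ` I))"
  have m: "0 < m" "\<And>X. X \<in> I \<Longrightarrow> m \<le> sim_ratio X"
    using I(1,2) ratio_pos by (auto simp: m_def)
  \<comment> \<open>All factors are fixed before A is given: P and B are single maps, and X will be
    taken from a finite set. This is the required uniformity.\<close>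
  define c where "c = sim_ratio P * m * b"
  have c: "0 < c" using m(1) b(1) ratio_pos[OF P(1)] by (simp add: c_def)
  show "\<exists>c>0. \<forall>A\<in>L. \<exists>v\<ge>c. v \<le> \<epsilon> \<and>
     (\<exists>C\<in>L. \<exists>D\<in>L. \<forall>x. norm x \<le> R \<longrightarrow> norm (inv A (inv C (D (A x))) - x - v *\<^sub>R \<omega>) \<le> \<eta> * v)"
  proof (rule exI[of _ "c * \<epsilon>"], rule conjI, rule_tac[2] ballI)
    show "0 < c * \<epsilon>" using c \<epsilon> by simp
    fix A assume A: "A \<in> L"
    \<comment> \<open>The first bound controls the direction. The second makes the target ratio
      \<theta> smaller than the ratio of A, so that at least one power of B is needed and
      \<open>B ^^ n\<close> lies in L.\<close>
    define \<epsilon>0 where "\<epsilon>0 = min (\<eta> / 4) (c * \<epsilon> * sim_ratio A / 2)"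
    have \<epsilon>0: "0 < \<epsilon>0" "\<epsilon>0 \<le> \<eta> / 4" "\<epsilon>0 < c * \<epsilon> * sim_ratio A"
    proof -
      have "0 < c * \<epsilon> * sim_ratio A" using \<epsilon> c ratio_pos[OF A] by simp
      then show "0 < \<epsilon>0" "\<epsilon>0 \<le> \<eta> / 4" "\<epsilon>0 < c * \<epsilon> * sim_ratio A"
        using \<eta> unfolding \<epsilon>0_def by linarith+
    qed
    obtain C D where CD: "C \<in> L" "D \<in> L" "let \<Phi> = (\<lambda>x. inv C (D x) - x) in
     0 < norm (\<Phi> a) \<and> norm (\<Phi> a) \<le> \<epsilon>0 \<and> norm (\<Phi> a - norm (\<Phi> a) *\<^sub>R \<omega>) \<le> \<epsilon>0 * norm (\<Phi> a) \<and>
     (\<forall>x. norm (\<Phi> x - \<Phi> a) \<le> K * norm (\<Phi> a) * norm (x - a))"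
      using ov \<epsilon>0(1) unfolding overlap_at_def by blast
    define \<Phi> where "\<Phi> x = inv C (D x) - x" for x
    define v0 where "v0 = norm (\<Phi> a)"
    have v0: "0 < v0" "v0 \<le> \<epsilon>0" "norm (\<Phi> a - v0 *\<^sub>R \<omega>) \<le> \<epsilon>0 * v0"
      "\<And>x. norm (\<Phi> x - \<Phi> a) \<le> K * v0 * norm (x - a)"
      using CD(3) unfolding Let_def v0_def \<Phi>_def by auto
    \<comment> \<open>If the ratio of U lies between \<open>c * \<theta>\<close> and \<theta>, then
      the magnified displacement \<open>v0 / sim_ratio U\<close> lies between
      \<open>c * \<epsilon>\<close> and \<epsilon>.\<close>
    define \<theta> where "\<theta> = v0 / (c * \<epsilon>)"
    have \<theta>: "0 < \<theta>" "\<theta> < sim_ratio A"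
      using v0 \<epsilon>0 c \<epsilon> by (auto simp: \<theta>_def divide_less_eq mult.commute)
    have "\<exists>n. b ^ n * sim_ratio A \<le> \<theta>"
      using real_arch_pow_inv[of "\<theta> / sim_ratio A" b] \<theta> b ratio_pos[OF A]
      by (auto simp: less_divide_eq intro: less_imp_le)
    then obtain n where n: "b ^ n * sim_ratio A \<le> \<theta>" "\<And>k. k < n \<Longrightarrow> \<theta> < b ^ k * sim_ratio A"
      using exists_least_iff[of "\<lambda>n. b ^ n * sim_ratio A \<le> \<theta>"] by (auto simp: not_le)
    have n0: "0 < n" using n(1) \<theta> by (cases n) auto
    have n2: "b * \<theta> \<le> b ^ n * sim_ratio A"
      using n(2)[of "n - 1"] n0 b by (cases n) (auto simp: mult.assoc)
    define Y where "Y = B ^^ n \<circ> A"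
    have Y: "Y \<in> L" using comp_in[OF funpow_in[OF B n0] A] by (simp add: Y_def)
    have rY: "sim_ratio Y = b ^ n * sim_ratio A"
      unfolding Y_def using sim_ratio_comp[OF similarity_map_funpow[OF sim[OF B]] sim[OF A]]
      by (simp add: sim_ratio_funpow[OF sim[OF B]] b_def)
    \<comment> \<open>X inverts the rotation of \<open>Y \<circ> P\<close> and not that of Y: the
      rotation of \<open>P \<circ> X \<circ> Y\<close> is conjugate, by that of P, to the one of
      \<open>X \<circ> Y \<circ> P\<close>, and P has to stay outermost.\<close>
    obtain X where X: "X \<in> I" "\<forall>x. norm (sim_lin X (sim_lin (Y \<circ> P) x) - x) \<le> \<eta> / 4 * norm x"
      using I(3) comp_in[OF Y P(1)] by blast
    have XL: "X \<in> L" using X I by blast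
    define G where "G = P \<circ> X \<circ> B ^^ n"
    define U where "U = P \<circ> (X \<circ> Y)"
    have G: "G \<in> L" unfolding G_def using P XL funpow_in[OF B n0] comp_in by blast
    have U: "U \<in> L" "U = G \<circ> A" using P XL Y comp_in by (auto simp: U_def G_def Y_def comp_assoc)
    have rU: "sim_ratio U = sim_ratio P * (sim_ratio X * sim_ratio Y)"
      unfolding U_def using P XL Y comp_in by (simp add: sim_ratio_comp sim)
    have "sim_ratio U \<le> 1 * (1 * \<theta>)"
      unfolding rU using ratio_less_1 ratio_pos P(1) XL Y n(1) rY \<theta> b ratio_pos[OF A]
      by (intro mult_mono) (auto intro: less_imp_le)
    moreover have "sim_ratio P * (m * (b * \<theta>)) \<le> sim_ratio U"
      unfolding rU using m X(1) n2 rY \<theta> b ratio_pos[OF P(1)] ratio_pos[OF XL]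
      by (intro mult_left_mono mult_mono) auto
    ultimately have rU2: "c * \<theta> \<le> sim_ratio U" "sim_ratio U \<le> \<theta>" by (auto simp: c_def mult.assoc)
    have rU0: "0 < sim_ratio U" using ratio_pos[OF U(1)] .
    define v where "v = v0 / sim_ratio U"
    have "v0 / \<theta> \<le> v" "v \<le> v0 / (c * \<theta>)"
      unfolding v_def using rU2 rU0 v0 c \<theta> by (auto intro!: divide_left_mono)
    moreover have "v0 / \<theta> = c * \<epsilon>" "v0 / (c * \<theta>) = \<epsilon>"
      using v0(1) c \<epsilon> by (auto simp: \<theta>_def)
    ultimately have v: "c * \<epsilon> \<le> v" "v \<le> \<epsilon>" by auto
    have rot: "norm (sim_lin U \<omega> - \<omega>) \<le> \<eta> / 4"
    proof -
      define y where "y = inv (sim_lin P) \<omega>"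
      have y: "sim_lin P y = \<omega>" "norm y = 1"
        using sim_lin_inv_apply[OF sim[OF P(1)]] norm_inv_sim_lin[OF sim[OF P(1)]] \<omega> by (auto simp: y_def)
      have "sim_lin U \<omega> - \<omega> = sim_lin P (sim_lin X (sim_lin (Y \<circ> P) y) - y)"
        unfolding U_def using P XL Y comp_in y
        by (simp add: sim_lin_comp sim linear_diff[OF linear_sim_lin])
      then show ?thesis using X(2)[rule_format, of y] y norm_sim_lin[OF sim[OF P(1)]] by simp
    qed
    have "norm (inv A (inv (C \<circ> G) ((D \<circ> G) (A x))) - x - v *\<^sub>R \<omega>) \<le> \<eta> * v" if x: "norm x \<le> R" for x
    proof -
      have near: "norm (U x - a) \<le> \<delta>"
        using P(2) norm_L_le[OF comp_in[OF XL Y] M(2), of x] x by (simp add: U_def dist_norm)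
      have "inv A (inv (C \<circ> G) ((D \<circ> G) (A x))) = inv U (U x + \<Phi> (U x))"
        using CD G A by (simp add: U(2) inv_comp_apply \<Phi>_def)
      also have "\<dots> = x + (1 / sim_ratio U) *\<^sub>R inv (sim_lin U) (\<Phi> (U x))"
        by (rule sim_inv_add[OF sim[OF U(1)]])
      finally have "inv A (inv (C \<circ> G) ((D \<circ> G) (A x))) - x - v *\<^sub>R \<omega>
          = (1 / sim_ratio U) *\<^sub>R (inv (sim_lin U) (\<Phi> (U x)) - v0 *\<^sub>R \<omega>)"
        by (simp add: v_def scaleR_diff_right)
      then have eq: "norm (inv A (inv (C \<circ> G) ((D \<circ> G) (A x))) - x - v *\<^sub>R \<omega>)
          = norm (inv (sim_lin U) (\<Phi> (U x)) - v0 *\<^sub>R \<omega>) / sim_ratio U"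
        using rU0 by simp
      have "norm (inv (sim_lin U) (\<Phi> (U x)) - v0 *\<^sub>R \<omega>)
          = norm (sim_lin U (inv (sim_lin U) (\<Phi> (U x)) - v0 *\<^sub>R \<omega>))"
        using norm_sim_lin[OF sim[OF U(1)]] by simp
      also have "\<dots> = norm (\<Phi> (U x) - v0 *\<^sub>R sim_lin U \<omega>)"
        using linear_sim_lin[OF sim[OF U(1)]]
        by (simp add: linear_diff linear_scale sim_lin_inv_apply[OF sim[OF U(1)]])
      also have "\<dots> \<le> norm (\<Phi> (U x) - \<Phi> a) + norm (\<Phi> a - v0 *\<^sub>R \<omega>) + norm (v0 *\<^sub>R (\<omega> - sim_lin U \<omega>))"
        using norm_triangle_ineq[of "\<Phi> (U x) - \<Phi> a" "\<Phi> a - v0 *\<^sub>R \<omega>"]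
          norm_triangle_ineq[of "\<Phi> (U x) - v0 *\<^sub>R \<omega>" "v0 *\<^sub>R (\<omega> - sim_lin U \<omega>)"]
        by (simp add: algebra_simps)
      also have "\<dots> \<le> \<eta> / 4 * v0 + \<eta> / 4 * v0 + v0 * (\<eta> / 4)"
      proof (intro add_mono)
        have "norm (\<Phi> (U x) - \<Phi> a) \<le> K * v0 * \<delta>"
          using v0(4)[of "U x"] mult_left_mono[OF near, of "K * v0"] K v0(1) by simp
        also have "\<dots> = (K * \<delta>) * v0" by simp
        also have "\<dots> \<le> \<eta> / 4 * v0" using \<delta>(2) v0(1) by (intro mult_right_mono) auto
        finally show "norm (\<Phi> (U x) - \<Phi> a) \<le> \<eta> / 4 * v0" .
        show "norm (\<Phi> a - v0 *\<^sub>R \<omega>) \<le> \<eta> / 4 * v0"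
          using v0(3) mult_right_mono[OF \<epsilon>0(2), of v0] v0(1) by linarith
        show "norm (v0 *\<^sub>R (\<omega> - sim_lin U \<omega>)) \<le> v0 * (\<eta> / 4)"
          using rot v0(1) by (simp add: norm_minus_commute)
      qed
      also have "\<dots> \<le> \<eta> * v0" using \<eta> v0(1) by (simp add: algebra_simps)
      finally have "norm (inv (sim_lin U) (\<Phi> (U x)) - v0 *\<^sub>R \<omega>) / sim_ratio U \<le> \<eta> * v0 / sim_ratio U"
        using rU0 by (intro divide_right_mono) auto
      then show ?thesis unfolding eq by (simp add: v_def)
    qed
    moreover have "C \<circ> G \<in> L" "D \<circ> G \<in> L" using CD G comp_in by blast+
    ultimately show "\<exists>v\<ge>c * \<epsilon>. v \<le> \<epsilon> \<and>
     (\<exists>C\<in>L. \<exists>D\<in>L. \<forall>x. norm x \<le> R \<longrightarrow> norm (inv A (inv C (D (A x))) - x - v *\<^sub>R \<omega>) \<le> \<eta> * v)"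
      using v by blast
  qed
qed

section \<open>The vector space of translations\<close>

text \<open>The limit translations are so far only an additive group; keeping the vectors all of
  whose multiples belong to it yields a subspace.\<close>

definition translation_space :: "'a set" where
  "translation_space = {w. \<forall>t. t *\<^sub>R w \<in> limit_translations}"

lemma subspace_translation_space: "subspace translation_space"
  unfolding subspace_def translation_space_def
  using limit_translations_0 by (auto simp: scaleR_add_right limit_translations_add)

lemma translation_spaceD: "w \<in> translation_space \<Longrightarrow> w \<in> limit_translations"
  unfolding translation_space_def by (metis (mono_tags) mem_Collect_eq scaleR_one)

lemma overlap_at_translation_space:
  assumes "a \<in> F" "0 \<le> K" "norm \<omega> = 1" "overlap_at a K \<omega>"
  shows "\<omega> \<in> translation_space"
proof -
  have *: "near_translations \<omega>" using overlap_at_near_translations[OF assms] .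
  have "t *\<^sub>R \<omega> \<in> limit_translations" for t
  proof (cases "0 \<le> t")
    case True then show ?thesis using near_translations_imp[OF *] by blast
  next
    case False
    then have "- ((- t) *\<^sub>R \<omega>) \<in> limit_translations"
      using near_translations_imp[OF *, of "- t"] by (intro limit_translations_uminus) auto
    then show ?thesis by simp
  qed
  then show ?thesis by (simp add: translation_space_def)
qed

text \<open>The sets \<^term>\<open>inv A ` F\<close> grow along \<^term>\<open>C \<circ> A\<close>, so translates can be adjoined one at a time.\<close>

lemma translates_approx:
  assumes "finite W" "W \<subseteq> limit_translations" "A0 \<in> L" "0 < \<epsilon>"
  shows "\<exists>A\<in>L. inv A0 ` F \<subseteq> inv A ` F \<and> (\<forall>w\<in>W. \<forall>x\<in>F. \<exists>y\<in>inv A ` F. dist y (x + w) \<le> \<epsilon>)"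
  using assms(1,2)
proof (induction W rule: finite_induct)
  case empty
  then show ?case using assms(3) by auto
next
  case (insert w W)
  then obtain A where A: "A \<in> L" "inv A0 ` F \<subseteq> inv A ` F"
    "\<forall>w\<in>W. \<forall>x\<in>F. \<exists>y\<in>inv A ` F. dist y (x + w) \<le> \<epsilon>" by auto
  obtain M where M: "\<forall>x\<in>F. norm x \<le> M" using F_bound by blast
  obtain C D where CD: "C \<in> L" "D \<in> L"
    "\<forall>x. norm x \<le> M \<longrightarrow> norm (inv A (inv C (D (A x))) - x - w) \<le> \<epsilon>"
    using limit_translationsD[of w A \<epsilon> M] insert.prems A(1) assms(4) by auto
  have sub: "inv A ` F \<subseteq> inv (C \<circ> A) ` F"
  proof
    fix y assume "y \<in> inv A ` F"
    then obtain x where x: "x \<in> F" "y = inv A x" by blast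
    have "y = inv (C \<circ> A) (C x)" using x A CD by (simp add: inv_comp_apply sim)
    then show "y \<in> inv (C \<circ> A) ` F" using maps_F[OF CD(1) x(1)] by blast
  qed
  have "\<exists>y\<in>inv (C \<circ> A) ` F. dist y (x + w) \<le> \<epsilon>" if x: "x \<in> F" for x
  proof
    show "inv (C \<circ> A) (D (A x)) \<in> inv (C \<circ> A) ` F" using maps_F[OF CD(2) maps_F[OF A(1) x]] by (rule imageI)
    show "dist (inv (C \<circ> A) (D (A x))) (x + w) \<le> \<epsilon>"
      using CD M x A by (auto simp: inv_comp_apply dist_norm diff_diff_eq)
  qed
  moreover have "\<forall>w\<in>W. \<forall>x\<in>F. \<exists>y\<in>inv (C \<circ> A) ` F. dist y (x + w) \<le> \<epsilon>"
    using A(3) sub by (meson subset_iff)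
  ultimately have "\<forall>w'\<in>insert w W. \<forall>x\<in>F. \<exists>y\<in>inv (C \<circ> A) ` F. dist y (x + w') \<le> \<epsilon>"
    by (metis insert_iff)
  then show ?case
    by (intro bexI[of _ "C \<circ> A"] conjI order_trans[OF A(2) sub] comp_in CD(1) A(1))
qed

lemma bounded_translates_approx:
  assumes "bounded W" "W \<subseteq> limit_translations" "A0 \<in> L" "0 < \<epsilon>"
  shows "\<exists>A\<in>L. inv A0 ` F \<subseteq> inv A ` F \<and> (\<forall>w\<in>W. \<forall>x\<in>F. \<exists>y\<in>inv A ` F. dist y (x + w) \<le> \<epsilon>)"
proof -
  have "0 < \<epsilon> / 2" using assms(4) by simp
  from maximal_separated[OF assms(1) this] obtain P where P: "P \<subseteq> W" "finite P"
    "W \<subseteq> (\<Union>p\<in>P. cball p (\<epsilon> / 2))" by metis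
  obtain A where A: "A \<in> L" "inv A0 ` F \<subseteq> inv A ` F"
    "\<forall>w\<in>P. \<forall>x\<in>F. \<exists>y\<in>inv A ` F. dist y (x + w) \<le> \<epsilon> / 2"
    using translates_approx[OF P(2) _ assms(3), of "\<epsilon> / 2"] order_trans[OF P(1) assms(2)] assms(4) by (metis half_gt_zero)
  have "\<exists>y\<in>inv A ` F. dist y (x + w) \<le> \<epsilon>" if w: "w \<in> W" and x: "x \<in> F" for w x
  proof -
    obtain p where p: "p \<in> P" "dist p w \<le> \<epsilon> / 2" using P(3) w by auto
    obtain y where y: "y \<in> inv A ` F" "dist y (x + p) \<le> \<epsilon> / 2" using A(3) p x by blast
    have "dist y (x + w) \<le> dist y (x + p) + dist (x + p) (x + w)" by (rule dist_triangle)
    then have "dist y (x + w) \<le> \<epsilon>" using y p by (simp add: dist_norm)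
    then show ?thesis using y by blast
  qed
  then show ?thesis using A by blast
qed

end

section \<open>Assouad exponents\<close>

definition assouad_exponents :: "'a::metric_space set \<Rightarrow> real set" where
  "assouad_exponents E = {\<alpha>. 0 \<le> \<alpha> \<and> (\<exists>c::real. \<forall>r R. 0 < r \<and> r < R \<longrightarrow>
     (\<forall>x\<in>E. real (covering_number r (cball x R \<inter> E)) \<le> c * (R / r) powr \<alpha>))}"

lemma assouad_dim_eq_Inf: "assouad_dim E = Inf (assouad_exponents E)"
  by (simp add: assouad_dim_def assouad_exponents_def)

lemma assouad_exponentsD:
  assumes "\<alpha> \<in> assouad_exponents E"
  shows "0 \<le> \<alpha>" "\<exists>c>0. \<forall>r R. 0 < r \<and> r < R \<longrightarrow>
     (\<forall>x\<in>E. real (covering_number r (cball x R \<inter> E)) \<le> c * (R / r) powr \<alpha>)"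
proof -
  show "0 \<le> \<alpha>" using assms by (simp add: assouad_exponents_def)
  obtain c :: real where c: "\<And>r R x. 0 < r \<Longrightarrow> r < R \<Longrightarrow> x \<in> E \<Longrightarrow>
      real (covering_number r (cball x R \<inter> E)) \<le> c * (R / r) powr \<alpha>"
    using assms by (auto simp: assouad_exponents_def)
  have "real (covering_number r (cball x R \<inter> E)) \<le> (\<bar>c\<bar> + 1) * (R / r) powr \<alpha>"
    if "0 < r" "r < R" "x \<in> E" for r R x
    using c[OF that] mult_right_mono[of c "\<bar>c\<bar> + 1" "(R / r) powr \<alpha>"] abs_ge_self[of c]
    by (meson add_increasing2 order_trans powr_ge_zero zero_le_one)
  then show "\<exists>c>0. \<forall>r R. 0 < r \<and> r < R \<longrightarrow>
     (\<forall>x\<in>E. real (covering_number r (cball x R \<inter> E)) \<le> c * (R / r) powr \<alpha>)"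
    by (intro exI[of _ "\<bar>c\<bar> + 1"]) auto
qed

lemma assouad_exponents_bdd_below: "bdd_below (assouad_exponents E)"
  by (rule bdd_belowI[of _ 0]) (simp add: assouad_exponents_def)

lemma assouad_exponents_nonempty:
  fixes E :: "'a::euclidean_space set"
  shows "assouad_exponents E \<noteq> {}"
proof -
  obtain K where K: "0 < K" "\<forall>(x::'a) R r. 0 < r \<and> r \<le> R \<longrightarrow>
      real (covering_number r (cball x R)) \<le> K * (R / r) ^ DIM('a)"
    using covering_number_cball by blast
  have "real (covering_number r (cball x R \<inter> E)) \<le> K * (R / r) powr real DIM('a)"
    if r: "0 < r" "r < R" for r R and x :: 'a
  proof -
    have "real (covering_number r (cball x R \<inter> E)) \<le> real (covering_number r (cball x R))"
      using r by (intro of_nat_mono covering_number_mono) auto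
    also have "\<dots> \<le> K * (R / r) ^ DIM('a)" using K(2) r by simp
    finally show ?thesis using r by (simp add: powr_realpow)
  qed
  then have "real DIM('a) \<in> assouad_exponents E" unfolding assouad_exponents_def by auto
  then show ?thesis by blast
qed

text \<open>Beyond D a ball contains all of E, so that R may be lowered to D; for
  \<open>r \<ge> D\<close> a single ball is enough, which is why the constant is raised to at least
  1.\<close>

lemma assouad_exponents_localI:
  fixes E :: "'a::euclidean_space set"
  assumes "bounded E" "0 \<le> \<alpha>" "\<And>x. x \<in> E \<Longrightarrow> E \<subseteq> cball x D" "0 < D"
    and c: "\<And>r R x. \<lbrakk>0 < r; r < R; R \<le> D; x \<in> E\<rbrakk> \<Longrightarrow>
      real (covering_number r (cball x R \<inter> E)) \<le> c * (R / r) powr \<alpha>"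
  shows "\<alpha> \<in> assouad_exponents E"
proof -
  define c' where "c' = max c 1"
  have "real (covering_number r (cball x R \<inter> E)) \<le> c' * (R / r) powr \<alpha>"
    if r: "0 < r" "r < R" and x: "x \<in> E" for r R x
  proof (cases "R \<le> D")
    case True
    show ?thesis
      using c[OF r True x] mult_right_mono[of c c' "(R / r) powr \<alpha>"] by (simp add: c'_def)
  next
    case False
    show ?thesis
    proof (cases "r < D")
      case True
      have "cball x R \<inter> E = cball x D \<inter> E" using assms(3)[OF x] False by auto
      then have "real (covering_number r (cball x R \<inter> E)) \<le> c * (D / r) powr \<alpha>"
        using c[OF r(1) True order.refl x] by simp
      also have "\<dots> \<le> c' * (D / r) powr \<alpha>" by (simp add: c'_def mult_right_mono)
      also have "\<dots> \<le> c' * (R / r) powr \<alpha>"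
        using False assms(2,4) r by (intro mult_left_mono powr_mono2) (auto simp: c'_def divide_right_mono)
      finally show ?thesis .
    next
      case False
      have "cball x R \<inter> E \<subseteq> (\<Union>c\<in>{x}. cball c r)" using assms(3)[OF x] False by auto
      then have "covering_number r (cball x R \<inter> E) \<le> 1" by (intro covering_number_le[of "{x}"]) auto
      moreover have "1 \<le> c' * (R / r) powr \<alpha>"
        using mult_mono[of 1 c' 1 "(R / r) powr \<alpha>"] ge_one_powr_ge_zero[of "R / r" \<alpha>] r assms(2)
        by (simp add: c'_def)
      ultimately show ?thesis by linarith
    qed
  qed
  then show ?thesis using assms(2) unfolding assouad_exponents_def by blast
qed

section \<open>Orthogonal projections and the dimension formula\<close>

lemma orth_proj_eq:
  assumes "subspace W" "y \<in> W" "x - y \<in> W\<^sup>\<bottom>"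
  shows "orth_proj W x = y"
  unfolding orth_proj_def
proof (rule the_equality)
  show "y \<in> W \<and> x - y \<in> W\<^sup>\<bottom>" using assms by blast
  fix z assume z: "z \<in> W \<and> x - z \<in> W\<^sup>\<bottom>"
  have "z - y \<in> W" using z assms subspace_diff by blast
  moreover have "(x - y) - (x - z) \<in> W\<^sup>\<bottom>"
    using z assms(3) subspace_diff[OF subspace_orthogonal_comp] by blast
  ultimately have "orthogonal (z - y) (z - y)" by (auto simp: orthogonal_comp_def)
  then show "z = y" by (simp add: orthogonal_self)
qed

lemma
  fixes W :: "'a::euclidean_space set"
  assumes "subspace W"
  shows orth_proj_in: "orth_proj W x \<in> W"
    and orth_proj_compl: "x - orth_proj W x \<in> W\<^sup>\<bottom>"
proof -
  have "x \<in> W + W\<^sup>\<bottom>" using subspace_sum_orthogonal_comp[OF assms] by simp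
  then obtain y z where "y \<in> W" "z \<in> W\<^sup>\<bottom>" "x = y + z" by (auto elim: set_plus_elim)
  then show "orth_proj W x \<in> W" "x - orth_proj W x \<in> W\<^sup>\<bottom>"
    using orth_proj_eq[OF assms, of y x] by auto
qed

lemma linear_orth_proj:
  fixes W :: "'a::euclidean_space set"
  assumes "subspace W" shows "linear (orth_proj W)"
proof (rule linearI)
  have c: "subspace (W\<^sup>\<bottom>)" by (rule subspace_orthogonal_comp)
  fix x y :: 'a and t :: real
  have "(x - orth_proj W x) + (y - orth_proj W y) \<in> W\<^sup>\<bottom>"
    using orth_proj_compl[OF assms] subspace_add[OF c] by blast
  then show "orth_proj W (x + y) = orth_proj W x + orth_proj W y"
    using orth_proj_in[OF assms] subspace_add[OF assms]
    by (intro orth_proj_eq[OF assms]) (auto simp: algebra_simps)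
  have "t *\<^sub>R (x - orth_proj W x) \<in> W\<^sup>\<bottom>"
    using orth_proj_compl[OF assms] subspace_scale[OF c] by blast
  then show "orth_proj W (t *\<^sub>R x) = t *\<^sub>R orth_proj W x"
    using orth_proj_in[OF assms] subspace_scale[OF assms]
    by (intro orth_proj_eq[OF assms]) (auto simp: algebra_simps)
qed

lemma norm_orthogonal_add:
  fixes a b :: "'a::real_inner"
  assumes "orthogonal a b"
  shows "norm a \<le> norm (a + b)" "norm b \<le> norm (a + b)"
proof -
  have "norm (a + b) ^ 2 = norm a ^ 2 + norm b ^ 2" using norm_add_Pythagorean[OF assms] .
  then have "norm a ^ 2 \<le> norm (a + b) ^ 2" "norm b ^ 2 \<le> norm (a + b) ^ 2" by auto
  then show "norm a \<le> norm (a + b)" "norm b \<le> norm (a + b)"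
    by (meson norm_ge_zero power2_le_imp_le)+
qed

lemma
  fixes W :: "'a::euclidean_space set"
  assumes "subspace W"
  shows norm_orth_proj_le: "norm (orth_proj W x) \<le> norm x"
    and norm_minus_orth_proj_le: "norm (x - orth_proj W x) \<le> norm x"
proof -
  have "orthogonal (orth_proj W x) (x - orth_proj W x)"
    using orth_proj_in[OF assms, of x] orth_proj_compl[OF assms, of x]
    by (auto simp: orthogonal_comp_def orthogonal_commute)
  from norm_orthogonal_add[OF this]
  show "norm (orth_proj W x) \<le> norm x" "norm (x - orth_proj W x) \<le> norm x" by auto
qed

text \<open>Upper half of the dimension formula: a piece of E lies in the orthogonal sum of a ball
  of V and a piece of the projection, and covers of the two at scale \<open>r / 2\<close>
  combine.\<close>

lemma assouad_exponents_projection: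
  fixes E :: "'a::euclidean_space set"
  assumes V: "subspace V" and E: "bounded E" and \<alpha>: "\<alpha> \<in> assouad_exponents (orth_proj (V\<^sup>\<bottom>) ` E)"
  shows "\<alpha> + real (dim V) \<in> assouad_exponents E"
proof -
  define p where "p = orth_proj (V\<^sup>\<bottom>)"
  have W: "subspace (V\<^sup>\<bottom>)" by (rule subspace_orthogonal_comp)
  have lp: "linear p" unfolding p_def by (rule linear_orth_proj[OF W])
  have np: "norm (p x) \<le> norm x" "norm (x - p x) \<le> norm x" for x
    unfolding p_def by (rule norm_orth_proj_le[OF W], rule norm_minus_orth_proj_le[OF W])
  have pV: "x - p x \<in> V" for x
    using orth_proj_compl[OF W, of x] orthogonal_comp_self[OF V] by (simp add: p_def)
  have bp: "bounded (p ` E)" using E lp by (simp add: bounded_linear_image linear_conv_bounded_linear)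
  have \<alpha>0: "0 \<le> \<alpha>" using assouad_exponentsD[OF \<alpha>] by blast
  obtain c where c: "0 < c" "\<forall>r R. 0 < r \<and> r < R \<longrightarrow>
     (\<forall>x\<in>p ` E. real (covering_number r (cball x R \<inter> p ` E)) \<le> c * (R / r) powr \<alpha>)"
    using assouad_exponentsD[OF \<alpha>] unfolding p_def by blast
  obtain K where K: "0 < K" "\<And>R r. \<lbrakk>0 < r; r \<le> R\<rbrakk> \<Longrightarrow>
    \<exists>C. finite C \<and> real (card C) \<le> K * (R / r) ^ dim V \<and> V \<inter> cball 0 R \<subseteq> (\<Union>c\<in>C. cball c r)"
    using subspace_ball_cover[OF V] by metis
  have "real (covering_number r (cball x R \<inter> E)) \<le> (K * c * 2 powr (\<alpha> + dim V)) * (R / r) powr (\<alpha> + dim V)"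
    if r: "0 < r" "r < R" and x: "x \<in> E" for r R x
  proof -
    have r2: "0 < r / 2" "r / 2 \<le> R" "r / 2 < R" using r by auto
    obtain C1 where C1: "finite C1" "real (card C1) \<le> K * (R / (r / 2)) ^ dim V"
      "V \<inter> cball 0 R \<subseteq> (\<Union>c\<in>C1. cball c (r / 2))" using K(2)[OF r2(1,2)] by metis
    have "bounded (cball (p x) R \<inter> p ` E)" using bp by blast
    from covering_number_attained[OF this r2(1)] obtain C2 where C2: "finite C2"
      "card C2 = covering_number (r / 2) (cball (p x) R \<inter> p ` E)"
      "cball (p x) R \<inter> p ` E \<subseteq> (\<Union>c\<in>C2. cball c (r / 2))" by metis
    have cC2: "real (card C2) \<le> c * (R / (r / 2)) powr \<alpha>"
      unfolding C2(2) using c(2) r2 x by blast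
    \<comment> \<open>The cover of the ball of V is centred at 0, that of the projection is not;
      only the V-component of x remains to be added.\<close>
    define C where "C = (\<lambda>(a, b). a + b + (x - p x)) ` (C1 \<times> C2)"
    have "cball x R \<inter> E \<subseteq> (\<Union>c\<in>C. cball c r)"
    proof
      fix z assume z: "z \<in> cball x R \<inter> E"
      then have zx: "norm (z - x) \<le> R" by (simp add: dist_norm norm_minus_commute)
      have "norm (p z - p x) \<le> R" using np(1)[of "z - x"] zx by (simp add: linear_diff[OF lp])
      then have "p z \<in> cball (p x) R \<inter> p ` E" using z by (simp add: dist_norm norm_minus_commute)
      then obtain b where b: "b \<in> C2" "dist b (p z) \<le> r / 2" using C2(3) by auto
      have "(z - x) - p (z - x) \<in> V \<inter> cball 0 R" using pV np(2)[of "z - x"] zx by simp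
      then obtain a where a: "a \<in> C1" "dist a ((z - x) - p (z - x)) \<le> r / 2" using C1(3) by auto
      have "dist (a + b + (x - p x)) z \<le> dist a ((z - x) - p (z - x)) + dist b (p z)"
        using norm_triangle_ineq[of "a - ((z - x) - p (z - x))" "b - p z"]
        by (simp add: dist_norm linear_diff[OF lp] algebra_simps)
      then have "dist (a + b + (x - p x)) z \<le> r" using a b by linarith
      then show "z \<in> (\<Union>c\<in>C. cball c r)" using a b by (force simp: C_def)
    qed
    moreover have "finite C" using C1 C2 by (simp add: C_def)
    ultimately have "covering_number r (cball x R \<inter> E) \<le> card C"
      by (intro covering_number_le) auto
    also have "card C \<le> card C1 * card C2"
      unfolding C_def using C1 C2 card_image_le[of "C1 \<times> C2"] by (simp add: card_cartesian_product)
    finally have "real (covering_number r (cball x R \<inter> E)) \<le> real (card C1) * real (card C2)"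
      by (metis of_nat_le_iff of_nat_mult)
    also have "\<dots> \<le> (K * (R / (r / 2)) ^ dim V) * (c * (R / (r / 2)) powr \<alpha>)"
      using C1(2) cC2 K(1) r by (intro mult_mono) auto
    also have "\<dots> = K * c * (R / (r / 2)) powr (\<alpha> + dim V)"
      using r by (simp add: powr_add powr_realpow)
    also have "R / (r / 2) = 2 * (R / r)" by simp
    also have "(2 * (R / r)) powr (\<alpha> + dim V) = 2 powr (\<alpha> + dim V) * (R / r) powr (\<alpha> + dim V)"
      using r by (intro powr_mult)
    finally show ?thesis by (simp only: mult.assoc)
  qed
  then show ?thesis using \<alpha>0 unfolding assouad_exponents_def by (auto intro!: add_nonneg_nonneg)
qed

context loop_semigroup
begin

text \<open>Lower half of the dimension formula. A magnified copy of F nearly contains the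
  orthogonal sum of a separated set in a ball of V and one in a ball of the projection; the product
  is pulled back into F and counted there. The bound \<open>R \<le> 2 * M\<close> keeps all
  translations involved in one bounded set.\<close>

lemma product_covering_bound:
  assumes V: "subspace V" "V \<subseteq> translation_space" and \<beta>: "\<beta> \<in> assouad_exponents F"
    and M: "0 < M" "\<forall>x\<in>F. norm x \<le> M"
  shows "\<exists>c>0. \<forall>r R. 0 < r \<and> r < R \<and> R \<le> 2 * M \<longrightarrow> (\<forall>y\<in>orth_proj (V\<^sup>\<bottom>) ` F.
    real (covering_number r (cball y R \<inter> orth_proj (V\<^sup>\<bottom>) ` F)) * (R / r) powr dim V \<le> c * (R / r) powr \<beta>)"
proof -
  define p where "p = orth_proj (V\<^sup>\<bottom>)"
  have W: "subspace (V\<^sup>\<bottom>)" by (rule subspace_orthogonal_comp)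
  have lp: "linear p" unfolding p_def by (rule linear_orth_proj[OF W])
  have pin: "p x \<in> V\<^sup>\<bottom>" for x unfolding p_def by (rule orth_proj_in[OF W])
  have np: "norm (p x) \<le> norm x" "norm (x - p x) \<le> norm x" for x
    unfolding p_def by (rule norm_orth_proj_le[OF W], rule norm_minus_orth_proj_le[OF W])
  have pV: "x - p x \<in> V" for x
    using orth_proj_compl[OF W, of x] orthogonal_comp_self[OF V(1)] by (simp add: p_def)
  have bp: "bounded (p ` F)"
    using bounded_F lp by (simp add: bounded_linear_image linear_conv_bounded_linear)
  obtain c where c: "0 < c" "\<forall>r R. 0 < r \<and> r < R \<longrightarrow>
     (\<forall>x\<in>F. real (covering_number r (cball x R \<inter> F)) \<le> c * (R / r) powr \<beta>)"
    using assouad_exponentsD[OF \<beta>] by blast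
  obtain \<kappa> where \<kappa>: "0 < \<kappa>" "\<And>R r. \<lbrakk>0 < r; 0 < R\<rbrakk> \<Longrightarrow>
    \<exists>P. finite P \<and> P \<subseteq> V \<inter> cball 0 R \<and> separated r P \<and> \<kappa> * (R / r) ^ dim V \<le> real (card P)"
    using subspace_ball_separated[OF V(1)] by metis
  define T where "T = V \<inter> cball 0 (4 * M)"
  have T: "bounded T" "T \<subseteq> limit_translations"
    using V(2) translation_spaceD by (auto simp: T_def intro: bounded_subset[OF bounded_cball])
  obtain A0 where A0: "A0 \<in> L" using L_nonempty by blast
  have "real (covering_number r (cball y R \<inter> p ` F)) * (R / r) powr dim V
      \<le> (c * 12 powr \<beta> / \<kappa>) * (R / r) powr \<beta>"
    if r: "0 < r" "r < R" "R \<le> 2 * M" and y: "y \<in> p ` F" for r R y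
  proof -
    obtain x0 where x0: "x0 \<in> F" "y = p x0" using y by blast
    have "bounded (cball y R \<inter> p ` F)" using bp by blast
    from maximal_separated[OF this r(1)] obtain Q where Q: "Q \<subseteq> cball y R \<inter> p ` F" "finite Q"
      "separated r Q" "covering_number r (cball y R \<inter> p ` F) \<le> card Q" by metis
    obtain P where P: "finite P" "P \<subseteq> V \<inter> cball 0 R" "separated r P"
      "\<kappa> * (R / r) ^ dim V \<le> real (card P)"
      using \<kappa>(2)[of r R] r by auto
    have "\<forall>q\<in>Q. \<exists>l\<in>F. p l = q" using Q(1) by blast
    then obtain l where l: "\<And>q. q \<in> Q \<Longrightarrow> l q \<in> F \<and> p (l q) = q" by metis
    \<comment> \<open>The shift by \<open>x0 - y\<close>, a vector of V, moves the product from the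
      point y of the projection to the point x0 of F above it.\<close>
    define z where "z = (\<lambda>(q, u). q + u + (x0 - y))"
    have "0 < r / 8" using r by simp
    from bounded_translates_approx[OF T A0 this] obtain A where A: "A \<in> L"
      "\<forall>w\<in>T. \<forall>x\<in>F. \<exists>y\<in>inv A ` F. dist y (x + w) \<le> r / 8" by blast
    have sA: "similarity_map A" using sim A by blast
    have "\<exists>g\<in>F. dist (inv A g) (z s) \<le> r / 8" if s: "s \<in> Q \<times> P" for s
    proof -
      obtain q u where qu: "s = (q, u)" "q \<in> Q" "u \<in> P" using s by auto
      \<comment> \<open>Replaces the V-component of the lift of q by that of x0 plus u, so that
        \<open>l q + w\<close> is the product point.\<close>
      define w where "w = (x0 - y) + u - (l q - q)"
      have "w \<in> V"
      proof -
        have "x0 - y \<in> V" "l q - q \<in> V" "u \<in> V"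
          using l[OF qu(2)] pV[of "l q"] pV[of x0] x0 P(2) qu(3) by auto
        then show ?thesis unfolding w_def by (meson subspace_diff subspace_add V(1))
      qed
      moreover have "norm w \<le> 4 * M"
      proof -
        have "norm w \<le> norm (x0 - y) + norm u + norm (l q - q)"
          unfolding w_def using norm_triangle_ineq4[of "(x0 - y) + u" "l q - q"]
            norm_triangle_ineq[of "x0 - y" u] by linarith
        moreover have "norm (x0 - y) \<le> M" using np(2)[of x0] x0 M(2) by force
        moreover have "norm (l q - q) \<le> M" using np(2)[of "l q"] l[OF qu(2)] M(2) by force
        moreover have "norm u \<le> R" using qu P(2) by auto
        ultimately show ?thesis using r by linarith
      qed
      ultimately have "w \<in> T" by (simp add: T_def)
      moreover have "l q + w = z s" by (simp add: w_def z_def qu)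
      ultimately show ?thesis using A(2) l[OF qu(2)] by fastforce
    qed
    then obtain g where g: "\<And>s. s \<in> Q \<times> P \<Longrightarrow> g s \<in> F \<and> dist (inv A (g s)) (z s) \<le> r / 8" by metis
    \<comment> \<open>Assouad bounds refer to balls centred in the set. The zero translation
      supplies a centre: a point of the magnified copy close to x0.\<close>
    have "0 \<in> T" using V(1) M by (simp add: T_def subspace_0)
    then obtain f0 where f0: "f0 \<in> F" "dist (inv A f0) x0 \<le> r / 8" using A(2) x0 by force
    have zsep: "r < dist (z s) (z s')" if s: "s \<in> Q \<times> P" "s' \<in> Q \<times> P" "s \<noteq> s'" for s s'
    proof -
      obtain q u q' u' where qu: "s = (q, u)" "q \<in> Q" "u \<in> P" "s' = (q', u')" "q' \<in> Q" "u' \<in> P"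
        using s by auto
      have "q - q' \<in> V\<^sup>\<bottom>"
        using l[OF qu(2)] l[OF qu(5)] pin[of "l q"] pin[of "l q'"] subspace_diff[OF W] by metis
      moreover have "u - u' \<in> V" using qu P(2) subspace_diff[OF V(1)] by blast
      ultimately have o: "orthogonal (q - q') (u - u')"
        by (auto simp: orthogonal_comp_def orthogonal_commute)
      have "dist (z s) (z s') = norm ((q - q') + (u - u'))"
        by (simp add: z_def qu dist_norm algebra_simps)
      then have "norm (q - q') \<le> dist (z s) (z s')" "norm (u - u') \<le> dist (z s) (z s')"
        using norm_orthogonal_add[OF o] by auto
      moreover have "r < norm (q - q') \<or> r < norm (u - u')"
        using qu s(3) Q(3) P(3) by (auto simp: separated_def dist_norm)
      ultimately show ?thesis by linarith
    qed
    define h where "h = inv A \<circ> g"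
    \<comment> \<open>Two errors of \<open>r / 8\<close> leave more than \<open>r / 2\<close> of the
      separation r, hence the radius \<open>r / 4\<close> in the count.\<close>
    have hsep: "2 * (r / 4) < dist (h s) (h s')" if s: "s \<in> Q \<times> P" "s' \<in> Q \<times> P" "s \<noteq> s'" for s s'
    proof -
      have "dist (z s) (z s') \<le> dist (z s) (h s) + dist (h s) (z s')" by (rule dist_triangle)
      also have "dist (h s) (z s') \<le> dist (h s) (h s') + dist (h s') (z s')" by (rule dist_triangle)
      finally show ?thesis
        using g[OF s(1)] g[OF s(2)] zsep[OF s] r unfolding h_def by (simp add: dist_commute)
    qed
    define E where "E = inv A ` F \<inter> cball (inv A f0) (3 * R)"
    have bE: "bounded E" unfolding E_def by blast
    have "inj_on h (Q \<times> P)"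
    proof (rule inj_onI, rule ccontr)
      fix s s' assume "s \<in> Q \<times> P" "s' \<in> Q \<times> P" "h s = h s'" "s \<noteq> s'"
      then show False using hsep[of s s'] r by simp
    qed
    then have "card (h ` (Q \<times> P)) = card Q * card P"
      by (simp add: card_image card_cartesian_product)
    moreover have "h ` (Q \<times> P) \<subseteq> E"
    proof
      fix v assume "v \<in> h ` (Q \<times> P)"
      then obtain s where s: "s \<in> Q \<times> P" "v = h s" by blast
      obtain q u where qu: "s = (q, u)" "q \<in> Q" "u \<in> P" using s by auto
      have "dist x0 (z s) \<le> norm (q - y) + norm u"
        using norm_triangle_ineq[of "q - y" u] by (simp add: z_def qu dist_norm norm_minus_commute algebra_simps)
      moreover have "norm (q - y) \<le> R" "norm u \<le> R"
        using qu Q(1) P(2) by (auto simp: dist_norm norm_minus_commute)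
      ultimately have "dist x0 (z s) \<le> 2 * R" by linarith
      moreover have "dist (inv A f0) (h s) \<le> dist (inv A f0) x0 + dist x0 (z s) + dist (z s) (h s)"
        using dist_triangle[of "inv A f0" "h s" x0] dist_triangle[of x0 "h s" "z s"] by linarith
      ultimately have "dist (inv A f0) (h s) \<le> 3 * R"
        using f0(2) g[OF s(1)] r by (simp add: h_def dist_commute)
      then show "v \<in> E" using s g[OF s(1)] by (simp add: E_def h_def)
    qed
    moreover have "separated (2 * (r / 4)) (h ` (Q \<times> P))"
      using hsep by (auto simp: separated_def)
    ultimately have "card Q * card P \<le> covering_number (r / 4) E"
      using separated_card_le(2)[of "h ` (Q \<times> P)" E "r / 4"] bE r by simp
    also have "\<dots> = covering_number (sim_ratio A * (r / 4)) (A ` E)"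
      using covering_number_similarity[OF sA bE, of "r / 4"] r by simp
    also have "\<dots> \<le> covering_number (sim_ratio A * (r / 4)) (cball f0 (sim_ratio A * (3 * R)) \<inter> F)"
    proof (rule covering_number_mono)
      show "A ` E \<subseteq> cball f0 (sim_ratio A * (3 * R)) \<inter> F"
      proof
        fix v assume "v \<in> A ` E"
        then obtain e f where e: "e \<in> E" "v = A e" "f \<in> F" "e = inv A f" by (auto simp: E_def)
        have "dist (A (inv A f0)) (A e) = sim_ratio A * dist (inv A f0) e" by (rule sim_dist[OF sA])
        also have "\<dots> \<le> sim_ratio A * (3 * R)"
          using e(1) ratio_pos[OF A(1)] by (intro mult_left_mono) (auto simp: E_def)
        finally show "v \<in> cball f0 (sim_ratio A * (3 * R)) \<inter> F" using e sA by simp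
      qed
    qed (use r ratio_pos[OF A(1)] bounded_F in auto)
    finally have "real (card Q * card P)
        \<le> real (covering_number (sim_ratio A * (r / 4)) (cball f0 (sim_ratio A * (3 * R)) \<inter> F))"
      by (rule of_nat_mono)
    also have "\<dots> \<le> c * ((sim_ratio A * (3 * R)) / (sim_ratio A * (r / 4))) powr \<beta>"
    proof (rule c(2)[rule_format, OF _ f0(1)])
      show "0 < sim_ratio A * (r / 4) \<and> sim_ratio A * (r / 4) < sim_ratio A * (3 * R)"
        using r ratio_pos[OF A(1)] by (intro conjI mult_strict_left_mono) auto
    qed
    also have "(sim_ratio A * (3 * R)) / (sim_ratio A * (r / 4)) = 12 * (R / r)"
      using ratio_pos[OF A(1)] r by (simp add: field_simps)
    also have "(12 * (R / r)) powr \<beta> = 12 powr \<beta> * (R / r) powr \<beta>"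
      using r by (intro powr_mult)
    finally have *: "real (card Q) * real (card P) \<le> c * (12 powr \<beta> * (R / r) powr \<beta>)" by simp
    have "real (covering_number r (cball y R \<inter> p ` F)) * (\<kappa> * (R / r) ^ dim V)
        \<le> real (card Q) * real (card P)"
      using Q(4) P(4) \<kappa>(1) r by (intro mult_mono) auto
    also note *
    finally show ?thesis
      using \<kappa>(1) r by (simp add: powr_realpow field_simps)
  qed
  moreover have "0 < c * 12 powr \<beta> / \<kappa>" using c(1) \<kappa>(1) by simp
  ultimately show ?thesis unfolding p_def by blast
qed

lemma assouad_exponents_projection_converse:
  assumes V: "subspace V" "V \<subseteq> translation_space" and \<beta>: "\<beta> \<in> assouad_exponents F"
  shows "\<beta> - real (dim V) \<in> assouad_exponents (orth_proj (V\<^sup>\<bottom>) ` F)"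
proof -
  obtain M where M: "0 < M" "\<forall>x\<in>F. norm x \<le> M" using F_bound by blast
  define p where "p = orth_proj (V\<^sup>\<bottom>)"
  have W: "subspace (V\<^sup>\<bottom>)" by (rule subspace_orthogonal_comp)
  have lp: "linear p" unfolding p_def by (rule linear_orth_proj[OF W])
  have bp: "bounded (p ` F)"
    using bounded_F lp by (simp add: bounded_linear_image linear_conv_bounded_linear)
  have pM: "norm y \<le> M" if "y \<in> p ` F" for y
    using that M(2) norm_orth_proj_le[OF W] by (force simp: p_def intro: order_trans)
  obtain c where c: "0 < c" "\<forall>r R. 0 < r \<and> r < R \<and> R \<le> 2 * M \<longrightarrow> (\<forall>y\<in>p ` F.
    real (covering_number r (cball y R \<inter> p ` F)) * (R / r) powr dim V \<le> c * (R / r) powr \<beta>)"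
    using product_covering_bound[OF V \<beta> M] unfolding p_def by blast
  have cov: "real (covering_number r (cball y R \<inter> p ` F)) \<le> c * (R / r) powr (\<beta> - dim V)"
    if "0 < r" "r < R" "R \<le> 2 * M" "y \<in> p ` F" for r R y
    using c(2)[rule_format, of r R y] that by (simp add: powr_diff le_divide_eq)
  \<comment> \<open>Exponents are nonnegative by definition, so this is part of the claim: covering
    numbers are at least 1 and cannot be bounded by a power tending to 0 at small scales.\<close>
  have "0 \<le> \<beta> - dim V"
  proof (rule ccontr)
    assume neg: "\<not> ?thesis"
    obtain y where y: "y \<in> p ` F" using F_nonempty by blast
    have bd: "1 \<le> c * x powr (\<beta> - dim V)" if x: "1 < x" for x
    proof -
      have r: "0 < 2 * M / x" "2 * M / x < 2 * M" using x M(1) by (auto simp: divide_less_eq)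
      have "1 \<le> covering_number (2 * M / x) (cball y (2 * M) \<inter> p ` F)"
      proof (rule covering_number_pos)
        have "y \<in> cball y (2 * M) \<inter> p ` F" using y M(1) by simp
        then show "cball y (2 * M) \<inter> p ` F \<noteq> {}" by blast
      qed (use r in auto)
      then have "1 \<le> real (covering_number (2 * M / x) (cball y (2 * M) \<inter> p ` F))" by linarith
      also have "\<dots> \<le> c * (2 * M / (2 * M / x)) powr (\<beta> - dim V)"
        using cov[OF r order.refl y] .
      finally show ?thesis using M(1) x by simp
    qed
    have "((\<lambda>x. c * x powr (\<beta> - dim V)) \<longlongrightarrow> c * 0) at_top"
      using neg by (intro tendsto_intros tendsto_neg_powr filterlim_ident) auto
    then have "eventually (\<lambda>x. c * x powr (\<beta> - dim V) < 1) at_top"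
      by (rule order_tendstoD) simp
    then have "eventually (\<lambda>x::real. False) at_top"
      using eventually_gt_at_top[of 1] by eventually_elim (use bd in force)
    then show False by simp
  qed
  then show ?thesis
    unfolding p_def[symmetric]
  proof (rule assouad_exponents_localI[OF bp, where D = "2 * M" and c = c])
    fix y assume y: "y \<in> p ` F"
    show "p ` F \<subseteq> cball y (2 * M)"
    proof
      fix z assume "z \<in> p ` F"
      then show "z \<in> cball y (2 * M)"
        using pM[OF y] pM[of z] norm_triangle_ineq4[of y z] by (simp add: dist_norm)
    qed
  qed (use M(1) cov in auto)
qed

text \<open>By the two halves the sets of exponents are translates of each other by
  \<open>dim V\<close>.\<close>

lemma assouad_dim_projection:
  assumes V: "subspace V" "V \<subseteq> translation_space"
  shows "assouad_dim F = real (dim V) + assouad_dim (orth_proj (V\<^sup>\<bottom>) ` F)"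
proof -
  let ?S = "assouad_exponents (orth_proj (V\<^sup>\<bottom>) ` F)"
  have "assouad_exponents F = (\<lambda>x. real (dim V) + x) ` ?S"
  proof (intro subset_antisym subsetI)
    fix \<beta> assume "\<beta> \<in> assouad_exponents F"
    then have "\<beta> - real (dim V) \<in> ?S" by (rule assouad_exponents_projection_converse[OF V])
    then show "\<beta> \<in> (\<lambda>x. real (dim V) + x) ` ?S" by force
  next
    fix \<beta> assume "\<beta> \<in> (\<lambda>x. real (dim V) + x) ` ?S"
    then show "\<beta> \<in> assouad_exponents F"
      using assouad_exponents_projection[OF V(1) bounded_F] by (auto simp: add.commute)
  qed
  moreover have "Inf ((\<lambda>x. real (dim V) + x) ` ?S) = real (dim V) + Inf ?S"
    by (rule Inf_add_eq[of "\<lambda>x. x" ?S "real (dim V)", unfolded image_ident,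
          OF assouad_exponents_bdd_below assouad_exponents_nonempty])
  ultimately show ?thesis by (simp add: assouad_dim_eq_Inf)
qed

end

section \<open>Invariance of the translation space\<close>

text \<open>In the map built from \<open>q \<circ> C \<circ> g\<close>,
  \<open>q \<circ> D \<circ> g\<close> and A the factor g cancels, and what remains is the map built
  from C, D and \<open>g \<circ> A \<circ> q\<close>, conjugated by q. For vertices, q and g belong
  to paths between the two in opposite directions.\<close>

lemma limit_translations_transfer:
  assumes L: "loop_semigroup L F" and L': "loop_semigroup L' F'"
    and q: "similarity_map q" and g: "similarity_map g"
    and to: "\<And>A. A \<in> L' \<Longrightarrow> g \<circ> A \<circ> q \<in> L" and fro: "\<And>C. C \<in> L \<Longrightarrow> q \<circ> C \<circ> g \<in> L'"
    and w: "w \<in> loop_semigroup.limit_translations L"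
  shows "sim_ratio q *\<^sub>R sim_lin q w \<in> loop_semigroup.limit_translations L'"
  unfolding loop_semigroup.limit_translations_def[OF L']
proof (intro CollectI ballI allI impI)
  interpret L: loop_semigroup L F by (rule L)
  interpret L': loop_semigroup L' F' by (rule L')
  fix A and \<eta> R :: real assume A: "A \<in> L'" and \<eta>: "0 < \<eta>"
  define R' where "R' = sim_ratio (inv q) * R + norm (inv q 0)"
  have rq: "0 < sim_ratio q" using sim_ratio_pos[OF q] .
  have "0 < \<eta> / sim_ratio q" using \<eta> rq by simp
  from L.limit_translationsD[OF w to[OF A] this, of R'] obtain C D where CD: "C \<in> L" "D \<in> L"
    "\<forall>x. norm x \<le> R' \<longrightarrow> norm (inv (g \<circ> A \<circ> q) (inv C (D ((g \<circ> A \<circ> q) x))) - x - w) \<le> \<eta> / sim_ratio q"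
    by blast
  note sims = L'.sim[OF A] L.sim[OF CD(1)] L.sim[OF CD(2)] q g
  have "norm (inv A (inv (q \<circ> C \<circ> g) ((q \<circ> D \<circ> g) (A x))) - x - sim_ratio q *\<^sub>R sim_lin q w) \<le> \<eta>"
    if x: "norm x \<le> R" for x
  proof -
    define y where "y = inv q x"
    have y: "q y = x" using q by (simp add: y_def)
    have "norm y \<le> dist (inv q x) (inv q 0) + norm (inv q 0)"
      unfolding y_def by (metis add.commute dist_norm norm_triangle_sub)
    also have "\<dots> \<le> R'"
      using x sim_ratio_pos[OF similarity_map_inv[OF q]]
      by (simp add: R'_def sim_dist[OF similarity_map_inv[OF q]] mult_left_mono)
    finally have "norm y \<le> R'" .
    define z where "z = inv (g \<circ> A \<circ> q) (inv C (D ((g \<circ> A \<circ> q) y)))"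
    have z: "norm (z - y - w) \<le> \<eta> / sim_ratio q" using CD(3) \<open>norm y \<le> R'\<close> by (auto simp: z_def)
    have "q z = inv A (inv g (inv C (D (g (A (q y))))))"
      using sims by (simp add: z_def inv_sim_comp similarity_map_comp)
    also have "\<dots> = inv A (inv (q \<circ> C \<circ> g) ((q \<circ> D \<circ> g) (A x)))"
      using sims by (simp add: y inv_sim_comp similarity_map_comp)
    finally have "inv A (inv (q \<circ> C \<circ> g) ((q \<circ> D \<circ> g) (A x))) - x - sim_ratio q *\<^sub>R sim_lin q w
        = q z - q y - sim_ratio q *\<^sub>R sim_lin q w" by (simp add: y)
    also have "\<dots> = sim_ratio q *\<^sub>R sim_lin q (z - y - w)"
      by (simp add: sim_diff[OF q] linear_diff[OF linear_sim_lin[OF q]] scaleR_diff_right)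
    finally show ?thesis
      using z rq by (simp add: norm_sim_lin[OF q] le_divide_eq mult.commute)
  qed
  then show "\<exists>C\<in>L'. \<exists>D\<in>L'. \<forall>x. norm x \<le> R \<longrightarrow>
      norm (inv A (inv C (D (A x))) - x - sim_ratio q *\<^sub>R sim_lin q w) \<le> \<eta>"
    using fro CD by blast
qed

lemma translation_space_transfer:
  assumes L: "loop_semigroup L F" and L': "loop_semigroup L' F'"
    and q: "similarity_map q" and g: "similarity_map g"
    and to: "\<And>A. A \<in> L' \<Longrightarrow> g \<circ> A \<circ> q \<in> L" and fro: "\<And>C. C \<in> L \<Longrightarrow> q \<circ> C \<circ> g \<in> L'"
    and w: "w \<in> loop_semigroup.translation_space L"
  shows "sim_lin q w \<in> loop_semigroup.translation_space L'"
  unfolding loop_semigroup.translation_space_def[OF L']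
proof (intro CollectI allI)
  fix t :: real
  have rq: "0 < sim_ratio q" using sim_ratio_pos[OF q] .
  have "(t / sim_ratio q) *\<^sub>R w \<in> loop_semigroup.limit_translations L"
    using w unfolding loop_semigroup.translation_space_def[OF L] by blast
  from limit_translations_transfer[OF L L' q g to fro this]
  show "t *\<^sub>R sim_lin q w \<in> loop_semigroup.limit_translations L'"
    using rq by (simp add: linear_scale[OF linear_sim_lin[OF q]])
qed

lemma dim_translation_space_le:
  assumes L: "loop_semigroup L F" and L': "loop_semigroup L' F'"
    and q: "similarity_map q" and g: "similarity_map g"
    and to: "\<And>A. A \<in> L' \<Longrightarrow> g \<circ> A \<circ> q \<in> L" and fro: "\<And>C. C \<in> L \<Longrightarrow> q \<circ> C \<circ> g \<in> L'"
  shows "dim (loop_semigroup.translation_space L) \<le> dim (loop_semigroup.translation_space L')"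
proof -
  have "inj (sim_lin q)" using orthogonal_transformation_inj[OF sim_lin_orthogonal[OF q]] .
  then have "dim (sim_lin q ` loop_semigroup.translation_space L) = dim (loop_semigroup.translation_space L)"
    using dim_image_eq[OF linear_sim_lin[OF q]] by (meson inj_on_subset subset_UNIV)
  then show ?thesis
    using translation_space_transfer[OF assms] by (metis dim_subset image_subsetI)
qed

context loop_semigroup
begin

text \<open>The transfer with \<open>q = g = A\<close> gives one inclusion; equality follows by
  dimension, as no inverses are available in L.\<close>

lemma sim_lin_translation_space:
  assumes "A \<in> L"
  shows "sim_lin A ` translation_space = translation_space"
proof (rule subspace_dim_equal)
  show "subspace translation_space" by (rule subspace_translation_space)
  show "subspace (sim_lin A ` translation_space)"
    using linear_subspace_image[OF linear_sim_lin[OF sim[OF assms]] subspace_translation_space] .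
  show "sim_lin A ` translation_space \<subseteq> translation_space"
    using translation_space_transfer[OF loop_semigroup_axioms loop_semigroup_axioms sim[OF assms] sim[OF assms]]
      assms comp_in by blast
  have "inj (sim_lin A)" using orthogonal_transformation_inj[OF sim_lin_orthogonal[OF sim[OF assms]]] .
  then show "dim translation_space \<le> dim (sim_lin A ` translation_space)"
    using dim_image_eq[OF linear_sim_lin[OF sim[OF assms]]]
    by (metis inj_on_subset order.refl subset_UNIV)
qed

section \<open>The strict lower bound for the dimension\<close>

text \<open>Since rotations preserve V, they commute with the projection, so that elements of L
  scale projected distances by their ratio. Words of length n in two maps whose pieces have disjoint
  projections then give \<open>2 ^ n\<close> points with geometrically decreasing
  separation.\<close>

lemma projection_positive_exponents:
  assumes V: "subspace V" "\<And>A. A \<in> L \<Longrightarrow> sim_lin A ` V = V"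
    and xy: "x \<in> F" "y \<in> F" "orth_proj (V\<^sup>\<bottom>) x \<noteq> orth_proj (V\<^sup>\<bottom>) y"
  shows "\<exists>\<alpha>\<^sub>0>0. \<forall>\<alpha>\<in>assouad_exponents (orth_proj (V\<^sup>\<bottom>) ` F). \<alpha>\<^sub>0 \<le> \<alpha>"
proof -
  define p where "p = orth_proj (V\<^sup>\<bottom>)"
  have W: "subspace (V\<^sup>\<bottom>)" by (rule subspace_orthogonal_comp)
  have lp: "linear p" unfolding p_def by (rule linear_orth_proj[OF W])
  have pin: "p z \<in> V\<^sup>\<bottom>" for z unfolding p_def by (rule orth_proj_in[OF W])
  have pV: "z - p z \<in> V" for z
    using orth_proj_compl[OF W, of z] orthogonal_comp_self[OF V(1)] by (simp add: p_def)
  have np: "norm (p z) \<le> norm z" for z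
    unfolding p_def by (rule norm_orth_proj_le[OF W])
  have perp: "z \<in> V\<^sup>\<bottom>" if "\<forall>v\<in>V. orthogonal v z" for z
    using that by (simp add: orthogonal_comp_def)
  have pA: "norm (p (A u) - p (A v)) = sim_ratio A * norm (p u - p v)" if A: "A \<in> L" for A u v
  proof -
    have o: "orthogonal_transformation (sim_lin A)" and lA: "linear (sim_lin A)"
      using sim_lin_orthogonal linear_sim_lin sim[OF A] by blast+
    have "p (sim_lin A z) = sim_lin A (p z)" for z
      unfolding p_def
    proof (rule orth_proj_eq[OF W])
      show "sim_lin A (orth_proj (V\<^sup>\<bottom>) z) \<in> V\<^sup>\<bottom>"
      proof (rule perp, rule ballI)
        fix v assume "v \<in> V"
        then obtain v' where v': "v' \<in> V" "v = sim_lin A v'" using V(2)[OF A] by blast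
        have "sim_lin A v' \<bullet> sim_lin A (p z) = v' \<bullet> p z" using o by (simp add: orthogonal_transformation_def)
        also have "\<dots> = 0" using pin[of z] v'(1) by (simp add: orthogonal_comp_def orthogonal_def inner_commute)
        finally show "orthogonal v (sim_lin A (orth_proj (V\<^sup>\<bottom>) z))"
          by (simp add: v' orthogonal_def p_def)
      qed
      have "sim_lin A (z - p z) \<in> V" using V(2)[OF A] pV[of z] by blast
      then show "sim_lin A z - sim_lin A (orth_proj (V\<^sup>\<bottom>) z) \<in> V\<^sup>\<bottom>\<^sup>\<bottom>"
        by (simp add: orthogonal_comp_self[OF V(1)] p_def linear_diff[OF lA])
    qed
    then have "p (A u) - p (A v) = sim_ratio A *\<^sub>R sim_lin A (p (u - v))"
      by (simp add: linear_diff[OF lp, symmetric] sim_diff[OF sim[OF A]] linear_scale[OF lp])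
    then show ?thesis
      using ratio_pos[OF A] norm_sim_lin[OF sim[OF A]] by (simp add: linear_diff[OF lp])
  qed
  \<comment> \<open>Pieces within \<open>\<gamma> / 4\<close> of x and of y still have projections
    more than \<open>\<gamma> / 4\<close> apart.\<close>
  define \<gamma> where "\<gamma> = norm (p x - p y)"
  have \<gamma>: "0 < \<gamma>" "0 < \<gamma> / 4" using xy by (auto simp: \<gamma>_def p_def)
  obtain M where M: "0 < M" "\<forall>x\<in>F. norm x \<le> M" using F_bound by blast
  obtain A where A: "A \<in> L" "\<And>z. z \<in> F \<Longrightarrow> dist (A z) x \<le> \<gamma> / 4"
    using small_piece_ball[OF xy(1) \<gamma>(2), of M] M(2) by blast
  obtain B where B: "B \<in> L" "\<And>z. z \<in> F \<Longrightarrow> dist (B z) y \<le> \<gamma> / 4"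
    using small_piece_ball[OF xy(2) \<gamma>(2), of M] M(2) by blast
  have AB: "\<gamma> / 4 < norm (p (A u) - p (B v))" if "u \<in> F" "v \<in> F" for u v
  proof -
    have "norm (p (A u) - p x) \<le> \<gamma> / 4" "norm (p (B v) - p y) \<le> \<gamma> / 4"
      using A(2)[OF that(1)] B(2)[OF that(2)] np[of "A u - x"] np[of "B v - y"]
      by (simp_all add: linear_diff[OF lp] dist_norm)
    moreover have "\<gamma> \<le> norm (p (A u) - p x) + norm (p (A u) - p (B v)) + norm (p (B v) - p y)"
      using norm_triangle_ineq[of "p x - p (A u)" "p (A u) - p (B v)"]
        norm_triangle_ineq[of "p x - p (B v)" "p (B v) - p y"]
      unfolding \<gamma>_def by (simp add: norm_minus_commute)
    ultimately show ?thesis using \<gamma> by linarith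
  qed
  \<comment> \<open>A common lower bound for both ratios, so that the separation at level n does not
    depend on the word.\<close>
  define t where "t = min (sim_ratio A) (sim_ratio B)"
  have t: "0 < t" "t < 1" "t \<le> sim_ratio A" "t \<le> sim_ratio B"
    using ratio_pos[OF A(1)] ratio_pos[OF B(1)] ratio_less_1[OF A(1)] by (auto simp: t_def min_def)
  have words: "\<exists>U\<subseteq>F. finite U \<and> card U = 2 ^ n \<and>
      (\<forall>u\<in>U. \<forall>v\<in>U. u \<noteq> v \<longrightarrow> t ^ n * (\<gamma> / 4) < norm (p u - p v))" for n
  proof (induction n)
    case 0
    show ?case by (intro exI[of _ "{x}"]) (use xy in auto)
  next
    case (Suc n)
    then obtain U where U: "U \<subseteq> F" "finite U" "card U = 2 ^ n"
      "\<forall>u\<in>U. \<forall>v\<in>U. u \<noteq> v \<longrightarrow> t ^ n * (\<gamma> / 4) < norm (p u - p v)" by blast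
    have same: "t ^ Suc n * (\<gamma> / 4) < norm (p (C u) - p (C v))"
      if C: "C \<in> L" "t \<le> sim_ratio C" and uv: "u \<in> U" "v \<in> U" "u \<noteq> v" for C u v
    proof -
      have "t * (t ^ n * (\<gamma> / 4)) < t * norm (p u - p v)"
        using U(4) uv t(1) by (intro mult_strict_left_mono) auto
      also have "\<dots> \<le> sim_ratio C * norm (p u - p v)" using C(2) by (intro mult_right_mono) auto
      finally show ?thesis by (simp add: pA[OF C(1)] mult.assoc)
    qed
    have "t ^ Suc n * (\<gamma> / 4) \<le> 1 * (\<gamma> / 4)"
      using t \<gamma> by (intro mult_right_mono power_le_one) auto
    have diff: "t ^ Suc n * (\<gamma> / 4) < norm (p (A u) - p (B v))"
      "t ^ Suc n * (\<gamma> / 4) < norm (p (B v) - p (A u))" if "u \<in> U" "v \<in> U" for u v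
    proof -
      have "\<gamma> / 4 < norm (p (A u) - p (B v))" using AB U(1) that by blast
      then show "t ^ Suc n * (\<gamma> / 4) < norm (p (A u) - p (B v))"
        "t ^ Suc n * (\<gamma> / 4) < norm (p (B v) - p (A u))"
        using \<open>t ^ Suc n * (\<gamma> / 4) \<le> 1 * (\<gamma> / 4)\<close> norm_minus_commute[of "p (A u)" "p (B v)"] by linarith+
    qed
    have inj: "inj_on C U" if "C \<in> L" for C
      using bij_similarity_map[OF sim[OF that]] by (meson bij_def inj_on_subset subset_UNIV)
    have "A ` U \<inter> B ` U = {}"
    proof (rule ccontr)
      assume "A ` U \<inter> B ` U \<noteq> {}"
      then obtain u v where "u \<in> U" "v \<in> U" "A u = B v" by blast
      then show False using AB[of u v] U(1) \<gamma> by auto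
    qed
    then have "card (A ` U \<union> B ` U) = 2 ^ Suc n"
      using U inj A(1) B(1) by (simp add: card_Un_disjoint card_image)
    moreover have "A ` U \<union> B ` U \<subseteq> F" using U(1) maps_F A(1) B(1) by blast
    moreover have "\<forall>u\<in>A ` U \<union> B ` U. \<forall>v\<in>A ` U \<union> B ` U. u \<noteq> v \<longrightarrow>
        t ^ Suc n * (\<gamma> / 4) < norm (p u - p v)"
      using same[OF A(1) t(3)] same[OF B(1) t(4)] diff by blast
    ultimately show ?case using U(2) by (intro exI[of _ "A ` U \<union> B ` U"]) auto
  qed
  define \<alpha>\<^sub>0 where "\<alpha>\<^sub>0 = ln 2 / ln (1 / t)"
  have lt: "0 < ln (1 / t)" using t by simp
  have "\<alpha>\<^sub>0 \<le> \<alpha>" if \<alpha>: "\<alpha> \<in> assouad_exponents (p ` F)" for \<alpha>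
  proof (rule ccontr)
    assume less: "\<not> \<alpha>\<^sub>0 \<le> \<alpha>"
    define D where "D = 2 * M + \<gamma>"
    have D: "0 < D" "\<gamma> < D" using M \<gamma> by (auto simp: D_def)
    obtain c where c: "0 < c" "\<forall>r R. 0 < r \<and> r < R \<longrightarrow>
     (\<forall>x\<in>p ` F. real (covering_number r (cball x R \<inter> p ` F)) \<le> c * (R / r) powr \<alpha>)"
      using assouad_exponentsD[OF \<alpha>] by blast
    have "\<alpha> * ln (1 / t) < ln 2" using less lt by (simp add: \<alpha>\<^sub>0_def not_le less_divide_eq)
    then have "(1 / t) powr \<alpha> < 2"
      using t by (subst ln_less_cancel_iff[symmetric]) (auto simp: ln_powr)
    \<comment> \<open>Compares the factor 2 by which the points multiply with the growth per level
      that \<alpha> permits; it exceeds 1 because \<alpha> is below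
      \<open>\<alpha>\<^sub>0\<close>.\<close>
    define s where "s = 2 / (1 / t) powr \<alpha>"
    have s: "1 < s" using \<open>(1 / t) powr \<alpha> < 2\<close> t by (simp add: s_def)
    have "s ^ n \<le> c * (8 * D / \<gamma>) powr \<alpha>" for n
    proof -
      obtain U where U: "U \<subseteq> F" "finite U" "card U = 2 ^ n"
        "\<forall>u\<in>U. \<forall>v\<in>U. u \<noteq> v \<longrightarrow> t ^ n * (\<gamma> / 4) < norm (p u - p v)" using words by blast
      define r where "r = t ^ n * (\<gamma> / 8)"
      have r: "0 < r" "r < D"
      proof -
        show "0 < r" using t \<gamma> by (simp add: r_def)
        have "r \<le> 1 * (\<gamma> / 8)" unfolding r_def using t \<gamma> by (intro mult_right_mono power_le_one) auto
        then show "r < D" using D \<gamma> by linarith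
      qed
      have "inj_on p U"
      proof (rule inj_onI, rule ccontr)
        fix u v assume uv: "u \<in> U" "v \<in> U" "p u = p v" "u \<noteq> v"
        have "0 < t ^ n * (\<gamma> / 4)" using t \<gamma> by simp
        then show False using U(4) uv by force
      qed
      then have cU: "card (p ` U) = 2 ^ n" using U(3) by (simp add: card_image)
      have "p ` F \<subseteq> cball (p x) D"
      proof
        fix z assume "z \<in> p ` F"
        then obtain f where f: "f \<in> F" "z = p f" by blast
        have "norm (p f) \<le> M" "norm (p x) \<le> M"
          using np[of f] np[of x] M(2) f(1) xy(1) order_trans by blast+
        then show "z \<in> cball (p x) D"
          using norm_triangle_ineq4[of "p x" "p f"] \<gamma> by (simp add: dist_norm f D_def)
      qed
      then have "p ` U \<subseteq> cball (p x) D \<inter> p ` F" using U(1) by blast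
      moreover have "separated (2 * r) (p ` U)"
      proof -
        have "2 * r = t ^ n * (\<gamma> / 4)" by (simp add: r_def)
        then show ?thesis unfolding separated_def using U(4) by (force simp: dist_norm)
      qed
      ultimately have "card (p ` U) \<le> covering_number r (cball (p x) D \<inter> p ` F)"
        using r by (intro separated_card_le) auto
      then have "real (2 ^ n) \<le> real (covering_number r (cball (p x) D \<inter> p ` F))" using cU by simp
      also have "\<dots> \<le> c * (D / r) powr \<alpha>" using c(2) r xy(1) by blast
      also have "D / r = (8 * D / \<gamma>) * (1 / t) ^ n" using t \<gamma> by (simp add: r_def power_divide field_simps)
      also have "\<dots> powr \<alpha> = (8 * D / \<gamma>) powr \<alpha> * ((1 / t) ^ n) powr \<alpha>"
        using D \<gamma> t by (intro powr_mult)
      also have "((1 / t) ^ n) powr \<alpha> = ((1 / t) powr \<alpha>) ^ n"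
        using t by (simp add: powr_realpow[symmetric] powr_powr mult.commute powr_power)
      finally have "2 ^ n / ((1 / t) powr \<alpha>) ^ n \<le> c * (8 * D / \<gamma>) powr \<alpha>"
        using t by (simp add: divide_le_eq mult.assoc)
      then show ?thesis by (simp add: s_def power_divide)
    qed
    moreover obtain n where "c * (8 * D / \<gamma>) powr \<alpha> < s ^ n" using real_arch_pow[OF s] by blast
    ultimately show False using not_less by blast
  qed
  moreover have "0 < \<alpha>\<^sub>0" using lt by (simp add: \<alpha>\<^sub>0_def)
  ultimately show ?thesis unfolding p_def by blast
qed

text \<open>If the projection of F were a single point, F would lie in a translate of the
  translation space, hence in a hyperplane. So its exponents are bounded away from 0, and the
  dimension formula gives the strict inequality.\<close>

lemma dim_translation_space_less:
  assumes span: "\<And>a b. a \<noteq> 0 \<Longrightarrow> \<not> F \<subseteq> {x. a \<bullet> x = b}" and less: "dim translation_space < DIM('a)"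
  shows "real (dim translation_space) < assouad_dim F"
proof -
  let ?V = "translation_space"
  have V: "subspace ?V" by (rule subspace_translation_space)
  have W: "subspace (?V\<^sup>\<bottom>)" by (rule subspace_orthogonal_comp)
  have "span ?V \<noteq> UNIV" using less V by (metis dim_UNIV dim_span less_irrefl)
  then obtain a where a: "a \<noteq> 0" "\<forall>x\<in>span ?V. a \<bullet> x = 0"
    using span_not_univ_subset_hyperplane by blast
  then have aW: "a \<in> ?V\<^sup>\<bottom>" by (simp add: orthogonal_comp_def orthogonal_def span_base inner_commute)
  obtain x where x: "x \<in> F" using F_nonempty by blast
  have "\<exists>y\<in>F. orth_proj (?V\<^sup>\<bottom>) x \<noteq> orth_proj (?V\<^sup>\<bottom>) y"
  proof (rule ccontr)
    assume n: "\<not> ?thesis"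
    have "a \<bullet> y = a \<bullet> orth_proj (?V\<^sup>\<bottom>) x" if y: "y \<in> F" for y
    proof -
      have "y - orth_proj (?V\<^sup>\<bottom>) y \<in> ?V"
        using orth_proj_compl[OF W, of y] orthogonal_comp_self[OF V] by simp
      then have "a \<bullet> (y - orth_proj (?V\<^sup>\<bottom>) y) = 0" using a(2) by (simp add: span_base)
      then show ?thesis using n y by (simp add: inner_diff_right)
    qed
    then show False using span[OF a(1)] by blast
  qed
  then obtain y where y: "y \<in> F" "orth_proj (?V\<^sup>\<bottom>) x \<noteq> orth_proj (?V\<^sup>\<bottom>) y" by blast
  obtain \<alpha>\<^sub>0 where \<alpha>\<^sub>0: "0 < \<alpha>\<^sub>0" "\<forall>\<alpha>\<in>assouad_exponents (orth_proj (?V\<^sup>\<bottom>) ` F). \<alpha>\<^sub>0 \<le> \<alpha>"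
    using projection_positive_exponents[OF V sim_lin_translation_space x y] by blast
  have "\<alpha>\<^sub>0 \<le> assouad_dim (orth_proj (?V\<^sup>\<bottom>) ` F)"
    unfolding assouad_dim_eq_Inf
    by (rule cInf_greatest[OF assouad_exponents_nonempty]) (use \<alpha>\<^sub>0(2) in blast)
  then show ?thesis using assouad_dim_projection[OF V order.refl] \<alpha>\<^sub>0(1) by linarith
qed

section \<open>Weak tangents\<close>

text \<open>The magnified copies are chosen increasing, so that their parts in a fixed ball converge
  to the closure of their union and no subsequence has to be extracted.\<close>

lemma weak_tangent_translates:
  assumes W: "bounded W" "W \<subseteq> limit_translations" "0 \<in> W"
  shows "\<exists>K. weak_tangent F K \<and> {w + x | w x. w \<in> W \<and> x \<in> F} \<subseteq> K"
proof -
  have "\<exists>A. \<forall>n. A n \<in> L \<and> (inv (A n) ` F \<subseteq> inv (A (Suc n)) ` F \<and>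
      (\<forall>w\<in>W. \<forall>x\<in>F. \<exists>y\<in>inv (A (Suc n)) ` F. dist y (x + w) \<le> 1 / (real n + 1)))"
  proof (rule dependent_nat_choice)
    show "\<exists>A. A \<in> L" using L_nonempty by blast
    fix A0 n assume "A0 \<in> L"
    from bounded_translates_approx[OF W(1,2) this, of "1 / (real n + 1)"]
    show "\<exists>A. A \<in> L \<and> (inv A0 ` F \<subseteq> inv A ` F \<and>
      (\<forall>w\<in>W. \<forall>x\<in>F. \<exists>y\<in>inv A ` F. dist y (x + w) \<le> 1 / (real n + 1)))" by auto
  qed
  then obtain A where "\<forall>n. A n \<in> L \<and> (inv (A n) ` F \<subseteq> inv (A (Suc n)) ` F \<and>
      (\<forall>w\<in>W. \<forall>x\<in>F. \<exists>y\<in>inv (A (Suc n)) ` F. dist y (x + w) \<le> 1 / (real n + 1)))"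
    by (rule exE)
  then have A: "\<And>n. A n \<in> L" "\<And>n. inv (A n) ` F \<subseteq> inv (A (Suc n)) ` F"
    "\<And>n w x. w \<in> W \<Longrightarrow> x \<in> F \<Longrightarrow> \<exists>y\<in>inv (A (Suc n)) ` F. dist y (x + w) \<le> 1 / (real n + 1)"
    by simp_all
  define T where "T n = inv (A (Suc n))" for n
  have T: "similarity_map (T n)" for n unfolding T_def using similarity_map_inv[OF sim[OF A(1)]] .
  obtain M where M: "0 < M" "\<forall>x\<in>F. norm x \<le> M" using F_bound by blast
  obtain N where N: "0 < N" "\<forall>w\<in>W. norm w \<le> N" using W(1) bounded_pos by blast
  \<comment> \<open>Large enough for all sums of points of F and W with an approximation error of at
    most 1.\<close>
  define X where "X = cball (0::'a) (M + N + 1)"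
  define E where "E n = T n ` F \<inter> X" for n
  define U where "U = (\<Union>n. E n)"
  define K where "K = closure U"
  have near: "\<exists>y\<in>E n. dist y (x + w) \<le> 1 / (real n + 1)" if wx: "w \<in> W" "x \<in> F" for n w x
  proof -
    obtain y where y: "y \<in> T n ` F" "dist y (x + w) \<le> 1 / (real n + 1)"
      using A(3)[OF wx] unfolding T_def by metis
    have "1 / (real n + 1) \<le> 1" by simp
    moreover have "norm x \<le> M" "norm w \<le> N" using wx M N by auto
    moreover have "norm y \<le> dist y (x + w) + norm (x + w)"
      by (metis add.commute dist_norm norm_triangle_sub)
    ultimately have "norm y \<le> M + N + 1" using y(2) norm_triangle_ineq[of x w] by linarith
    then show ?thesis using y by (auto simp: E_def X_def)
  qed
  have E_ne: "E n \<noteq> {}" for n using near[OF W(3), of _ n] F_nonempty by blast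
  have E_mono: "E m \<subseteq> E n" if "m \<le> n" for m n
    using that lift_Suc_mono_le[of "\<lambda>n. inv (A n) ` F" "Suc m" "Suc n"] A(2)
    by (auto simp: E_def T_def)
  have bU: "bounded U" unfolding U_def E_def X_def by (rule bounded_subset[OF bounded_cball]) blast
  have UX: "U \<subseteq> X" unfolding U_def E_def by blast
  have KX: "K \<subseteq> X" unfolding K_def using UX by (intro closure_minimal) (auto simp: X_def)
  have cK: "compact K" unfolding K_def using bU by (simp add: compact_closure)
  have K_ne: "K \<noteq> {}" using E_ne closure_subset[of U] unfolding K_def U_def by blast
  have sub: "{w + x | w x. w \<in> W \<and> x \<in> F} \<subseteq> K"
  proof clarify
    fix w x assume wx: "w \<in> W" "x \<in> F"
    show "w + x \<in> K"
      unfolding K_def closure_approachable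
    proof (intro allI impI)
      fix e :: real assume "0 < e"
      then obtain n where n: "1 / (real n + 1) < e"
        using reals_Archimedean by (auto simp: inverse_eq_divide add.commute)
      obtain y where "y \<in> E n" "dist y (x + w) \<le> 1 / (real n + 1)" using near[OF wx] by blast
      then show "\<exists>y\<in>U. dist y (w + x) < e" using n by (force simp: U_def add.commute)
    qed
  qed
  have "(\<lambda>n. hausdorff_dist (E n) K) \<longlonglongrightarrow> 0"
  proof (rule LIMSEQ_I)
    fix e :: real assume e: "0 < e"
    then have "0 < e / 2" by simp
    from maximal_separated[OF bU this] obtain P where P: "P \<subseteq> U" "finite P"
      "U \<subseteq> (\<Union>p\<in>P. cball p (e / 2))" by metis
    \<comment> \<open>A finite net of the increasing union already lies in one of its
      members.\<close>
    have "\<forall>p\<in>P. \<exists>n. p \<in> E n" using P(1) by (auto simp: U_def)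
    then obtain k where k: "\<forall>p\<in>P. p \<in> E (k p)" by metis
    obtain n0 where n0: "\<forall>p\<in>P. k p \<le> n0"
      using finite_nat_set_iff_bounded_le[of "k ` P"] P(2) by auto
    have "norm (hausdorff_dist (E n) K - 0) < e" if n: "n0 \<le> n" for n
    proof -
      have PE: "P \<subseteq> E n" using k n0 n E_mono by (meson le_trans subset_eq)
      have EK: "E n \<subseteq> K" unfolding K_def using closure_subset[of U] by (auto simp: U_def)
      have 1: "(SUP a\<in>E n. infdist a K) = 0"
      proof -
        have "infdist a K = 0" if "a \<in> E n" for a using EK that infdist_zero by blast
        then have "(SUP a\<in>E n. infdist a K) = (SUP a\<in>E n. 0)" by (intro SUP_cong) auto
        then show ?thesis using E_ne by simp
      qed
      have "closed (\<Union>p\<in>P. cball p (e / 2))" using P(2) by (intro closed_UN) auto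
      then have KP: "K \<subseteq> (\<Union>p\<in>P. cball p (e / 2))"
        unfolding K_def using P(3) by (intro closure_minimal)
      have 2: "(SUP b\<in>K. infdist b (E n)) \<le> e / 2"
      proof (rule cSUP_least[OF K_ne])
        fix b assume "b \<in> K"
        then obtain p where p: "p \<in> P" "dist p b \<le> e / 2" using KP by auto
        have "infdist b (E n) \<le> dist b p" using p PE by (intro infdist_le) auto
        then show "infdist b (E n) \<le> e / 2" using p by (simp add: dist_commute)
      qed
      show ?thesis unfolding hausdorff_dist_def 1 using 2 e by (simp add: max_def)
    qed
    then show "\<exists>n0. \<forall>n\<ge>n0. norm (hausdorff_dist (E n) K - 0) < e" by blast
  qed
  moreover have "F \<subseteq> X" using M N by (auto simp: X_def dest: bspec)
  ultimately have "weak_tangent F K"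
    unfolding weak_tangent_def
    using compact_F F_nonempty cK K_ne KX T E_ne
    by (intro conjI exI[of _ X] exI[of _ T]) (auto simp: E_def X_def)
  then show ?thesis using sub by blast
qed

end

section \<open>Overlapping directions\<close>

lemma affine_bound:
  fixes \<Phi> :: "'a::euclidean_space \<Rightarrow> 'a"
  assumes M: "linear M" "\<And>x y. \<Phi> x - \<Phi> y = M (x - y)"
    and s: "\<And>b. b \<in> insert 0 Basis \<Longrightarrow> norm (\<Phi> b) \<le> s"
  shows "norm (\<Phi> x) \<le> (1 + 2 * (\<Sum>b\<in>Basis. \<bar>x \<bullet> b\<bar>)) * s"
proof -
  have "norm (M x) = norm (\<Sum>b\<in>Basis. (x \<bullet> b) *\<^sub>R M b)"
    by (subst euclidean_representation[of x, symmetric])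
      (simp only: linear_sum[OF M(1)] linear_scale[OF M(1)])
  also have "\<dots> \<le> (\<Sum>b\<in>Basis. \<bar>x \<bullet> b\<bar> * (2 * s))"
  proof (rule sum_norm_le)
    fix b :: 'a assume b: "b \<in> Basis"
    have "norm (M b) \<le> norm (\<Phi> b) + norm (\<Phi> 0)"
      using M(2)[of b 0] norm_triangle_ineq4[of "\<Phi> b" "\<Phi> 0"] by simp
    also have "\<dots> \<le> 2 * s" using s[of b] s[of 0] b by simp
    finally show "norm ((x \<bullet> b) *\<^sub>R M b) \<le> \<bar>x \<bullet> b\<bar> * (2 * s)" by (simp add: mult_left_mono)
  qed
  also have "\<dots> = 2 * (\<Sum>b\<in>Basis. \<bar>x \<bullet> b\<bar>) * s" by (simp add: sum_distrib_left sum_distrib_right mult_ac)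
  finally have "norm (M x) \<le> 2 * (\<Sum>b\<in>Basis. \<bar>x \<bullet> b\<bar>) * s" .
  moreover have "norm (\<Phi> x) \<le> norm (\<Phi> 0) + norm (M x)"
  proof -
    have "\<Phi> x = \<Phi> 0 + M x" using M(2)[of x 0] by (simp add: algebra_simps)
    then show ?thesis by (metis norm_triangle_ineq)
  qed
  ultimately show ?thesis using s[of 0] by (simp add: distrib_right)
qed

lemma affine_frechet_derivative:
  fixes \<Phi> :: "'a::euclidean_space \<Rightarrow> 'a"
  assumes M: "linear M" "\<And>x y. \<Phi> x - \<Phi> y = M (x - y)"
  shows "frechet_derivative \<Phi> (at a) = M"
proof -
  have "\<Phi> x = M x + \<Phi> 0" for x using M(2)[of x 0] by (simp add: algebra_simps)
  then have e: "\<Phi> = (\<lambda>x. M x + \<Phi> 0)" by blast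
  have "((\<lambda>x. M x + \<Phi> 0) has_derivative (\<lambda>z. M z + 0)) (at a)"
    by (intro has_derivative_add has_derivative_const linear_imp_has_derivative M(1))
  then have "(\<Phi> has_derivative M) (at a)" unfolding e[symmetric] by simp
  then show ?thesis by (rule frechet_derivative_at[symmetric])
qed

lemma affine_continuous_on:
  fixes \<Phi> :: "'a::euclidean_space \<Rightarrow> 'a"
  assumes M: "linear M" "\<And>x y. \<Phi> x - \<Phi> y = M (x - y)"
  shows "continuous_on S \<Phi>"
proof -
  have "\<Phi> x = M x + \<Phi> 0" for x using M(2)[of x 0] by (simp add: algebra_simps)
  then have e: "\<Phi> = (\<lambda>x. M x + \<Phi> 0)" by blast
  have "continuous_on S (\<lambda>x. M x + \<Phi> 0)"
    using linear_continuous_on[of M S] M(1) by (intro continuous_intros) (simp add: linear_conv_bounded_linear)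
  then show ?thesis unfolding e[symmetric] .
qed

lemma insert_0_Basis_cube: "b \<in> insert 0 Basis \<Longrightarrow> b \<in> cbox (0::'a::euclidean_space) One"
  by (auto simp: mem_box inner_Basis)

lemma norm_le_cube_sup_norm:
  fixes \<Phi> :: "'a::euclidean_space \<Rightarrow> 'a"
  assumes "continuous_on UNIV \<Phi>" "x \<in> cbox 0 One"
  shows "norm (\<Phi> x) \<le> cube_sup_norm \<Phi>"
proof -
  have "compact ((\<lambda>x. norm (\<Phi> x)) ` cbox 0 One)"
    using assms(1) by (intro compact_continuous_image continuous_on_norm compact_cbox)
      (meson continuous_on_subset subset_UNIV)
  then have "bdd_above ((\<lambda>x. norm (\<Phi> x)) ` cbox 0 One)"
    by (rule bounded_imp_bdd_above[OF compact_imp_bounded])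
  then show ?thesis unfolding cube_sup_norm_def using assms(2) by (intro cSUP_upper) auto
qed

lemma cube_sup_norm_le:
  fixes \<Phi> :: "'a::euclidean_space \<Rightarrow> 'a"
  assumes "\<And>x. x \<in> cbox 0 One \<Longrightarrow> norm (\<Phi> x) \<le> s"
  shows "cube_sup_norm \<Phi> \<le> s"
  unfolding cube_sup_norm_def using insert_0_Basis_cube[of 0] assms by (intro cSUP_least) blast+

context loop_semigroup
begin

lemma return_map_affine:
  assumes "C \<in> L" "D \<in> L"
  obtains M where "linear M"
    "\<And>x y. (inv C (D x) - x) - (inv C (D y) - y) = M (x - y)"
proof -
  define h where "h = inv C \<circ> D"
  have h: "similarity_map h"
    unfolding h_def using assms by (intro similarity_map_comp similarity_map_inv sim)
  have "linear (\<lambda>z. sim_ratio h *\<^sub>R sim_lin h z - z)"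
    using linear_sim_lin[OF h] by (intro linear_compose_sub linear_compose_scale_right linear_id[unfolded id_def])
  moreover have "(inv C (D x) - x) - (inv C (D y) - y) = sim_ratio h *\<^sub>R sim_lin h (x - y) - (x - y)" for x y
    using sim_diff[OF h, of x y] by (simp add: h_def algebra_simps)
  ultimately show thesis using that by blast
qed

text \<open>The minimum over the ball is at most the value at its centre, so the defining condition
  bounds the norm of the derivative by \<open>norm (\<Phi> k a) / \<rho>\<close>. This is the
  relative Lipschitz condition with \<open>K = 1 / \<rho>\<close>.\<close>

lemma direction_imp_translation_space:
  assumes \<omega>: "norm \<omega> = 1"
    and CD: "\<And>k. C k \<in> L \<and> D k \<in> L \<and> \<Phi> k = (\<lambda>x. inv (C k) (D k x) - x)"
    and cube: "(\<lambda>k::nat. cube_sup_norm (\<Phi> k)) \<longlonglongrightarrow> 0"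
    and a: "a \<in> F" and \<rho>: "0 < \<rho>" and dir: "(\<lambda>k. \<Phi> k a /\<^sub>R norm (\<Phi> k a)) \<longlonglongrightarrow> \<omega>"
    and y: "\<And>k. is_arg_min (\<lambda>x. norm (\<Phi> k x)) (\<lambda>x. x \<in> cball a \<rho>) (y k)"
      "\<And>k. \<rho> * onorm (frechet_derivative (\<Phi> k) (at a)) \<le> norm (\<Phi> k (y k))"
  shows "\<omega> \<in> translation_space"
proof -
  have "overlap_at a (1 / \<rho>) \<omega>"
    unfolding overlap_at_def
  proof (intro allI impI)
    fix \<epsilon> :: real assume \<epsilon>: "0 < \<epsilon>"
    define B where "B = 1 + 2 * (\<Sum>b\<in>Basis. \<bar>a \<bullet> b\<bar>)"
    have B: "0 < B" unfolding B_def by (intro add_pos_nonneg mult_nonneg_nonneg sum_nonneg) auto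
    have "eventually (\<lambda>k. cube_sup_norm (\<Phi> k) < \<epsilon> / B) sequentially"
      using \<epsilon> B by (intro order_tendstoD(2)[OF cube]) simp
    \<comment> \<open>A distance below 1 excludes \<open>\<Phi> k a = 0\<close>: the normalised
      vector would then be 0, at distance 1 from the unit vector \<omega>.\<close>
    moreover have "eventually (\<lambda>k. dist (\<Phi> k a /\<^sub>R norm (\<Phi> k a)) \<omega> < min \<epsilon> 1) sequentially"
      using \<epsilon> by (intro tendstoD[OF dir]) simp
    ultimately have "eventually (\<lambda>k. cube_sup_norm (\<Phi> k) < \<epsilon> / B \<and>
        dist (\<Phi> k a /\<^sub>R norm (\<Phi> k a)) \<omega> < min \<epsilon> 1) sequentially" by (rule eventually_conj)
    then obtain k where k: "cube_sup_norm (\<Phi> k) < \<epsilon> / B" "dist (\<Phi> k a /\<^sub>R norm (\<Phi> k a)) \<omega> < min \<epsilon> 1"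
      using eventually_happens trivial_limit_sequentially by blast
    obtain M where M: "linear M" "\<And>x y. \<Phi> k x - \<Phi> k y = M (x - y)"
      using return_map_affine[of "C k" "D k"] CD[of k] by metis
    have small: "norm (\<Phi> k a) \<le> \<epsilon>"
    proof -
      have "norm (\<Phi> k a) \<le> B * cube_sup_norm (\<Phi> k)"
        unfolding B_def
        by (intro affine_bound[OF M] norm_le_cube_sup_norm affine_continuous_on[OF M] insert_0_Basis_cube)
      then show ?thesis using k(1) B by (simp add: less_divide_eq mult.commute)
    qed
    have pos: "0 < norm (\<Phi> k a)"
      using k(2) \<omega> by (cases "\<Phi> k a = 0") (auto simp: dist_norm)
    have "norm (\<Phi> k a - norm (\<Phi> k a) *\<^sub>R \<omega>) = norm (\<Phi> k a) * norm (\<Phi> k a /\<^sub>R norm (\<Phi> k a) - \<omega>)"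
    proof -
      have "\<Phi> k a - norm (\<Phi> k a) *\<^sub>R \<omega> = norm (\<Phi> k a) *\<^sub>R (\<Phi> k a /\<^sub>R norm (\<Phi> k a) - \<omega>)"
        using pos by (simp add: scaleR_diff_right)
      then show ?thesis by (metis norm_scaleR abs_norm_cancel)
    qed
    also have "\<dots> \<le> norm (\<Phi> k a) * \<epsilon>" using k(2) by (intro mult_left_mono) (auto simp: dist_norm)
    finally have dirk: "norm (\<Phi> k a - norm (\<Phi> k a) *\<^sub>R \<omega>) \<le> \<epsilon> * norm (\<Phi> k a)" by (simp add: mult.commute)
    have lip: "norm (\<Phi> k x - \<Phi> k a) \<le> 1 / \<rho> * norm (\<Phi> k a) * norm (x - a)" for x
    proof -
      have "norm (\<Phi> k (y k)) \<le> norm (\<Phi> k a)"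
        using y(1)[of k] \<rho> by (force simp: is_arg_min_def not_less)
      then have "onorm M \<le> norm (\<Phi> k a) / \<rho>"
        using y(2)[of k] \<rho> unfolding affine_frechet_derivative[OF M] by (simp add: le_divide_eq mult.commute)
      then have "onorm M * norm (x - a) \<le> norm (\<Phi> k a) / \<rho> * norm (x - a)" by (intro mult_right_mono) auto
      moreover have "norm (M (x - a)) \<le> onorm M * norm (x - a)"
        using onorm[of M] M(1) by (simp add: linear_conv_bounded_linear)
      ultimately show ?thesis by (simp add: M(2))
    qed
    show "\<exists>C\<in>L. \<exists>D\<in>L. let \<Phi> = (\<lambda>x. inv C (D x) - x) in
     0 < norm (\<Phi> a) \<and> norm (\<Phi> a) \<le> \<epsilon> \<and> norm (\<Phi> a - norm (\<Phi> a) *\<^sub>R \<omega>) \<le> \<epsilon> * norm (\<Phi> a) \<and>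
     (\<forall>x. norm (\<Phi> x - \<Phi> a) \<le> 1 / \<rho> * norm (\<Phi> a) * norm (x - a))"
      using CD[of k] small pos dirk lip by (intro bexI[of _ "C k"] bexI[of _ "D k"]) (auto simp: Let_def)
  qed
  moreover have "0 \<le> 1 / \<rho>" using \<rho> by simp
  ultimately show ?thesis using overlap_at_translation_space[OF a _ \<omega>] by blast
qed

text \<open>Return maps approximate the translations by \<open>t k *\<^sub>R \<omega>\<close> with
  an error small compared to \<open>t k\<close>. Then the direction converges at every point, and
  the linear part is dominated by the displacement on the whole unit ball about
  \<open>a\<close>.\<close>

lemma translation_space_imp_direction:
  assumes \<omega>: "norm \<omega> = 1" "\<omega> \<in> translation_space" and a: "a \<in> F"
  shows "\<exists>C D \<Phi>. (\<forall>k::nat. C k \<in> L \<and> D k \<in> L \<and> \<Phi> k = (\<lambda>x. inv (C k) (D k x) - x)) \<and>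
    (\<forall>k. 0 < cube_sup_norm (\<Phi> k)) \<and> (\<lambda>k. cube_sup_norm (\<Phi> k)) \<longlonglongrightarrow> 0 \<and>
    (\<lambda>k. \<Phi> k a /\<^sub>R norm (\<Phi> k a)) \<longlonglongrightarrow> \<omega> \<and>
    (\<exists>y. \<forall>k. is_arg_min (\<lambda>x. norm (\<Phi> k x)) (\<lambda>x. x \<in> cball a 1) (y k) \<and>
       1 * onorm (frechet_derivative (\<Phi> k) (at a)) \<le> norm (\<Phi> k (y k)))"
proof -
  define t where "t k = 1 / (real k + 1)" for k
  \<comment> \<open>Quadratic in \<open>t k\<close>, so that the error of the direction, relative to
    a displacement of size about \<open>t k\<close>, still tends to 0.\<close>
  define \<eta> where "\<eta> k = t k * t k / 8" for k
  have t: "0 < t k" "t k \<le> 1" for k by (auto simp: t_def)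
  have \<eta>: "0 < \<eta> k" "\<eta> k \<le> t k / 8" for k
    using t[of k] by (auto simp: \<eta>_def mult_left_le)
  have t0: "t \<longlonglongrightarrow> 0" unfolding t_def using lim_inverse_n' LIMSEQ_Suc[OF lim_1_over_n] by (simp add: add.commute)
  \<comment> \<open>The ball of this radius contains both the unit cube and the unit ball about
    \<open>a\<close>.\<close>
  define R where "R = norm a + 1 + real DIM('a)"
  have "\<exists>C\<in>L. \<exists>D\<in>L. \<forall>x. norm x \<le> R \<longrightarrow> norm (inv C (D x) - x - t k *\<^sub>R \<omega>) \<le> \<eta> k" for k
    using \<omega>(2) \<eta>(1) by (intro limit_translations_return) (auto simp: translation_space_def)
  then obtain C D where CD: "\<And>k. C k \<in> L" "\<And>k. D k \<in> L"
    "\<And>k x. norm x \<le> R \<Longrightarrow> norm (inv (C k) (D k x) - x - t k *\<^sub>R \<omega>) \<le> \<eta> k" by metis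
  define \<Phi> where "\<Phi> k = (\<lambda>x. inv (C k) (D k x) - x)" for k
  have near: "norm (\<Phi> k x - t k *\<^sub>R \<omega>) \<le> \<eta> k" if "norm x \<le> R" for k x
    using CD(3)[OF that] by (simp add: \<Phi>_def)
  have lower: "7 / 8 * t k \<le> norm (\<Phi> k x)" and upper: "norm (\<Phi> k x) \<le> 2 * t k" if "norm x \<le> R" for k x
    using near[OF that, of k] \<eta>[of k] t[of k] \<omega>(1) norm_triangle_ineq3[of "\<Phi> k x" "t k *\<^sub>R \<omega>"]
    by (simp_all add: abs_le_iff)
  have cubeR: "norm x \<le> R" if "x \<in> cbox 0 One" for x :: 'a
  proof -
    have "norm x \<le> (\<Sum>b\<in>Basis. \<bar>x \<bullet> b\<bar>)" by (rule norm_le_l1)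
    also have "\<dots> \<le> (\<Sum>b\<in>(Basis::'a set). 1)"
      using that by (intro sum_mono) (auto simp: mem_box)
    finally have "norm x \<le> real DIM('a)" by simp
    then show ?thesis using norm_ge_zero[of a] unfolding R_def by linarith
  qed
  have ballR: "norm x \<le> R" if "x \<in> cball a 1" for x
    using that norm_triangle_sub[of x a] by (simp add: R_def dist_norm norm_minus_commute)
  have "\<exists>M. linear M \<and> (\<forall>x y. \<Phi> k x - \<Phi> k y = M (x - y))" for k
    using return_map_affine[OF CD(1,2)] unfolding \<Phi>_def by metis
  then obtain M where M: "\<And>k. linear (M k)" "\<And>k x y. \<Phi> k x - \<Phi> k y = M k (x - y)" by metis
  have cont: "continuous_on S (\<Phi> k)" for S k using affine_continuous_on[OF M] .
  have cube_pos: "0 < cube_sup_norm (\<Phi> k)" for k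
    using norm_le_cube_sup_norm[OF cont insert_0_Basis_cube, of 0 k] lower[of 0 k] t[of k]
    by (simp add: R_def)
  have cube_lim: "(\<lambda>k. cube_sup_norm (\<Phi> k)) \<longlonglongrightarrow> 0"
  proof (rule tendsto_sandwich)
    show "\<forall>\<^sub>F k in sequentially. 0 \<le> cube_sup_norm (\<Phi> k)" using cube_pos by (simp add: less_imp_le)
    show "\<forall>\<^sub>F k in sequentially. cube_sup_norm (\<Phi> k) \<le> 2 * t k"
      by (intro always_eventually allI cube_sup_norm_le upper cubeR)
    show "(\<lambda>k. 2 * t k) \<longlonglongrightarrow> 0" using tendsto_mult_left[OF t0, of 2] by simp
  qed simp
  have dir: "(\<lambda>k. \<Phi> k a /\<^sub>R norm (\<Phi> k a)) \<longlonglongrightarrow> \<omega>"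
  proof (rule metric_tendsto_imp_tendsto[OF t0])
    have "dist (\<Phi> k a /\<^sub>R norm (\<Phi> k a)) \<omega> \<le> dist (t k) 0" for k
    proof -
      define n where "n = norm (\<Phi> k a)"
      have aR: "norm a \<le> R" by (simp add: R_def)
      have n: "7 / 8 * t k \<le> n" "0 < n" using lower[OF aR, of k] t[of k] by (auto simp: n_def)
      have "\<bar>n - t k\<bar> \<le> \<eta> k"
        using near[OF aR, of k] norm_triangle_ineq3[of "\<Phi> k a" "t k *\<^sub>R \<omega>"] \<omega>(1) t[of k] by (simp add: n_def)
      then have "norm ((t k - n) *\<^sub>R \<omega>) \<le> \<eta> k" using \<omega>(1) by (simp add: abs_minus_commute)
      then have "norm (\<Phi> k a - n *\<^sub>R \<omega>) \<le> 2 * \<eta> k"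
        using near[OF aR, of k] norm_triangle_ineq[of "\<Phi> k a - t k *\<^sub>R \<omega>" "(t k - n) *\<^sub>R \<omega>"]
        by (simp add: algebra_simps)
      also have "\<dots> = t k * t k / 4" by (simp add: \<eta>_def)
      also have "\<dots> \<le> t k * (7 / 8 * t k)" using t[of k] by simp
      also have "\<dots> \<le> t k * n" using n t[of k] by (intro mult_left_mono) auto
      finally have "norm (\<Phi> k a - n *\<^sub>R \<omega>) \<le> t k * n" .
      moreover have "\<Phi> k a /\<^sub>R n - \<omega> = (\<Phi> k a - n *\<^sub>R \<omega>) /\<^sub>R n" using n by (simp add: scaleR_diff_right)
      ultimately have "norm (\<Phi> k a /\<^sub>R n - \<omega>) \<le> t k"
        using n by (simp add: divide_le_eq flip: divide_inverse_commute)
      then show ?thesis using t[of k] by (simp add: n_def dist_norm)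
    qed
    then show "\<forall>\<^sub>F k in sequentially. dist (\<Phi> k a /\<^sub>R norm (\<Phi> k a)) \<omega> \<le> dist (t k) 0" by simp
  qed
  have "\<exists>y. is_arg_min (\<lambda>x. norm (\<Phi> k x)) (\<lambda>x. x \<in> cball a 1) y \<and>
       1 * onorm (frechet_derivative (\<Phi> k) (at a)) \<le> norm (\<Phi> k y)" for k
  proof -
    obtain y where y: "y \<in> cball a 1" "\<forall>x\<in>cball a 1. norm (\<Phi> k y) \<le> norm (\<Phi> k x)"
      using continuous_attains_inf[of "cball a 1" "\<lambda>x. norm (\<Phi> k x)"] continuous_on_norm[OF cont] by auto
    have "onorm (M k) \<le> 2 * \<eta> k"
    proof (rule onorm_le)
      fix z
      show "norm (M k z) \<le> 2 * \<eta> k * norm z"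
      proof (cases "z = 0")
        case True then show ?thesis using linear_0[OF M(1)] by simp
      next
        case False
        define u where "u = z /\<^sub>R norm z"
        have u: "z = norm z *\<^sub>R u" "norm u = 1" using False by (auto simp: u_def)
        have "M k u = (\<Phi> k (a + u) - t k *\<^sub>R \<omega>) - (\<Phi> k a - t k *\<^sub>R \<omega>)"
          using M(2)[of k "a + u" a] by simp
        then have "norm (M k u) \<le> norm (\<Phi> k (a + u) - t k *\<^sub>R \<omega>) + norm (\<Phi> k a - t k *\<^sub>R \<omega>)"
          by (simp only: norm_triangle_ineq4)
        also have "\<dots> \<le> \<eta> k + \<eta> k"
          using u by (intro add_mono near ballR) (auto simp: dist_norm)
        finally have "norm z * norm (M k u) \<le> norm z * (2 * \<eta> k)" by (intro mult_left_mono) auto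
        then show ?thesis by (subst u(1)) (simp add: linear_scale[OF M(1)] mult_ac)
      qed
    qed
    also have "\<dots> \<le> 7 / 8 * t k" using \<eta>[of k] t[of k] by linarith
    also have "\<dots> \<le> norm (\<Phi> k y)" using lower[OF ballR[OF y(1)]] .
    finally have "1 * onorm (frechet_derivative (\<Phi> k) (at a)) \<le> norm (\<Phi> k y)"
      unfolding affine_frechet_derivative[OF M] by simp
    moreover have "is_arg_min (\<lambda>x. norm (\<Phi> k x)) (\<lambda>x. x \<in> cball a 1) y"
      using y unfolding is_arg_min_def by (metis not_less)
    ultimately show ?thesis by blast
  qed
  then have "\<exists>y. \<forall>k. is_arg_min (\<lambda>x. norm (\<Phi> k x)) (\<lambda>x. x \<in> cball a 1) (y k) \<and>
       1 * onorm (frechet_derivative (\<Phi> k) (at a)) \<le> norm (\<Phi> k (y k))" by metis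
  then show ?thesis
    using CD(1,2) cube_pos cube_lim dir
    by (intro exI[of _ C] exI[of _ D] exI[of _ \<Phi>] conjI allI) (auto simp: \<Phi>_def)
qed

text \<open>As \<^term>\<open>F\<close> spans, an affine map is controlled by its values at finitely many points of \<^term>\<open>F\<close>;
  one of these dominates for infinitely many terms of a sequence of return maps converging to the identity.\<close>

lemma exists_translation:
  assumes span: "\<And>a b. a \<noteq> 0 \<Longrightarrow> \<not> F \<subseteq> {x. a \<bullet> x = b}"
    and small: "\<And>\<epsilon>. 0 < \<epsilon> \<Longrightarrow> \<exists>C\<in>L. \<exists>D\<in>L. inv C \<circ> D \<noteq> id \<and>
      (\<forall>b\<in>insert 0 Basis. norm (inv C (D b) - b) \<le> \<epsilon>)"
  shows "\<exists>\<omega>\<in>translation_space. norm \<omega> = 1"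
proof -
  obtain x0 where x0: "x0 \<in> F" using F_nonempty by blast
  define S where "S = (\<lambda>x. x - x0) ` F"
  have "span S = UNIV"
  proof (rule ccontr)
    assume "span S \<noteq> UNIV"
    then obtain a where a: "a \<noteq> 0" "\<forall>x\<in>span S. a \<bullet> x = 0"
      using span_not_univ_subset_hyperplane by blast
    have "a \<bullet> x = a \<bullet> x0" if "x \<in> F" for x
    proof -
      have "x - x0 \<in> span S" using that by (simp add: S_def span_base)
      then have "a \<bullet> (x - x0) = 0" using a(2) by blast
      then show ?thesis by (simp add: inner_diff_right)
    qed
    then show False using span[OF a(1)] by blast
  qed
  then obtain B where B: "B \<subseteq> S" "independent B" "span B = UNIV"
    using maximal_independent_subset[of S] by (metis span_mono span_span top.extremum_unique span_eq)
  have finB: "finite B" using B(2) independent_imp_finite by blast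
  have "\<exists>u. (\<Sum>v\<in>B. u v *\<^sub>R v) = b" for b using B(3) span_finite[OF finB] by (metis (mono_tags, lifting) UNIV_I imageE)
  then obtain u where u: "\<And>b. (\<Sum>v\<in>B. u b v *\<^sub>R v) = b" by metis
  define P where "P = insert x0 ((\<lambda>v. x0 + v) ` B)"
  have P: "finite P" "P \<subseteq> F" using finB B(1) x0 by (auto simp: P_def S_def)
  define K where "K = 2 * (\<Sum>b\<in>(Basis::'a set). \<Sum>v\<in>B. \<bar>u b v\<bar>)"
  have K: "0 \<le> K" by (simp add: K_def sum_nonneg)
  have dom: "\<exists>p\<in>P. \<forall>z. norm (M z) \<le> K * norm (\<Phi> p) * norm z"
    if M: "linear M" "\<And>x y. \<Phi> x - \<Phi> y = M (x - y)" for M and \<Phi> :: "'a \<Rightarrow> 'a"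
  proof -
    define m where "m = Max ((\<lambda>p. norm (\<Phi> p)) ` P)"
    have mP: "norm (\<Phi> p) \<le> m" if "p \<in> P" for p using P(1) that by (simp add: m_def)
    have "P \<noteq> {}" by (simp add: P_def)
    then have "m \<in> (\<lambda>p. norm (\<Phi> p)) ` P" unfolding m_def using P(1) by (intro Max_in) auto
    then obtain p where p: "p \<in> P" "m = norm (\<Phi> p)" by blast
    have Mv: "norm (M v) \<le> 2 * m" if v: "v \<in> B" for v
    proof -
      have "M v = \<Phi> (x0 + v) - \<Phi> x0" using M(2)[of "x0 + v" x0] by simp
      then have "norm (M v) \<le> norm (\<Phi> (x0 + v)) + norm (\<Phi> x0)" by (simp only: norm_triangle_ineq4)
      then show ?thesis using mP[of "x0 + v"] mP[of x0] v by (simp add: P_def)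
    qed
    have "norm (M z) \<le> K * m * norm z" for z
    proof -
      have "norm (M z) = norm (\<Sum>b\<in>Basis. (z \<bullet> b) *\<^sub>R (\<Sum>v\<in>B. u b v *\<^sub>R M v))"
        by (subst euclidean_representation[of z, symmetric], subst (2) u[symmetric])
          (simp only: linear_sum[OF M(1)] linear_scale[OF M(1)])
      also have "\<dots> \<le> (\<Sum>b\<in>(Basis::'a set). norm z * (\<Sum>v\<in>B. \<bar>u b v\<bar> * (2 * m)))"
      proof (rule sum_norm_le)
        fix b :: 'a assume b: "b \<in> Basis"
        have "norm (\<Sum>v\<in>B. u b v *\<^sub>R M v) \<le> (\<Sum>v\<in>B. \<bar>u b v\<bar> * (2 * m))"
          using Mv by (intro sum_norm_le) (simp add: mult_left_mono)
        then show "norm ((z \<bullet> b) *\<^sub>R (\<Sum>v\<in>B. u b v *\<^sub>R M v)) \<le> norm z * (\<Sum>v\<in>B. \<bar>u b v\<bar> * (2 * m))"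
          using Basis_le_norm[OF b, of z] by (simp add: mult_mono)
      qed
      also have "\<dots> = K * m * norm z"
        by (simp add: K_def sum_distrib_left sum_distrib_right mult_ac)
      finally show ?thesis .
    qed
    then show ?thesis using p by auto
  qed
  have "\<exists>C\<in>L. \<exists>D\<in>L. inv C \<circ> D \<noteq> id \<and> (\<forall>b\<in>insert 0 Basis. norm (inv C (D b) - b) \<le> 1 / (real k + 1))" for k
    by (rule small) simp
  then obtain C D where CD: "\<And>k. C k \<in> L" "\<And>k. D k \<in> L" "\<And>k. inv (C k) \<circ> D k \<noteq> id"
    "\<And>k b. b \<in> insert 0 Basis \<Longrightarrow> norm (inv (C k) (D k b) - b) \<le> 1 / (real k + 1)" by metis
  define \<Phi> where "\<Phi> k x = inv (C k) (D k x) - x" for k x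
  have "\<exists>M. linear M \<and> (\<forall>x y. \<Phi> k x - \<Phi> k y = M (x - y))" for k
    using return_map_affine[OF CD(1,2)] unfolding \<Phi>_def by metis
  then obtain M where M: "\<And>k. linear (M k)" "\<And>k x y. \<Phi> k x - \<Phi> k y = M k (x - y)" by metis
  have "\<exists>p\<in>P. \<forall>z. norm (M k z) \<le> K * norm (\<Phi> k p) * norm z" for k using dom[OF M] .
  then obtain p where p: "\<And>k. p k \<in> P" "\<And>k z. norm (M k z) \<le> K * norm (\<Phi> k (p k)) * norm z" by metis
  \<comment> \<open>If the displacement vanished at the dominating point, the linear part would
    vanish too and the return map would be the identity.\<close>
  have nz: "\<Phi> k (p k) \<noteq> 0" for k
  proof
    assume z: "\<Phi> k (p k) = 0"
    have "\<Phi> k x = 0" for x using p(2)[of k "x - p k"] M(2)[of k x "p k"] z by simp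
    then have "inv (C k) \<circ> D k = id" by (auto simp: \<Phi>_def fun_eq_iff)
    then show False using CD(3) by blast
  qed
  have "finite (range p)" using p(1) P(1) by (meson finite_subset image_subsetI)
  then obtain k0 where "infinite {k. p k = p k0}"
    using pigeonhole_infinite[of UNIV p] by auto
  then obtain r :: "nat \<Rightarrow> nat" where r': "strict_mono r" "\<forall>k. r k \<in> {k. p k = p k0}"
    using infinite_enumerate by blast
  then have r: "strict_mono r" "\<And>k. p (r k) = p k0" by auto
  define a where "a = p k0"
  have aF: "a \<in> F" using p(1) P(2) by (auto simp: a_def)
  define v where "v k = \<Phi> (r k) a /\<^sub>R norm (\<Phi> (r k) a)" for k
  have nza: "\<Phi> (r k) a \<noteq> 0" for k using nz[of "r k"] r(2) by (simp add: a_def)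
  have "v k \<in> sphere 0 1" for k using nza by (simp add: v_def)
  then obtain \<omega> s where \<omega>: "\<omega> \<in> sphere 0 1" "strict_mono s" "(v \<circ> s) \<longlonglongrightarrow> \<omega>"
    using compact_sphere[of "0::'a" 1] unfolding compact_def by metis
  have "overlap_at a K \<omega>"
    unfolding overlap_at_def
  proof (intro allI impI)
    fix \<epsilon> :: real assume \<epsilon>: "0 < \<epsilon>"
    define Q where "Q = 1 + 2 * (\<Sum>b\<in>Basis. \<bar>a \<bullet> b\<bar>)"
    have Q: "0 < Q" unfolding Q_def by (intro add_pos_nonneg mult_nonneg_nonneg sum_nonneg) auto
    obtain N where N: "Q / \<epsilon> < real N" using reals_Archimedean2 by blast
    have "eventually (\<lambda>k. dist ((v \<circ> s) k) \<omega> < \<epsilon>) sequentially" using tendstoD[OF \<omega>(3) \<epsilon>] .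
    moreover have "eventually (\<lambda>k. N \<le> k) sequentially" by (rule eventually_ge_at_top)
    ultimately have "eventually (\<lambda>k. dist ((v \<circ> s) k) \<omega> < \<epsilon> \<and> N \<le> k) sequentially" by (rule eventually_conj)
    then obtain k where k: "dist (v (s k)) \<omega> < \<epsilon>" "N \<le> k"
      using eventually_happens trivial_limit_sequentially by fastforce
    define j where "j = r (s k)"
    have "k \<le> j" unfolding j_def using seq_suble[OF \<omega>(2), of k] seq_suble[OF r(1), of "s k"] by linarith
    then have "Q / \<epsilon> \<le> real j + 1" using N k(2) by linarith
    then have Qj: "Q * (1 / (real j + 1)) \<le> \<epsilon>" using \<epsilon> by (simp add: divide_le_eq mult.commute)
    have "norm (\<Phi> j a) \<le> Q * (1 / (real j + 1))"
      unfolding Q_def using CD(4) by (intro affine_bound[OF M]) (simp add: \<Phi>_def)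
    then have small_a: "norm (\<Phi> j a) \<le> \<epsilon>" using Qj by linarith
    have pos: "0 < norm (\<Phi> j a)" using nza[of "s k"] by (simp add: j_def)
    have vj: "v (s k) = \<Phi> j a /\<^sub>R norm (\<Phi> j a)" by (simp add: v_def j_def)
    have "\<Phi> j a - norm (\<Phi> j a) *\<^sub>R \<omega> = norm (\<Phi> j a) *\<^sub>R (v (s k) - \<omega>)"
      unfolding vj using pos by (simp add: scaleR_diff_right)
    then have "norm (\<Phi> j a - norm (\<Phi> j a) *\<^sub>R \<omega>) = norm (\<Phi> j a) * dist (v (s k)) \<omega>"
      by (simp add: dist_norm)
    also have "\<dots> \<le> norm (\<Phi> j a) * \<epsilon>" using k(1) by (intro mult_left_mono) auto
    finally have dirj: "norm (\<Phi> j a - norm (\<Phi> j a) *\<^sub>R \<omega>) \<le> \<epsilon> * norm (\<Phi> j a)" by (simp add: mult.commute)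
    have lip: "norm (\<Phi> j x - \<Phi> j a) \<le> K * norm (\<Phi> j a) * norm (x - a)" for x
      using p(2)[of j "x - a"] r(2)[of "s k"] by (simp add: M(2) j_def a_def)
    show "\<exists>C\<in>L. \<exists>D\<in>L. let \<Phi> = (\<lambda>x. inv C (D x) - x) in
     0 < norm (\<Phi> a) \<and> norm (\<Phi> a) \<le> \<epsilon> \<and> norm (\<Phi> a - norm (\<Phi> a) *\<^sub>R \<omega>) \<le> \<epsilon> * norm (\<Phi> a) \<and>
     (\<forall>x. norm (\<Phi> x - \<Phi> a) \<le> K * norm (\<Phi> a) * norm (x - a))"
      using CD(1,2)[of j] small_a pos dirj lip
      by (intro bexI[of _ "C j"] bexI[of _ "D j"]) (auto simp: Let_def \<Phi>_def)
  qed
  moreover have "norm \<omega> = 1" using \<omega>(1) by simp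
  ultimately show ?thesis using overlap_at_translation_space[OF aF K] by blast
qed

end

section \<open>Regularity under the weak separation property\<close>

text \<open>Fekete's argument with constants: \<open>\<kappa> * a n\<close> is supermultiplicative
  and \<open>K * a n\<close> submultiplicative in n. Comparing both at \<open>n * m\<close> puts
  every \<open>ln (\<kappa> * a n) / n\<close> below every \<open>ln (K * a m) / m\<close>, and the
  supremum of the former separates the two families.\<close>

lemma almost_multiplicative_growth:
  fixes a :: "nat \<Rightarrow> real"
  assumes a: "\<And>n. 1 \<le> a n" and \<kappa>: "0 < \<kappa>" and K: "0 < K"
    and lower: "\<And>m n. \<kappa> * (a m * a n) \<le> a (m + n)" and upper: "\<And>m n. a (m + n) \<le> K * (a m * a n)"
  shows "\<exists>s\<ge>0. \<forall>n. exp (s * real n) / K \<le> a n \<and> a n \<le> exp (s * real n) / \<kappa>"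
proof -
  have a0: "0 < a n" for n using a[of n] by linarith
  have pow_lower: "(\<kappa> * a n) ^ m \<le> \<kappa> * a (n * m)" if "0 < m" for m n
    using that
  proof (induction m)
    case (Suc m)
    show ?case
    proof (cases "m = 0")
      case False
      have "(\<kappa> * a n) ^ Suc m \<le> (\<kappa> * a n) * (\<kappa> * a (n * m))"
        using Suc.IH False \<kappa> a0[of n] by simp
      also have "\<dots> = \<kappa> * (\<kappa> * (a n * a (n * m)))" by simp
      also have "\<dots> \<le> \<kappa> * a (n + n * m)" using lower \<kappa> by (intro mult_left_mono) auto
      finally show ?thesis by simp
    qed simp
  qed simp
  have pow_upper: "K * a (n * m) \<le> (K * a n) ^ m" if "0 < m" for m n
    using that
  proof (induction m)
    case (Suc m)
    show ?case
    proof (cases "m = 0")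
      case False
      have "K * a (n * Suc m) \<le> K * (K * (a n * a (n * m)))" using upper[of n "n * m"] K by (simp add: mult_left_mono)
      also have "\<dots> = (K * a n) * (K * a (n * m))" by simp
      also have "\<dots> \<le> (K * a n) * (K * a n) ^ m" using Suc.IH False K a0[of n] by simp
      finally show ?thesis by simp
    qed simp
  qed simp
  have \<kappa>K: "\<kappa> \<le> K"
  proof -
    have "\<kappa> * (a 0 * a 0) \<le> K * (a 0 * a 0)" using lower[of 0 0] upper[of 0 0] by simp
    then show ?thesis using a0[of 0] by simp
  qed
  have cross: "ln (\<kappa> * a n) / real n \<le> ln (K * a m) / real m" if mn: "0 < m" "0 < n" for m n
  proof -
    have "(\<kappa> * a n) ^ m \<le> \<kappa> * a (n * m)" using pow_lower mn by blast
    also have "\<dots> \<le> K * a (m * n)" using \<kappa>K a0[of "n * m"] by (simp add: mult.commute mult_left_mono)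
    also have "\<dots> \<le> (K * a m) ^ n" using pow_upper mn by blast
    finally have "ln ((\<kappa> * a n) ^ m) \<le> ln ((K * a m) ^ n)" using \<kappa> K a0 by simp
    then have "real m * ln (\<kappa> * a n) \<le> real n * ln (K * a m)"
      using \<kappa> K a0 by (simp add: ln_realpow)
    then show ?thesis using mn by (simp add: field_simps)
  qed
  define s where "s = (SUP n\<in>{0<..}. ln (\<kappa> * a n) / real n)"
  have bdd: "bdd_above ((\<lambda>n. ln (\<kappa> * a n) / real n) ` {0<..})"
    using cross[of 1] by (intro bdd_aboveI[of _ "ln (K * a 1) / real 1"]) auto
  have sl: "ln (\<kappa> * a n) \<le> s * real n" if "0 < n" for n
  proof -
    have "ln (\<kappa> * a n) / real n \<le> s" unfolding s_def using that bdd by (intro cSUP_upper) auto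
    then show ?thesis using that by (simp add: divide_le_eq)
  qed
  have su: "s * real m \<le> ln (K * a m)" if "0 < m" for m
  proof -
    have "s \<le> ln (K * a m) / real m" unfolding s_def using that cross by (intro cSUP_least) auto
    then show ?thesis using that by (simp add: le_divide_eq)
  qed
  have up: "a n \<le> exp (s * real n) / \<kappa>" for n
  proof (cases "n = 0")
    case True
    then show ?thesis using lower[of 0 0] a0[of 0] \<kappa> by (simp add: le_divide_eq mult.commute)
  next
    case False
    then have "exp (ln (\<kappa> * a n)) \<le> exp (s * real n)" using sl by simp
    then show ?thesis using \<kappa> a0[of n] by (simp add: le_divide_eq mult.commute)
  qed
  have low: "exp (s * real n) / K \<le> a n" for n
  proof (cases "n = 0")
    case True
    then show ?thesis using upper[of 0 0] a0[of 0] K by (simp add: divide_le_eq mult.commute)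
  next
    case False
    then have "exp (s * real n) \<le> exp (ln (K * a n))" using su by simp
    then show ?thesis using K a0[of n] by (simp add: divide_le_eq mult.commute)
  qed
  \<comment> \<open>A negative s would push the upper bound below 1, contrary to
    \<open>1 \<le> a n\<close>.\<close>
  have "0 \<le> s"
  proof (rule ccontr)
    assume "\<not> 0 \<le> s"
    then have "exp s < 1" by simp
    then obtain n where n: "exp s ^ n < \<kappa>" using real_arch_pow_inv[OF \<kappa>] by blast
    have "1 \<le> exp (s * real n) / \<kappa>" using up[of n] a[of n] by linarith
    then show False using n \<kappa> by (simp add: exp_of_nat2_mult le_divide_eq)
  qed
  then show ?thesis using up low by blast
qed

section \<open>Hausdorff measure from covering numbers\<close>

lemma hausdorff_measure_eq_0:
  fixes F :: "'a::euclidean_space set"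
  assumes F: "bounded F" and s: "0 \<le> s" "s < s'" and c0: "0 < c"
    and c: "\<And>t. \<lbrakk>0 < t; t \<le> 1\<rbrakk> \<Longrightarrow> real (covering_number t F) \<le> c * (1 / t) powr s"
  shows "hausdorff_measure s' F = 0"
proof -
  have "hausdorff_premeasure \<delta> s' F \<le> 0" if \<delta>: "0 < \<delta>" for \<delta>
  proof (rule ennreal_le_epsilon)
    fix e :: real assume e: "0 < e"
    define c' where "c' = c * 2 powr s'"
    have c': "0 < c'" using c0 by (simp add: c'_def)
    \<comment> \<open>Balls of radius t have diameter at most \<delta>, and the last bound makes the
      total \<open>c' * t powr (s' - s)\<close> at most e.\<close>
    define t where "t = min (min 1 (\<delta> / 2)) ((e / c') powr (1 / (s' - s)))"
    have t: "0 < t" "t \<le> 1" "2 * t \<le> \<delta>" "t \<le> (e / c') powr (1 / (s' - s))"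
      using \<delta> e c' by (auto simp: t_def)
    have "t powr (s' - s) \<le> ((e / c') powr (1 / (s' - s))) powr (s' - s)"
      using t s by (intro powr_mono2) auto
    also have "\<dots> = e / c'" using s e c' by (simp add: powr_powr)
    finally have te: "c' * t powr (s' - s) \<le> e" using c' by (simp add: le_divide_eq mult.commute)
    obtain C where C: "finite C" "card C = covering_number t F" "F \<subseteq> (\<Union>c\<in>C. cball c t)"
      using covering_number_attained[OF F t(1)] by metis
    obtain h where h: "bij_betw h {0..<card C} C" using ex_bij_betw_nat_finite[OF C(1)] by blast
    define U where "U n = (if n < card C then cball (h n) t else {})" for n
    have "F \<subseteq> (\<Union>n. U n)"
    proof
      fix x assume "x \<in> F"
      then obtain b where b: "b \<in> C" "x \<in> cball b t" using C(3) by blast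
      then have "b \<in> h ` {0..<card C}" using h by (simp add: bij_betw_def)
      then obtain n where "n < card C" "b = h n" by auto
      then show "x \<in> (\<Union>n. U n)" using b by (auto simp: U_def intro!: exI[of _ n])
    qed
    moreover have "\<forall>n. bounded (U n) \<and> diameter (U n) \<le> \<delta>" using t by (auto simp: U_def)
    ultimately have "hausdorff_premeasure \<delta> s' F \<le> (\<Sum>n. diam_pow s' (U n))"
      unfolding hausdorff_premeasure_def by (intro INF_lower) auto
    also have "\<dots> = (\<Sum>n<card C. diam_pow s' (U n))"
      by (rule suminf_finite) (auto simp: U_def diam_pow_def)
    also have "\<dots> = (\<Sum>n<card C. ennreal ((2 * t) powr s'))"
      using t s by (intro sum.cong) (auto simp: U_def diam_pow_def)
    also have "\<dots> = ennreal (real (card C) * (2 * t) powr s')" by (simp add: ennreal_mult ennreal_of_nat_eq_real_of_nat)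
    also have "\<dots> \<le> ennreal e"
    proof (rule ennreal_leI)
      have "real (card C) * (2 * t) powr s' \<le> (c * (1 / t) powr s) * (2 * t) powr s'"
        unfolding C(2) using c[OF t(1,2)] by (intro mult_right_mono) auto
      also have "\<dots> = c' * t powr (s' - s)"
        using t by (simp add: c'_def powr_mult powr_divide powr_diff)
      finally show "real (card C) * (2 * t) powr s' \<le> e" using te by linarith
    qed
    finally show "hausdorff_premeasure \<delta> s' F \<le> 0 + ennreal e" by simp
  qed
  then show ?thesis unfolding hausdorff_measure_def by (simp add: SUP_eq_iff)
qed

text \<open>Counting against a finite subcover at a scale far below its diameters.\<close>

lemma hausdorff_sum_lower_bound:
  fixes F :: "'a::euclidean_space set"
  assumes F: "compact F" "F \<noteq> {}" and s: "0 < s" and cK: "0 < c" "0 < K"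
    and lower: "\<And>t. \<lbrakk>0 < t; t \<le> 1\<rbrakk> \<Longrightarrow> c * (1 / t) powr s \<le> real (covering_number t F)"
    and upper: "\<And>t R x. \<lbrakk>0 < t; t \<le> R; R \<le> 1\<rbrakk> \<Longrightarrow>
      real (covering_number t (cball x R \<inter> F)) \<le> K * (R / t) powr s"
    and U: "F \<subseteq> (\<Union>n. U n)" "\<And>n::nat. bounded (U n) \<and> diameter (U n) \<le> 1 / 2"
  shows "ennreal (c / (2 * K)) \<le> (\<Sum>n. diam_pow s (U n))"
proof -
  define d where "d n = diameter (U n)" for n
  have d: "0 \<le> d n" "d n \<le> 1 / 2" for n using U(2)[of n] by (auto simp: d_def diameter_ge_0)
  \<comment> \<open>The first bound keeps every \<open>q n\<close> at most 1, so that
    \<open>upper\<close> applies to the radii \<open>R n\<close>; the second limits the total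
    enlargement to a quarter of \<open>c / K\<close>.\<close>
  define \<tau> where "\<tau> = min (1 - (1 / 2) powr s) (c / (4 * K))"
  have "(1 / 2 :: real) powr s < 1" using s powr_less_mono2[of s "1 / 2" 1] by simp
  then have \<tau>: "0 < \<tau>" "(1 / 2) powr s + \<tau> \<le> 1" "\<tau> \<le> c / (4 * K)" using cK by (auto simp: \<tau>_def)
  \<comment> \<open>A summable enlargement makes each radius strictly larger than the diameter, and
    positive even for single points, so that open balls cover and compactness applies.\<close>
  define q where "q n = d n powr s + \<tau> / 2 ^ Suc n" for n
  have q: "d n powr s < q n" "0 < q n" "q n \<le> 1" for n
  proof -
    show "d n powr s < q n" using \<tau> by (simp add: q_def)
    then show "0 < q n" by (rule le_less_trans[rotated]) simp
    have "(1::real) \<le> 2 ^ Suc n" by (rule one_le_power) simp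
    then have "\<tau> / 2 ^ Suc n \<le> \<tau> / 1" using \<tau>(1) by (intro divide_left_mono) auto
    moreover have "d n powr s \<le> (1 / 2) powr s" using d s by (intro powr_mono2) auto
    ultimately show "q n \<le> 1" using \<tau> by (simp add: q_def)
  qed
  define R where "R n = q n powr (1 / s)" for n
  have R: "0 < R n" "R n \<le> 1" "R n powr s = q n" "d n < R n" for n
  proof -
    show "0 < R n" using q[of n] by (simp add: R_def)
    show "R n \<le> 1" unfolding R_def using q[of n] s powr_mono2[of "1 / s" "q n" 1] by simp
    show Rs: "R n powr s = q n" using q[of n] s by (simp add: R_def powr_powr)
    show "d n < R n"
    proof (rule ccontr)
      assume "\<not> d n < R n"
      then have "R n powr s \<le> d n powr s" using \<open>0 < R n\<close> s by (intro powr_mono2) auto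
      then show False using Rs q(1)[of n] by simp
    qed
  qed
  define I where "I = {n. U n \<noteq> {}}"
  define x where "x n = (SOME x. x \<in> U n)" for n
  have x: "x n \<in> U n" if "n \<in> I" for n using that unfolding I_def x_def by (simp add: some_in_eq)
  have "F \<subseteq> (\<Union>n\<in>I. ball (x n) (R n))"
  proof
    fix y assume "y \<in> F"
    then obtain n where n: "y \<in> U n" using U(1) by blast
    then have nI: "n \<in> I" by (auto simp: I_def)
    have "dist (x n) y \<le> d n"
      unfolding d_def using U(2)[of n] x[OF nI] n by (intro diameter_bounded_bound) auto
    then have "dist (x n) y < R n" using R(4)[of n] by linarith
    then show "y \<in> (\<Union>n\<in>I. ball (x n) (R n))" using nI by auto
  qed
  then obtain J where J: "J \<subseteq> I" "finite J" "F \<subseteq> (\<Union>n\<in>J. ball (x n) (R n))"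
    using compactE_image[OF F(1), of I "\<lambda>n. ball (x n) (R n)"] by auto
  \<comment> \<open>A common scale not above any radius of the subcover; its power cancels from both
    sides of the count.\<close>
  define t where "t = Min (insert 1 (R ` J))"
  have t: "0 < t" "t \<le> 1" "\<And>n. n \<in> J \<Longrightarrow> t \<le> R n" using J(2) R(1) by (auto simp: t_def)
  have bF: "bounded F" using F(1) compact_imp_bounded by blast
  have "c * (1 / t) powr s \<le> real (covering_number t F)" using lower t by blast
  also have "\<dots> \<le> real (\<Sum>n\<in>J. covering_number t (cball (x n) (R n) \<inter> F))"
  proof (intro of_nat_mono covering_number_UN_le J(2) t(1))
    show "F \<subseteq> (\<Union>n\<in>J. cball (x n) (R n) \<inter> F)" using J(3) by force
  qed (use bF in blast)
  also have "\<dots> = (\<Sum>n\<in>J. real (covering_number t (cball (x n) (R n) \<inter> F)))" by simp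
  also have "\<dots> \<le> (\<Sum>n\<in>J. K * (q n * (1 / t) powr s))"
  proof (rule sum_mono)
    fix n assume n: "n \<in> J"
    have "real (covering_number t (cball (x n) (R n) \<inter> F)) \<le> K * (R n / t) powr s"
      using upper t n R(2) by blast
    also have "(R n / t) powr s = q n * (1 / t) powr s"
      using R[of n] t(1) powr_mult[of "R n" "1 / t" s] by simp
    finally show "real (covering_number t (cball (x n) (R n) \<inter> F)) \<le> K * (q n * (1 / t) powr s)" .
  qed
  also have "\<dots> = (K * sum q J) * (1 / t) powr s" by (simp add: sum_distrib_left sum_distrib_right mult_ac)
  finally have "c * (1 / t) powr s \<le> (K * sum q J) * (1 / t) powr s" .
  then have "c \<le> K * sum q J" using t(1) by simp
  then have cq: "c / K \<le> sum q J" using cK by (simp add: divide_le_eq mult.commute)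
  have "(\<Sum>n\<in>J. \<tau> / 2 ^ Suc n) \<le> \<tau>"
  proof -
    have "(\<lambda>n. \<tau> * (1 / 2) ^ Suc n) sums (\<tau> * 1)" by (intro sums_mult power_half_series)
    moreover have "\<tau> * (1 / 2) ^ Suc n = \<tau> / 2 ^ Suc n" for n by (simp add: power_divide)
    ultimately have "(\<lambda>n. \<tau> / 2 ^ Suc n) sums \<tau>" by (simp only: mult_1_right)
    then show ?thesis using sum_le_suminf[of "\<lambda>n. \<tau> / 2 ^ Suc n" J] J(2) \<tau>(1) by (auto simp: sums_iff)
  qed
  then have "c / K - c / (4 * K) \<le> (\<Sum>n\<in>J. d n powr s)"
    using cq \<tau>(3) by (simp add: q_def sum.distrib)
  then have "c / (2 * K) \<le> (\<Sum>n\<in>J. d n powr s)" using cK by (simp add: field_simps)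
  then have "ennreal (c / (2 * K)) \<le> ennreal (\<Sum>n\<in>J. d n powr s)" by (rule ennreal_leI)
  also have "\<dots> = (\<Sum>n\<in>J. diam_pow s (U n))"
  proof -
    have "(\<Sum>n\<in>J. diam_pow s (U n)) = (\<Sum>n\<in>J. ennreal (d n powr s))"
      using J(1) s by (intro sum.cong) (auto simp: diam_pow_def d_def I_def)
    then show ?thesis by (simp add: sum_ennreal)
  qed
  also have "\<dots> \<le> (\<Sum>n. diam_pow s (U n))" using J(2) by (intro sum_le_suminf) auto
  finally show ?thesis .
qed

text \<open>Smaller exponents are included in order to locate the Hausdorff dimension. They only
  increase the terms, as the diameters are below 1; exponent 0 is treated separately because a
  nonempty set then counts as 1.\<close>

lemma hausdorff_measure_pos:
  fixes F :: "'a::euclidean_space set"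
  assumes F: "compact F" "F \<noteq> {}" and s: "0 \<le> s'" "s' \<le> s" and cK: "0 < c" "0 < K"
    and lower: "\<And>t. \<lbrakk>0 < t; t \<le> 1\<rbrakk> \<Longrightarrow> c * (1 / t) powr s \<le> real (covering_number t F)"
    and upper: "\<And>t R x. \<lbrakk>0 < t; t \<le> R; R \<le> 1\<rbrakk> \<Longrightarrow>
      real (covering_number t (cball x R \<inter> F)) \<le> K * (R / t) powr s"
  shows "0 < hausdorff_measure s' F"
proof -
  define m where "m = (if s' = 0 then 1 else c / (2 * K))"
  have m: "0 < m" using cK by (simp add: m_def)
  have "ennreal m \<le> (\<Sum>n. diam_pow s' (U n))"
    if U: "F \<subseteq> (\<Union>n. U n)" "\<forall>n::nat. bounded (U n) \<and> diameter (U n) \<le> 1 / 2" for U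
  proof (cases "s' = 0")
    case True
    obtain y where "y \<in> F" using F(2) by blast
    then obtain n where n: "U n \<noteq> {}" using U(1) by blast
    have "(\<Sum>n\<in>{n}. diam_pow s' (U n)) \<le> (\<Sum>n. diam_pow s' (U n))" by (intro sum_le_suminf) auto
    then show ?thesis using n True by (simp add: m_def diam_pow_def)
  next
    case False
    have "ennreal m \<le> (\<Sum>n. diam_pow s (U n))"
      using hausdorff_sum_lower_bound[OF F _ cK lower upper U(1)] U(2) False s by (simp add: m_def)
    also have "\<dots> \<le> (\<Sum>n. diam_pow s' (U n))"
    proof (intro suminf_le)
      fix n
      have d: "0 \<le> diameter (U n)" "diameter (U n) \<le> 1" using U(2)[rule_format, of n] by (auto simp: diameter_ge_0)
      have "diameter (U n) powr s \<le> diameter (U n) powr s'"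
        using powr_mono'[OF s(2) d] .
      then show "diam_pow s (U n) \<le> diam_pow s' (U n)"
        using False s by (auto simp: diam_pow_def intro: ennreal_leI)
    qed auto
    finally show ?thesis .
  qed
  then have "ennreal m \<le> hausdorff_premeasure (1 / 2) s' F"
    unfolding hausdorff_premeasure_def by (intro INF_greatest) auto
  also have "\<dots> \<le> hausdorff_measure s' F" unfolding hausdorff_measure_def by (intro SUP_upper) auto
  finally show ?thesis using m by (metis ennreal_less_zero_iff less_le_trans)
qed

lemma assouad_exponents_similarity:
  assumes q: "similarity_map q" and sub: "q ` F' \<subseteq> F" and F: "bounded F"
  shows "assouad_exponents F \<subseteq> assouad_exponents F'"
proof
  fix \<alpha> assume \<alpha>: "\<alpha> \<in> assouad_exponents F"
  obtain c where c: "\<forall>r R. 0 < r \<and> r < R \<longrightarrow>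
     (\<forall>x\<in>F. real (covering_number r (cball x R \<inter> F)) \<le> c * (R / r) powr \<alpha>)"
    using assouad_exponentsD[OF \<alpha>] by blast
  define \<rho> where "\<rho> = sim_ratio q"
  have \<rho>: "0 < \<rho>" using sim_ratio_pos[OF q] by (simp add: \<rho>_def)
  have "real (covering_number r (cball x R \<inter> F')) \<le> c * (R / r) powr \<alpha>"
    if r: "0 < r" "r < R" and x: "x \<in> F'" for r R x
  proof -
    have "covering_number r (cball x R \<inter> F') = covering_number (\<rho> * r) (q ` (cball x R \<inter> F'))"
      unfolding \<rho>_def using r by (intro covering_number_similarity[OF q, symmetric]) auto
    also have "\<dots> \<le> covering_number (\<rho> * r) (cball (q x) (\<rho> * R) \<inter> F)"
      using sub F r \<rho> by (intro covering_number_mono) (auto simp: sim_dist[OF q] \<rho>_def)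
    finally have "real (covering_number r (cball x R \<inter> F'))
        \<le> real (covering_number (\<rho> * r) (cball (q x) (\<rho> * R) \<inter> F))" by (rule of_nat_mono)
    also have "\<dots> \<le> c * ((\<rho> * R) / (\<rho> * r)) powr \<alpha>"
      using c[rule_format, of "\<rho> * r" "\<rho> * R" "q x"] \<rho> r x sub by auto
    also have "(\<rho> * R) / (\<rho> * r) = R / r" using \<rho> by simp
    finally show ?thesis .
  qed
  then show "\<alpha> \<in> assouad_exponents F'" using assouad_exponentsD(1)[OF \<alpha>] by (auto simp: assouad_exponents_def)
qed

context loop_semigroup
begin

text \<open>Isolation for pointwise convergence, written with a basic neighbourhood of the identity:
  finitely many test points and one tolerance.\<close>

definition id_isolated :: bool where
  "id_isolated \<longleftrightarrow> (\<exists>P \<epsilon>. finite P \<and> 0 < \<epsilon> \<and> (\<forall>C\<in>L. \<forall>D\<in>L.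
     (\<forall>x\<in>P. norm (inv C (D x) - x) < \<epsilon>) \<longrightarrow> inv C \<circ> D = id))"

text \<open>Maps of comparable ratio near a ball are told apart by the positions of finitely many points.\<close>

lemma bounded_multiplicity:
  assumes id_isolated and c: "0 < c"
  shows "\<exists>N. \<forall>x R. 0 < R \<longrightarrow> (let \<A> = {A \<in> L. c * R \<le> sim_ratio A \<and> sim_ratio A \<le> R \<and>
    (\<exists>z. norm z \<le> Z \<and> dist (A z) x \<le> R)} in finite \<A> \<and> card \<A> \<le> N)"
proof -
  obtain P \<epsilon> where P: "finite P" "0 < \<epsilon>" "\<forall>C\<in>L. \<forall>D\<in>L.
     (\<forall>x\<in>P. norm (inv C (D x) - x) < \<epsilon>) \<longrightarrow> inv C \<circ> D = id"
    using assms(1) unfolding id_isolated_def by (elim exE conjE)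
  define \<mu> where "\<mu> = Max (insert 0 (norm ` P))"
  have \<mu>: "0 \<le> \<mu>" "\<And>p. p \<in> P \<Longrightarrow> norm p \<le> \<mu>" using P(1) by (auto simp: \<mu>_def)
  define \<tau> where "\<tau> = \<mu> + \<bar>Z\<bar> + 1"
  \<comment> \<open>Images of the test points are recorded up to \<open>\<epsilon>' * R\<close>. Two
    maps with the same record differ there by less than \<epsilon> times their ratio, so that the
    return map formed from them is within \<epsilon> of the identity on P.\<close>
  define \<epsilon>' where "\<epsilon>' = min \<epsilon> 1 * min c 1 / 3"
  have \<epsilon>': "0 < \<epsilon>'" "2 * \<epsilon>' < \<epsilon> * c" "\<epsilon>' \<le> \<tau>"
  proof -
    show "0 < \<epsilon>'" using P c by (simp add: \<epsilon>'_def)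
    have 1: "min \<epsilon> 1 * min c 1 \<le> \<epsilon> * c" using P(2) c by (intro mult_mono) auto
    moreover have "min \<epsilon> 1 * min c 1 \<le> 1 * 1" using P(2) c by (intro mult_mono) auto
    ultimately show "2 * \<epsilon>' < \<epsilon> * c" "\<epsilon>' \<le> \<tau>" using mult_pos_pos[OF P(2) c] \<mu>(1) abs_ge_zero[of Z] unfolding \<epsilon>'_def \<tau>_def by linarith+
  qed
  obtain K where K: "0 < K" "\<forall>(x::'a) R r. 0 < r \<and> r \<le> R \<longrightarrow>
      real (covering_number r (cball x R)) \<le> K * (R / r) ^ DIM('a)"
    using covering_number_cball by blast
  define N0 where "N0 = nat \<lceil>K * (\<tau> / \<epsilon>') ^ DIM('a)\<rceil>"
  have "finite \<A> \<and> card \<A> \<le> N0 ^ card P"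
    if R: "0 < R" and A_def: "\<A> = {A \<in> L. c * R \<le> sim_ratio A \<and> sim_ratio A \<le> R \<and>
      (\<exists>z. norm z \<le> Z \<and> dist (A z) x \<le> R)}" for \<A> x R
  proof -
    have r: "0 < \<epsilon>' * R" "\<epsilon>' * R \<le> \<tau> * R" using \<epsilon>' R by (auto intro: mult_right_mono)
    from covering_number_attained[OF bounded_cball r(1), of x "\<tau> * R"]
    obtain C where C: "finite C" "card C = covering_number (\<epsilon>' * R) (cball x (\<tau> * R))"
      "cball x (\<tau> * R) \<subseteq> (\<Union>c\<in>C. cball c (\<epsilon>' * R))" by metis
    have "real (card C) \<le> K * ((\<tau> * R) / (\<epsilon>' * R)) ^ DIM('a)" unfolding C(2) using K(2) r by blast
    then have cC: "card C \<le> N0" unfolding N0_def using R by (simp add: le_nat_iff le_ceiling_iff)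
    have pos: "\<exists>b\<in>C. dist b (A p) \<le> \<epsilon>' * R" if A: "A \<in> \<A>" and p: "p \<in> P" for A p
    proof -
      obtain z where z: "A \<in> L" "sim_ratio A \<le> R" "norm z \<le> Z" "dist (A z) x \<le> R" using A A_def by auto
      have "dist (A p) (A z) = sim_ratio A * dist p z" by (rule sim_dist[OF sim[OF z(1)]])
      also have "\<dots> \<le> R * (\<mu> + \<bar>Z\<bar>)"
      proof (rule mult_mono)
        show "dist p z \<le> \<mu> + \<bar>Z\<bar>" using norm_triangle_ineq4[of p z] \<mu>(2)[OF p] z(3) by (simp add: dist_norm)
      qed (use z R in auto)
      finally have "dist (A p) x \<le> R * (\<mu> + \<bar>Z\<bar>) + R"
        using dist_triangle[of "A p" x "A z"] z(4) by linarith
      then have "A p \<in> cball x (\<tau> * R)" by (simp add: \<tau>_def dist_commute algebra_simps)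
      then have "A p \<in> (\<Union>c\<in>C. cball c (\<epsilon>' * R))" using C(3) by (rule rev_subsetD)
      then show ?thesis by auto
    qed
    then have "\<forall>A\<in>\<A>. \<forall>p\<in>P. \<exists>b. b \<in> C \<and> dist b (A p) \<le> \<epsilon>' * R" by blast
    then obtain g where g: "\<And>A p. A \<in> \<A> \<Longrightarrow> p \<in> P \<Longrightarrow> g A p \<in> C \<and> dist (g A p) (A p) \<le> \<epsilon>' * R" by metis
    define \<phi> where "\<phi> A = (\<lambda>p\<in>P. g A p)" for A
    have im: "\<phi> ` \<A> \<subseteq> P \<rightarrow>\<^sub>E C" using g by (auto simp: \<phi>_def)
    have inj: "inj_on \<phi> \<A>"
    proof (rule inj_onI)
      fix A B assume AB: "A \<in> \<A>" "B \<in> \<A>" "\<phi> A = \<phi> B"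
      have AL: "A \<in> L" "B \<in> L" "c * R \<le> sim_ratio A" using AB A_def by auto
      have "norm (inv A (B p) - p) < \<epsilon>" if p: "p \<in> P" for p
      proof -
        have "g A p = g B p" using fun_cong[OF AB(3), of p] p by (simp add: \<phi>_def)
        then have "dist (B p) (A p) \<le> 2 * \<epsilon>' * R"
          using g[OF AB(1) p] g[OF AB(2) p] dist_triangle2[of "B p" "A p" "g A p"] by (simp add: dist_commute)
        also have "\<dots> < \<epsilon> * (c * R)" using \<epsilon>'(2) R by simp
        also have "\<dots> \<le> \<epsilon> * sim_ratio A" using AL(3) P(2) by simp
        also have "dist (B p) (A p) = sim_ratio A * dist (inv A (B p)) p"
          using sim_dist[OF sim[OF AL(1)], of "inv A (B p)" p] AL by (simp add: sim)
        finally show ?thesis using ratio_pos[OF AL(1)] by (simp add: dist_norm mult.commute)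
      qed
      then have "inv A \<circ> B = id" using P(3) AL(1,2) by blast
      then have "A (inv A (B x)) = A x" for x by (metis comp_apply id_apply)
      then show "A = B" using AL by (auto simp: sim)
    qed
    have fin: "finite (P \<rightarrow>\<^sub>E C)" using P(1) C(1) by (intro finite_PiE) auto
    have "finite \<A>" using inj im fin by (metis finite_imageD finite_subset)
    moreover have "card \<A> \<le> N0 ^ card P"
    proof -
      have "card \<A> \<le> card (P \<rightarrow>\<^sub>E C)" using card_inj_on_le[OF inj im fin] .
      also have "\<dots> = card C ^ card P" using P(1) by (simp add: card_PiE)
      also have "\<dots> \<le> N0 ^ card P" using cC by (intro power_mono) auto
      finally show ?thesis .
    qed
    ultimately show ?thesis by blast
  qed
  then show ?thesis unfolding Let_def by blast
qed

text \<open>Isolation enters through bounded multiplicity: near x the set F is covered by boundedly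
  many copies of F under \<open>A \<circ> inv B\<close>, with A of ratio about R and B from a finite
  set.\<close>

lemma local_covering_bound:
  assumes id_isolated
  shows "\<exists>K>0. \<forall>x t R. 0 < t \<and> 0 < R \<and> R \<le> 1 \<longrightarrow>
    real (covering_number t (cball x R \<inter> F)) \<le> K * real (covering_number (t / R) F)"
proof -
  obtain \<B> c where B: "finite \<B>" "\<B> \<subseteq> L" "0 < c" "\<And>a \<delta>. \<lbrakk>a \<in> F; 0 < \<delta>; \<delta> \<le> 1\<rbrakk> \<Longrightarrow>
      (\<exists>A\<in>L. \<exists>B\<in>\<B>. \<exists>z. c * \<delta> \<le> sim_ratio A \<and> sim_ratio A \<le> \<delta> \<and> B z \<in> F \<and> A z = a)"
    using cover by (metis (no_types, lifting))
  obtain M where M: "0 < M" "\<forall>x\<in>F. norm x \<le> M" using F_bound by blast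
  obtain f0 where f0: "f0 \<in> F" using F_nonempty by blast
  define \<beta> where "\<beta> = Min (insert 1 (sim_ratio ` \<B>))"
  have \<beta>: "0 < \<beta>" "\<And>B. B \<in> \<B> \<Longrightarrow> \<beta> \<le> sim_ratio B"
    using B(1,2) ratio_pos by (auto simp: \<beta>_def)
  \<comment> \<open>The points z supplied by \<open>cover\<close> may lie outside F; this bounds
    them, as the multiplicity bound requires.\<close>
  define Z where "Z = M + 2 * M / \<beta>"
  have Z: "norm z \<le> Z" if z: "B z \<in> F" "B \<in> \<B>" for B z
  proof -
    have BL: "B \<in> L" using z B(2) by blast
    have "\<beta> * dist z f0 \<le> sim_ratio B * dist z f0" using \<beta>(2)[OF z(2)] by (intro mult_right_mono) auto
    also have "\<dots> = dist (B z) (B f0)" by (simp add: sim_dist[OF sim[OF BL]])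
    also have "\<dots> \<le> norm (B z) + norm (B f0)" by (simp add: dist_norm norm_triangle_ineq4)
    also have "\<dots> \<le> 2 * M" using bspec[OF M(2) z(1)] bspec[OF M(2) maps_F[OF BL f0]] by linarith
    finally have "dist z f0 \<le> 2 * M / \<beta>" using \<beta>(1) by (simp add: le_divide_eq mult.commute)
    moreover have "norm z \<le> norm f0 + dist z f0" by (metis dist_norm norm_triangle_sub)
    ultimately show ?thesis using bspec[OF M(2) f0] by (simp add: Z_def)
  qed
  obtain N where N: "\<forall>x R. 0 < R \<longrightarrow> (let \<A> = {A \<in> L. c * R \<le> sim_ratio A \<and> sim_ratio A \<le> R \<and>
    (\<exists>z. norm z \<le> Z \<and> dist (A z) x \<le> R)} in finite \<A> \<and> card \<A> \<le> N)"
    using bounded_multiplicity[OF assms B(3)] by blast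
  obtain K where K: "0 < K" "\<forall>(E :: 'a set) r. bounded E \<and> 0 < r \<longrightarrow>
    real (covering_number (\<beta> * r) E) \<le> K * real (covering_number r E)"
    using covering_number_rescale[OF \<beta>(1)] by blast
  have "real (covering_number t (cball x R \<inter> F))
      \<le> ((real N * real (card \<B>) + 1) * K) * real (covering_number (t / R) F)"
    if t: "0 < t" and R: "0 < R" "R \<le> 1" for x t R
  proof -
    define \<A> where "\<A> = {A \<in> L. c * R \<le> sim_ratio A \<and> sim_ratio A \<le> R \<and>
      (\<exists>z. norm z \<le> Z \<and> dist (A z) x \<le> R)}"
    have A: "finite \<A>" "card \<A> \<le> N" using N R(1) unfolding \<A>_def Let_def by blast+
    define E where "E = (\<lambda>(A :: 'a \<Rightarrow> 'a, B :: 'a \<Rightarrow> 'a). (A \<circ> inv B) ` F)"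
    have E: "bounded (E s)" "covering_number t (E s) \<le> covering_number (\<beta> * (t / R)) F"
      if s: "s \<in> \<A> \<times> \<B>" for s
    proof -
      obtain A B where AB: "s = (A, B)" "A \<in> \<A>" "B \<in> \<B>" using s by auto
      have AL: "A \<in> L" "sim_ratio A \<le> R" using AB(2) by (auto simp: \<A>_def)
      have BL: "B \<in> L" using AB(3) \<open>\<B> \<subseteq> L\<close> by blast
      have S: "similarity_map (A \<circ> inv B)" using similarity_map_comp similarity_map_inv sim AL BL by blast
      have rS: "sim_ratio (A \<circ> inv B) = sim_ratio A / sim_ratio B"
        using sim_ratio_comp[OF sim[OF AL(1)] similarity_map_inv[OF sim[OF BL]]] sim_ratio_inv[OF sim[OF BL]] by simp
      show "bounded (E s)" using bounded_similarity_image[OF S bounded_F] by (simp add: E_def AB)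
      \<comment> \<open>The scale t pulled back to F; it is at least
        \<open>\<beta> * (t / R)\<close> because A has ratio at most R.\<close>
      define u where "u = t * sim_ratio B / sim_ratio A"
      have u: "0 < u" using t ratio_pos AL BL by (simp add: u_def)
      have "sim_ratio (A \<circ> inv B) * u = t"
        unfolding rS u_def using ratio_pos[OF AL(1)] ratio_pos[OF BL] by simp
      then have "covering_number t (E s) = covering_number u F"
        using covering_number_similarity[OF S bounded_F u] by (simp add: E_def AB)
      also have "\<dots> \<le> covering_number (\<beta> * (t / R)) F"
      proof (rule covering_number_mono)
        have "\<beta> * (t / R) = t * \<beta> / R" by simp
        also have "\<dots> \<le> u"
          unfolding u_def using \<beta> AL AB(3) t R ratio_pos[OF AL(1)] ratio_pos[OF BL]
          by (intro frac_le mult_left_mono) auto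
        finally show "\<beta> * (t / R) \<le> u" .
      qed (use bounded_F \<beta> t R in auto)
      finally show "covering_number t (E s) \<le> covering_number (\<beta> * (t / R)) F" .
    qed
    have "cball x R \<inter> F \<subseteq> (\<Union>s\<in>\<A> \<times> \<B>. E s)"
    proof
      fix a assume a: "a \<in> cball x R \<inter> F"
      then obtain A C z where A: "A \<in> L" "C \<in> \<B>" "c * R \<le> sim_ratio A" "sim_ratio A \<le> R" "C z \<in> F" "A z = a"
        using B(4)[of a R] R by blast
      have "A \<in> \<A>" using A a Z[OF A(5,2)] by (auto simp: \<A>_def dist_commute)
      moreover have "a \<in> E (A, C)"
      proof -
        have "C \<in> L" using A(2) \<open>\<B> \<subseteq> L\<close> by blast
        then have "(A \<circ> inv C) (C z) = a" using A by (simp add: sim)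
        then show ?thesis using A(5) unfolding E_def by force
      qed
      ultimately show "a \<in> (\<Union>s\<in>\<A> \<times> \<B>. E s)" using A(2) by blast
    qed
    then have "covering_number t (cball x R \<inter> F) \<le> (\<Sum>s\<in>\<A> \<times> \<B>. covering_number t (E s))"
      using A(1) B(1) E(1) t by (intro covering_number_UN_le) auto
    also have "\<dots> \<le> (\<Sum>s\<in>\<A> \<times> \<B>. covering_number (\<beta> * (t / R)) F)" using E(2) by (rule sum_mono)
    also have "\<dots> = card \<A> * card \<B> * covering_number (\<beta> * (t / R)) F" by (simp add: card_cartesian_product)
    finally have "real (covering_number t (cball x R \<inter> F))
        \<le> real (card \<A>) * real (card \<B>) * real (covering_number (\<beta> * (t / R)) F)"
      by (metis of_nat_le_iff of_nat_mult)
    also have "\<dots> \<le> (real N * real (card \<B>) + 1) * (K * real (covering_number (t / R) F))"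
    proof (rule mult_mono)
      have "real (card \<A>) * real (card \<B>) \<le> real N * real (card \<B>)"
        using A(2) by (intro mult_right_mono) auto
      then show "real (card \<A>) * real (card \<B>) \<le> real N * real (card \<B>) + 1" by linarith
      show "real (covering_number (\<beta> * (t / R)) F) \<le> K * real (covering_number (t / R) F)"
        using K(2)[rule_format, of F "t / R"] bounded_F t R by simp
    qed auto
    finally show ?thesis by (simp only: mult.assoc)
  qed
  moreover have "0 < (real N * real (card \<B>) + 1) * K" using K(1) by (intro mult_pos_pos add_nonneg_pos) auto
  ultimately show ?thesis by blast
qed

text \<open>A copy of a \<open>u\<close>-separated set is placed in a piece of size about t around
  each point of a \<open>t\<close>-separated set. Different copies are apart because their pieces
  are; within one copy the lower bound for the ratio preserves the separation.\<close>

lemma covering_supermultiplicative: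
  "\<exists>\<kappa>>0. \<forall>t u. 0 < t \<and> t \<le> 1 \<and> 0 < u \<and> u \<le> 1 \<longrightarrow>
    \<kappa> * (real (covering_number t F) * real (covering_number u F)) \<le> real (covering_number (t * u) F)"
proof -
  obtain c where c: "0 < c" "\<And>a \<delta>. \<lbrakk>a \<in> F; 0 < \<delta>; \<delta> \<le> 1\<rbrakk> \<Longrightarrow>
     (\<exists>A\<in>L. c * \<delta> \<le> sim_ratio A \<and> sim_ratio A \<le> \<delta> \<and> (\<forall>x\<in>F. dist (A x) a \<le> \<delta>))"
    using small_piece by blast
  \<comment> \<open>The value \<open>1 / 4\<close> serves points of different pieces,
    \<open>c / 4\<close> points of the same piece.\<close>
  define c' where "c' = min (c / 4) (1 / 4)"
  have c': "0 < c'" "c' \<le> c / 4" "c' \<le> 1 / 4" using c by (auto simp: c'_def)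
  have c2: "0 < c' / 2" using c' by simp
  obtain K where K: "0 < K" "\<forall>(E :: 'a set) r. bounded E \<and> 0 < r \<longrightarrow>
    real (covering_number ((c' / 2) * r) E) \<le> K * real (covering_number r E)"
    using covering_number_rescale[OF c2] by blast
  have "(1 / K) * (real (covering_number t F) * real (covering_number u F)) \<le> real (covering_number (t * u) F)"
    if t: "0 < t" "t \<le> 1" and u: "0 < u" "u \<le> 1" for t u
  proof -
    from maximal_separated[OF bounded_F t(1)] obtain P where P: "P \<subseteq> F" "finite P" "separated t P"
      "covering_number t F \<le> card P" by metis
    from maximal_separated[OF bounded_F u(1)] obtain Q where Q: "Q \<subseteq> F" "finite Q" "separated u Q"
      "covering_number u F \<le> card Q" by metis
    have "\<exists>A\<in>L. c * (t / 4) \<le> sim_ratio A \<and> (\<forall>x\<in>F. dist (A x) p \<le> t / 4)" if "p \<in> P" for p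
      using c(2)[of p "t / 4"] that P(1) t by auto
    then obtain A where A: "\<And>p. p \<in> P \<Longrightarrow> A p \<in> L" "\<And>p. p \<in> P \<Longrightarrow> c * (t / 4) \<le> sim_ratio (A p)"
      "\<And>p x. p \<in> P \<Longrightarrow> x \<in> F \<Longrightarrow> dist (A p x) p \<le> t / 4" by metis
    define h where "h = (\<lambda>(p, q). A p q)"
    have sep: "c' * (t * u) < dist (h s) (h s')" if s: "s \<in> P \<times> Q" "s' \<in> P \<times> Q" "s \<noteq> s'" for s s'
    proof -
      obtain p q p' q' where pq: "s = (p, q)" "p \<in> P" "q \<in> Q" "s' = (p', q')" "p' \<in> P" "q' \<in> Q" using s by auto
      show ?thesis
      proof (cases "p = p'")
        case False
        have "t < dist p p'" using False pq P(3) by (auto simp: separated_def)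
        also have "\<dots> \<le> dist (A p q) p + dist (A p q) (A p' q') + dist (A p' q') p'"
          using dist_triangle[of p p' "A p q"] dist_triangle[of "A p q" p' "A p' q'"] by (simp add: dist_commute)
        finally have "t / 2 < dist (A p q) (A p' q')"
          using A(3)[of p q] A(3)[of p' q'] pq Q(1) by fastforce
        moreover have "c' * (t * u) \<le> 1 / 4 * (t * 1)" using c' t u by (intro mult_mono) auto
        ultimately have "c' * (t * u) < dist (A p q) (A p' q')" using t by linarith
        then show ?thesis by (simp add: h_def pq)
      next
        case True
        then have "u < dist q q'" using s(3) pq Q(3) by (auto simp: separated_def)
        then have "c * (t / 4) * u < sim_ratio (A p) * dist q q'"
          using A(2)[OF pq(2)] c t u by (intro mult_le_less_imp_less) auto
        moreover have "c' * (t * u) \<le> c / 4 * (t * u)" using c' t u by (intro mult_right_mono) auto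
        ultimately show ?thesis
          using sim_dist[OF sim[OF A(1)[OF pq(2)]], of q q'] True by (simp add: h_def pq)
      qed
    qed
    have pos: "0 < c' * (t * u)" using c' t u by simp
    have "inj_on h (P \<times> Q)"
    proof (rule inj_onI, rule ccontr)
      fix s s' assume "s \<in> P \<times> Q" "s' \<in> P \<times> Q" "h s = h s'" "s \<noteq> s'"
      then show False using sep[of s s'] pos by simp
    qed
    then have "card P * card Q = card (h ` (P \<times> Q))" by (simp add: card_image card_cartesian_product)
    also have "\<dots> \<le> covering_number ((c' / 2) * (t * u)) F"
    proof (rule separated_card_le(2)[OF _ _ bounded_F])
      show "h ` (P \<times> Q) \<subseteq> F" using A(1) P(1) Q(1) maps_F by (auto simp: h_def)
      have "separated (c' * (t * u)) (h ` (P \<times> Q))"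
        unfolding separated_def
      proof clarify
        fix p q p' q' assume pq: "p \<in> P" "q \<in> Q" "p' \<in> P" "q' \<in> Q" "h (p, q) \<noteq> h (p', q')"
        then show "c' * (t * u) < dist (h (p, q)) (h (p', q'))" by (intro sep) auto
      qed
      then show "separated (2 * (c' / 2 * (t * u))) (h ` (P \<times> Q))" by simp
    qed (use c' t u in simp)
    finally have "real (card P) * real (card Q) \<le> real (covering_number ((c' / 2) * (t * u)) F)"
      by (metis of_nat_le_iff of_nat_mult)
    moreover have "real (covering_number t F) * real (covering_number u F) \<le> real (card P) * real (card Q)"
      using P(4) Q(4) by (intro mult_mono) auto
    moreover have "real (covering_number ((c' / 2) * (t * u)) F) \<le> K * real (covering_number (t * u) F)"
      using K(2) bounded_F t u by simp
    ultimately have "real (covering_number t F) * real (covering_number u F) \<le> K * real (covering_number (t * u) F)"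
      by linarith
    then show ?thesis using K(1) by (simp add: divide_le_eq mult.commute)
  qed
  moreover have "0 < 1 / K" using K by simp
  ultimately show ?thesis by blast
qed

text \<open>Summed over a cover by balls of radius \<open>(1 / 2) ^ m\<close>, the local bound gives
  submultiplicativity, so that the growth lemma applies at dyadic scales. Passing to intermediate
  scales costs a factor \<open>2 powr s\<close>.\<close>

lemma covering_growth:
  assumes id_isolated
  shows "\<exists>s\<ge>0. \<exists>c1>0. \<exists>c2>0. \<forall>t. 0 < t \<and> t \<le> 1 \<longrightarrow>
    c1 * (1 / t) powr s \<le> real (covering_number t F) \<and> real (covering_number t F) \<le> c2 * (1 / t) powr s"
proof -
  obtain K where K: "0 < K" "\<And>x t R. \<lbrakk>0 < t; 0 < R; R \<le> 1\<rbrakk> \<Longrightarrow>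
    real (covering_number t (cball x R \<inter> F)) \<le> K * real (covering_number (t / R) F)"
    using local_covering_bound[OF assms] by blast
  obtain \<kappa> where \<kappa>: "0 < \<kappa>" "\<And>t u. \<lbrakk>0 < t; t \<le> 1; 0 < u; u \<le> 1\<rbrakk> \<Longrightarrow>
    \<kappa> * (real (covering_number t F) * real (covering_number u F)) \<le> real (covering_number (t * u) F)"
    using covering_supermultiplicative by blast
  define a where "a n = real (covering_number ((1 / 2) ^ n) F)" for n
  have p: "0 < (1 / 2 :: real) ^ n" "(1 / 2 :: real) ^ n \<le> 1" for n by (auto simp: power_le_one)
  have a1: "1 \<le> a n" for n
    using covering_number_pos[OF bounded_F F_nonempty p(1)[of n]] by (simp add: a_def)
  have lower: "\<kappa> * (a m * a n) \<le> a (m + n)" for m n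
    unfolding a_def power_add by (rule \<kappa>(2)[OF p p])
  have upper: "a (m + n) \<le> K * (a m * a n)" for m n
  proof -
    obtain C where C: "finite C" "card C = covering_number ((1 / 2) ^ m) F"
      "F \<subseteq> (\<Union>c\<in>C. cball c ((1 / 2) ^ m))"
      using covering_number_attained[OF bounded_F p(1)] by metis
    have "a (m + n) \<le> real (\<Sum>c\<in>C. covering_number ((1 / 2) ^ (m + n)) (cball c ((1 / 2) ^ m) \<inter> F))"
      unfolding a_def using C(1,3) bounded_F p(1)
      by (intro of_nat_mono covering_number_UN_le) auto
    also have "\<dots> \<le> (\<Sum>c\<in>C. K * a n)"
      unfolding of_nat_sum
    proof (rule sum_mono)
      fix c
      show "real (covering_number ((1 / 2) ^ (m + n)) (cball c ((1 / 2) ^ m) \<inter> F)) \<le> K * a n"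
        using K(2)[of "(1 / 2) ^ (m + n)" "(1 / 2) ^ m" c] p by (simp add: a_def power_add)
    qed
    also have "\<dots> = K * (a m * a n)" using C(2) by (simp add: a_def)
    finally show ?thesis .
  qed
  obtain s0 where s0: "0 \<le> s0" "\<And>n. exp (s0 * real n) / K \<le> a n" "\<And>n. a n \<le> exp (s0 * real n) / \<kappa>"
    using almost_multiplicative_growth[OF a1 \<kappa>(1) K(1) lower upper] by blast
  define s where "s = s0 / ln 2"
  have s: "0 \<le> s" using s0(1) by (simp add: s_def)
  have ex: "exp (s0 * real n) = (2 ^ n) powr s" for n
    by (simp add: powr_def s_def ln_realpow)
  have "(1 / K * (1 / 2) powr s) * (1 / t) powr s \<le> real (covering_number t F) \<and>
      real (covering_number t F) \<le> (1 / \<kappa> * 2 powr s) * (1 / t) powr s"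
    if t: "0 < t" "t \<le> 1" for t
  proof -
    have "\<exists>n. (1 / 2) ^ n < t" using real_arch_pow_inv[OF t(1), of "1 / 2"] by simp
    then obtain n where n: "(1 / 2) ^ n < t" "\<And>k. k < n \<Longrightarrow> t \<le> (1 / 2) ^ k"
      using exists_least_iff[of "\<lambda>n. (1 / 2) ^ n < t"] by (auto simp: not_less)
    \<comment> \<open>Since \<open>t \<le> 1\<close>, n is positive and t lies between consecutive
      dyadic scales.\<close>
    obtain k where k: "n = Suc k" using n(1) t(2) by (cases n) auto
    have tk: "t \<le> (1 / 2) ^ k" using n(2)[of k] k by simp
    have k1: "2 ^ k \<le> 1 / t"
      using tk t(1) by (simp add: power_one_over le_divide_eq divide_le_eq mult.commute)
    have k2: "1 / t \<le> 2 * 2 ^ k"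
      using n(1) t(1) by (simp add: k power_one_over divide_less_eq divide_le_eq mult.commute)
    have "real (covering_number t F) \<le> a n"
      unfolding a_def using n(1) bounded_F by (intro of_nat_mono covering_number_mono) auto
    also have "\<dots> \<le> (2 * 2 ^ k) powr s / \<kappa>" using s0(3)[of n] ex[of n] k by simp
    also have "\<dots> \<le> (2 * (1 / t)) powr s / \<kappa>"
      using k1 s \<kappa>(1) by (intro divide_right_mono powr_mono2) auto
    also have "(2 * (1 / t)) powr s = 2 powr s * (1 / t) powr s" using t by (intro powr_mult)
    finally have up: "real (covering_number t F) \<le> (1 / \<kappa> * 2 powr s) * (1 / t) powr s" by simp
    have "(1 / 2 * (1 / t)) powr s / K \<le> (2 ^ k) powr s / K"
      using k2 s K(1) t(1) by (intro divide_right_mono powr_mono2) auto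
    also have "\<dots> \<le> a k" using s0(2)[of k] ex[of k] by simp
    also have "a k \<le> real (covering_number t F)"
      unfolding a_def using tk t(1) bounded_F by (intro of_nat_mono covering_number_mono) auto
    finally have "(1 / 2 * (1 / t)) powr s / K \<le> real (covering_number t F)" .
    moreover have "(1 / 2 * (1 / t)) powr s = (1 / 2) powr s * (1 / t) powr s" using t by (intro powr_mult)
    ultimately show ?thesis using up by simp
  qed
  moreover have "0 < 1 / K * (1 / 2) powr s" "0 < 1 / \<kappa> * 2 powr s" using K \<kappa> by auto
  ultimately show ?thesis using s by blast
qed

text \<open>The growth exponent s is the least Assouad exponent: the upper bounds make it
  admissible, and the lower bounds, read in one ball containing F, exclude anything smaller. The
  Hausdorff measure is positive up to s and vanishes beyond.\<close>

lemma isolated_dimensions: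
  assumes id_isolated
  shows "0 < hausdorff_measure (assouad_dim F) F" "hausdorff_dim F = assouad_dim F"
proof -
  obtain s c1 c2 where s: "0 \<le> s" "0 < c1" "0 < c2"
    and c1: "\<And>t. \<lbrakk>0 < t; t \<le> 1\<rbrakk> \<Longrightarrow> c1 * (1 / t) powr s \<le> real (covering_number t F)"
    and c2: "\<And>t. \<lbrakk>0 < t; t \<le> 1\<rbrakk> \<Longrightarrow> real (covering_number t F) \<le> c2 * (1 / t) powr s"
    using covering_growth[OF assms] by blast
  obtain K where K: "0 < K" "\<And>x t R. \<lbrakk>0 < t; 0 < R; R \<le> 1\<rbrakk> \<Longrightarrow>
    real (covering_number t (cball x R \<inter> F)) \<le> K * real (covering_number (t / R) F)"
    using local_covering_bound[OF assms] by blast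
  define K' where "K' = K * c2 + c2"
  have K': "0 < K'" using K s by (simp add: K'_def add_pos_pos)
  have local: "real (covering_number t (cball x R \<inter> F)) \<le> K' * (R / t) powr s"
    if t: "0 < t" "t \<le> R" "R \<le> 1" for t R x
  proof -
    have "real (covering_number t (cball x R \<inter> F)) \<le> K * real (covering_number (t / R) F)"
      using K(2) t by simp
    also have "\<dots> \<le> K * (c2 * (1 / (t / R)) powr s)" using K(1) c2[of "t / R"] t by (intro mult_left_mono) auto
    also have "\<dots> \<le> K' * (R / t) powr s"
      using s(3) by (simp add: K'_def distrib_right)
    finally show ?thesis .
  qed
  have global: "real (covering_number t (cball x R \<inter> F)) \<le> K' * (R / t) powr s"
    if t: "0 < t" "t < R" "1 < R" for t R x
  proof -
    \<comment> \<open>The growth bounds concern scales up to 1 only; \<open>1 / u\<close> is at most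
      \<open>R / t\<close> in both cases, as R exceeds 1 and t.\<close>
    define u where "u = min t 1"
    have u: "0 < u" "u \<le> 1" "u \<le> t" using t by (auto simp: u_def)
    have "covering_number t (cball x R \<inter> F) \<le> covering_number u F"
      using bounded_F u by (intro covering_number_mono) auto
    then have "real (covering_number t (cball x R \<inter> F)) \<le> c2 * (1 / u) powr s"
      using c2[OF u(1,2)] by linarith
    also have "\<dots> \<le> c2 * (R / t) powr s"
      using t s by (intro mult_left_mono powr_mono2) (auto simp: u_def min_def divide_right_mono)
    also have "\<dots> \<le> K' * (R / t) powr s" using K s by (intro mult_right_mono) (auto simp: K'_def)
    finally show ?thesis .
  qed
  have "real (covering_number t (cball x R \<inter> F)) \<le> K' * (R / t) powr s" if "0 < t" "t < R" for t R x
    using local[of t R x] global[of t R x] that by linarith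
  then have mem: "s \<in> assouad_exponents F" using s(1) by (auto simp: assouad_exponents_def)
  have min: "s \<le> \<alpha>" if \<alpha>: "\<alpha> \<in> assouad_exponents F" for \<alpha>
  proof (rule ccontr)
    assume less: "\<not> s \<le> \<alpha>"
    obtain M where M: "0 < M" "\<forall>x\<in>F. norm x \<le> M" using F_bound by blast
    obtain x where x: "x \<in> F" using F_nonempty by blast
    define D where "D = 2 * M + 1"
    have D: "1 < D" using M by (simp add: D_def)
    have FD: "cball x D \<inter> F = F"
    proof -
      have "dist x y \<le> D" if "y \<in> F" for y
        using norm_triangle_ineq4[of x y] bspec[OF M(2) x] bspec[OF M(2) that] by (simp add: dist_norm D_def)
      then show ?thesis by auto
    qed
    obtain c where c: "0 < c" "\<forall>r R. 0 < r \<and> r < R \<longrightarrow>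
     (\<forall>x\<in>F. real (covering_number r (cball x R \<inter> F)) \<le> c * (R / r) powr \<alpha>)"
      using assouad_exponentsD[OF \<alpha>] by blast
    have bd: "c1 \<le> c * D powr \<alpha> * y powr (\<alpha> - s)" if y: "1 < y" for y
    proof -
      have t: "0 < 1 / y" "1 / y \<le> 1" "1 / y < D" using y D by (auto simp: divide_less_eq mult_less_cancel_left1 intro: less_trans)
      have "c1 * y powr s \<le> real (covering_number (1 / y) F)" using c1[OF t(1,2)] by simp
      also have "\<dots> \<le> c * (D / (1 / y)) powr \<alpha>" using c(2)[rule_format, of "1 / y" D x] t x FD by simp
      also have "D / (1 / y) = D * y" by simp
      also have "(D * y) powr \<alpha> = D powr \<alpha> * y powr \<alpha>" using D y by (intro powr_mult)
      finally show ?thesis using y by (simp add: powr_diff le_divide_eq)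
    qed
    have "((\<lambda>y. c * D powr \<alpha> * y powr (\<alpha> - s)) \<longlongrightarrow> c * D powr \<alpha> * 0) at_top"
      using less by (intro tendsto_intros tendsto_neg_powr filterlim_ident) auto
    then have "eventually (\<lambda>y. c * D powr \<alpha> * y powr (\<alpha> - s) < c1) at_top"
      by (rule order_tendstoD) (use s(2) in simp)
    then have "eventually (\<lambda>y::real. False) at_top"
      using eventually_gt_at_top[of 1] by eventually_elim (use bd in force)
    then show False by simp
  qed
  have ad: "assouad_dim F = s"
    unfolding assouad_dim_eq_Inf using mem min by (intro cInf_eq_minimum)
  have pos: "0 < hausdorff_measure s' F" if "0 \<le> s'" "s' \<le> s" for s'
    using hausdorff_measure_pos[OF compact_F F_nonempty that s(2) K' c1 local] .
  then show "0 < hausdorff_measure (assouad_dim F) F" using ad s(1) by simp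
  have zero: "hausdorff_measure s' F = 0" if "s < s'" for s'
    using hausdorff_measure_eq_0[OF bounded_F s(1) that s(3) c2] .
  have "{s'. 0 \<le> s' \<and> hausdorff_measure s' F = 0} = {s<..}"
  proof (intro subset_antisym subsetI)
    fix s' assume "s' \<in> {s'. 0 \<le> s' \<and> hausdorff_measure s' F = 0}"
    then show "s' \<in> {s<..}" using pos[of s'] by (auto simp: not_le[symmetric])
  qed (use zero s(1) in auto)
  then show "hausdorff_dim F = assouad_dim F" unfolding hausdorff_dim_def ad by simp
qed

end

section \<open>Return maps and the identity\<close>

text \<open>A basic neighbourhood in the product topology restricts only finitely many coordinates,
  and each of them contains a ball.\<close>

lemma isolated_id_finite:
  fixes R :: "('a::euclidean_space \<Rightarrow> 'a) set"
  assumes "id isolated_in R"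
  shows "\<exists>P \<epsilon>. finite P \<and> 0 < \<epsilon> \<and> (\<forall>h\<in>R. (\<forall>x\<in>P. norm (h x - x) < \<epsilon>) \<longrightarrow> h = id)"
proof -
  obtain T where T: "open T" "T \<inter> R = {id}" using assms by (auto simp: isolated_in_def)
  have "openin (product_topology (\<lambda>_::'a. euclidean) UNIV) T"
    using T(1) by (simp add: open_fun_def)
  moreover have "id \<in> T" using T(2) by blast
  ultimately obtain X where X: "id \<in> PiE UNIV X" "\<And>i. openin euclidean (X i)"
    "finite {i. X i \<noteq> topspace euclidean}" "PiE UNIV X \<subseteq> T"
    by (rule product_topology_open_contains_basis[THEN exE]) blast
  define P where "P = {i. X i \<noteq> UNIV}"
  have P: "finite P" using X(3) by (simp add: P_def)
  have "\<exists>e>0. ball p e \<subseteq> X p" for p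
  proof -
    have "open (X p)" using X(2) by simp
    moreover have "p \<in> X p" using X(1) by (auto simp: PiE_iff)
    ultimately show ?thesis by (simp add: open_contains_ball)
  qed
  then obtain e where e: "\<And>p. 0 < e p" "\<And>p. ball p (e p) \<subseteq> X p" by metis
  define \<epsilon> where "\<epsilon> = Min (insert 1 (e ` P))"
  have \<epsilon>: "0 < \<epsilon>" "\<And>p. p \<in> P \<Longrightarrow> \<epsilon> \<le> e p" using P e(1) by (auto simp: \<epsilon>_def)
  have "h = id" if h: "h \<in> R" "\<forall>x\<in>P. norm (h x - x) < \<epsilon>" for h
  proof -
    have "h p \<in> X p" for p
    proof (cases "p \<in> P")
      case True
      then have "norm (h p - p) < e p" using h(2) \<epsilon>(2)[OF True] by force
      then show ?thesis using e(2)[of p] by (auto simp: dist_norm norm_minus_commute)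
    qed (simp add: P_def)
    then have "h \<in> T" using X(4) by (auto simp: PiE_UNIV_domain)
    then show ?thesis using h(1) T(2) by blast
  qed
  then show ?thesis using P \<epsilon>(1) by blast
qed

lemma not_isolated_id:
  fixes R :: "('a::euclidean_space \<Rightarrow> 'a) set"
  assumes "\<not> id isolated_in R" "id \<in> R" "finite P" "0 < \<epsilon>"
  shows "\<exists>h\<in>R. h \<noteq> id \<and> (\<forall>x\<in>P. norm (h x - x) < \<epsilon>)"
proof -
  define T where "T = (\<Inter>x\<in>P. {h :: 'a \<Rightarrow> 'a. norm (h x - x) < \<epsilon>})"
  have "open {h :: 'a \<Rightarrow> 'a. norm (h x - x) < \<epsilon>}" for x
    by (intro open_Collect_less continuous_intros continuous_on_product_coordinates)
  then have "open T" unfolding T_def using assms(3) by (intro open_INT) auto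
  moreover have "id \<in> T" using assms(4) by (simp add: T_def)
  ultimately have "T \<inter> R \<noteq> {id}" using assms(1,2) unfolding isolated_in_def by blast
  then obtain h where "h \<in> T" "h \<in> R" "h \<noteq> id" using \<open>id \<in> T\<close> assms(2) by blast
  then show ?thesis by (auto simp: T_def)
qed

text \<open>Conjugation by q turns a return map of \<open>L'\<close> into one of L, as g cancels.
  The test points are moved by q and the tolerance is scaled by its ratio. This carries isolation
  from one vertex to all others.\<close>

lemma id_isolated_transfer:
  assumes L: "loop_semigroup L F" and L': "loop_semigroup L' F'"
    and q: "similarity_map q" and g: "similarity_map g"
    and to: "\<And>A. A \<in> L' \<Longrightarrow> g \<circ> A \<circ> q \<in> L"
    and iso: "loop_semigroup.id_isolated L"
  shows "loop_semigroup.id_isolated L'"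
proof -
  interpret L: loop_semigroup L F by (rule L)
  interpret L': loop_semigroup L' F' by (rule L')
  obtain P \<epsilon> where P: "finite P" "0 < \<epsilon>" "\<forall>C\<in>L. \<forall>D\<in>L.
     (\<forall>x\<in>P. norm (inv C (D x) - x) < \<epsilon>) \<longrightarrow> inv C \<circ> D = id"
    using iso unfolding L.id_isolated_def by (elim exE conjE)
  have rq: "0 < sim_ratio q" using sim_ratio_pos[OF q] .
  have "inv C \<circ> D = id"
    if CD: "C \<in> L'" "D \<in> L'" "\<forall>y\<in>q ` P. norm (inv C (D y) - y) < sim_ratio q * \<epsilon>" for C D
  proof -
    have eq: "inv (g \<circ> C \<circ> q) ((g \<circ> D \<circ> q) x) = inv q (inv C (D (q x)))" for x
      using L'.sim[OF CD(1)] L'.sim[OF CD(2)] q g by (simp add: inv_sim_comp similarity_map_comp)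
    have "norm (inv (g \<circ> C \<circ> q) ((g \<circ> D \<circ> q) x) - x) < \<epsilon>" if x: "x \<in> P" for x
    proof -
      have "sim_ratio q * dist (inv q (inv C (D (q x)))) x = dist (inv C (D (q x))) (q x)"
        using sim_dist[OF q, of "inv q (inv C (D (q x)))" x] q by simp
      also have "\<dots> < sim_ratio q * \<epsilon>" using CD(3) x by (simp add: dist_norm)
      finally show ?thesis using rq unfolding eq by (simp add: dist_norm)
    qed
    then have id: "inv (g \<circ> C \<circ> q) \<circ> (g \<circ> D \<circ> q) = id"
      using P(3) to[OF CD(1)] to[OF CD(2)] by blast
    have "inv C (D y) = y" for y
    proof -
      have "inv q (inv C (D (q (inv q y)))) = inv q y"
        using fun_cong[OF id, of "inv q y"] unfolding comp_apply[of "inv (g \<circ> C \<circ> q)"] eq by simp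
      then have "q (inv q (inv C (D y))) = q (inv q y)" using q by simp
      then show ?thesis using q by simp
    qed
    then show ?thesis by (simp add: fun_eq_iff)
  qed
  moreover have "finite (q ` P)" "0 < sim_ratio q * \<epsilon>" using P rq by auto
  ultimately show ?thesis unfolding L'.id_isolated_def by blast
qed

section \<open>Graph directed systems\<close>

lemma path_map_simps [simp]:
  "path_map S [] = id" "path_map S (e # p) = S e \<circ> path_map S p"
  by (simp_all add: path_map_def)

lemma path_map_append: "path_map S (p @ q) = path_map S p \<circ> path_map S q"
  by (induction p) auto

locale attractor_system =
  fixes G :: "('v, 'e) pre_digraph" and S :: "'e \<Rightarrow> 'a::euclidean_space \<Rightarrow> 'a" and F :: "'v \<Rightarrow> 'a set"
  assumes gdifs: "graph_directed_ifs G S" and sc: "ifs_strongly_connected G" and attr: "is_attractor G S F"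
begin

sublocale fin_digraph G
  using gdifs by (simp add: graph_directed_ifs_def)

definition loops :: "'v \<Rightarrow> ('a \<Rightarrow> 'a) set" where
  "loops i = path_map S ` paths G i i"

lemma similarity_arc: "e \<in> arcs G \<Longrightarrow> similarity_map (S e)"
  and ratio_arc_less_1: "e \<in> arcs G \<Longrightarrow> sim_ratio (S e) < 1"
  using gdifs by (auto simp: graph_directed_ifs_def contracting_similarity_iff)

lemma similarity_path: "set p \<subseteq> arcs G \<Longrightarrow> similarity_map (path_map S p)"
  by (induction p) (auto intro!: similarity_map_comp similarity_arc simp: similarity_map_id)

lemma ratio_path_le_1: "set p \<subseteq> arcs G \<Longrightarrow> sim_ratio (path_map S p) \<le> 1"
proof (induction p)
  case (Cons e p)
  then have "sim_ratio (path_map S (e # p)) = sim_ratio (S e) * sim_ratio (path_map S p)"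
    unfolding path_map_simps by (intro sim_ratio_comp similarity_arc similarity_path) auto
  moreover have "sim_ratio (S e) * sim_ratio (path_map S p) \<le> 1 * 1"
    using Cons ratio_arc_less_1[of e] sim_ratio_pos[OF similarity_path[of p]] by (intro mult_mono) auto
  ultimately show ?case by (simp only: mult_1)
qed (simp add: sim_ratio_id)

lemma ratio_path_less_1:
  assumes "set p \<subseteq> arcs G" "p \<noteq> []"
  shows "sim_ratio (path_map S p) < 1"
proof -
  obtain e p' where p: "p = e # p'" using assms(2) by (cases p) auto
  have "sim_ratio (path_map S p) = sim_ratio (S e) * sim_ratio (path_map S p')"
    unfolding p path_map_simps using assms(1) p by (intro sim_ratio_comp similarity_arc similarity_path) auto
  also have "\<dots> \<le> sim_ratio (S e) * 1"
    using assms(1) p ratio_path_le_1[of p'] sim_ratio_pos[OF similarity_arc[of e]] by (intro mult_left_mono) auto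
  finally show ?thesis using ratio_arc_less_1[of e] assms(1) p by simp
qed

lemma paths_subset_arcs: "p \<in> paths G i j \<Longrightarrow> set p \<subseteq> arcs G"
  by (auto simp: paths_def awalk_def)

lemma similarity_paths: "p \<in> paths G i j \<Longrightarrow> similarity_map (path_map S p)"
  using similarity_path paths_subset_arcs by blast

lemma paths_append: "p \<in> paths G i j \<Longrightarrow> q \<in> paths G j k \<Longrightarrow> p @ q \<in> paths G i k"
  by (auto simp: paths_def simp del: awalk_append_iff intro: awalk_appendI)

lemma exists_path: "i \<in> verts G \<Longrightarrow> j \<in> verts G \<Longrightarrow> \<exists>p. p \<in> paths G i j"
  using sc by (auto simp: ifs_strongly_connected_def)

lemma compact_attractor: "i \<in> verts G \<Longrightarrow> compact (F i)"
  and attractor_nonempty: "i \<in> verts G \<Longrightarrow> F i \<noteq> {}"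
  and attractor_eq: "i \<in> verts G \<Longrightarrow> F i = (\<Union>j\<in>verts G. \<Union>e\<in>edges_between G i j. S e ` F j)"
  using attr unfolding is_attractor_def by blast+

lemma arc_maps:
  assumes "e \<in> arcs G" "x \<in> F (head G e)"
  shows "S e x \<in> F (tail G e)"
proof -
  have "e \<in> edges_between G (tail G e) (head G e)" using assms by (simp add: edges_between_def)
  then have "S e x \<in> (\<Union>j\<in>verts G. \<Union>e'\<in>edges_between G (tail G e) j. S e' ` F j)"
    using assms by (intro UN_I[of "head G e"] UN_I[of e] imageI) auto
  then show ?thesis using attractor_eq[OF tail_in_verts[OF assms(1)]] by simp
qed

lemma awalk_maps: "awalk i p j \<Longrightarrow> x \<in> F j \<Longrightarrow> path_map S p x \<in> F i"
proof (induction p arbitrary: i)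
  case Nil
  then show ?case by (auto simp: awalk_def)
next
  case (Cons e p)
  then show ?case using arc_maps[of e "path_map S p x"] by (auto simp: awalk_Cons_iff)
qed

section \<open>Decomposition of the attractor along paths\<close>

lemma arc_ratio_bounds:
  "\<exists>r R. 0 < r \<and> R < 1 \<and> 0 < R \<and> (\<forall>e\<in>arcs G. r \<le> sim_ratio (S e) \<and> sim_ratio (S e) \<le> R)"
proof -
  define r where "r = Min (insert 1 ((\<lambda>e. sim_ratio (S e)) ` arcs G))"
  define R where "R = Max (insert (1/2) ((\<lambda>e. sim_ratio (S e)) ` arcs G))"
  have "0 < r" "\<forall>e\<in>arcs G. r \<le> sim_ratio (S e)"
    using sim_ratio_pos[OF similarity_arc] by (auto simp: r_def)
  moreover have "R < 1" "\<forall>e\<in>arcs G. sim_ratio (S e) \<le> R"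
    using ratio_arc_less_1 by (auto simp: R_def)
  moreover have "1 / 2 \<le> R" unfolding R_def by (intro Max_ge) auto
  ultimately show ?thesis by (intro exI[of _ r] exI[of _ R]) auto
qed

text \<open>Edges leading to \<open>a\<close> are followed until the ratio is at most \<delta>; the
  last edge overshoots by a factor of at least r. The power \<open>R ^ n\<close> below \<delta>
  bounds the number of edges and serves for the induction.\<close>

lemma path_decomposition:
  assumes r: "0 < r" "R < 1" "0 < R" "\<forall>e\<in>arcs G. r \<le> sim_ratio (S e) \<and> sim_ratio (S e) \<le> R"
    and i: "i \<in> verts G" "a \<in> F i" and \<delta>: "0 < \<delta>" "\<delta> \<le> 1"
  shows "\<exists>j p x. p \<in> paths G i j \<and> x \<in> F j \<and> a = path_map S p x \<and>
     r * \<delta> \<le> sim_ratio (path_map S p) \<and> sim_ratio (path_map S p) \<le> \<delta>"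
proof -
  obtain n where "R ^ n < \<delta>" using real_arch_pow_inv[OF \<delta>(1) r(2)] by blast
  then show ?thesis using i \<delta>
  proof (induction n arbitrary: i a \<delta>)
    case 0
    then show ?case by simp
  next
    case (Suc n)
    obtain e b where e: "e \<in> arcs G" "tail G e = i" "b \<in> F (head G e)" "a = S e b"
      using Suc.prems(2,3) attractor_eq[of i] by (auto simp: edges_between_def)
    have re: "r \<le> sim_ratio (S e)" "sim_ratio (S e) \<le> R" "0 < sim_ratio (S e)"
      using r(4) e(1) sim_ratio_pos[OF similarity_arc[OF e(1)]] by auto
    show ?case
    proof (cases "sim_ratio (S e) \<le> \<delta>")
      case True
      have "[e] \<in> paths G i (head G e)"
        using e by (auto simp: paths_def awalk_Cons_iff awalk_Nil_iff)
      moreover have "r * \<delta> \<le> r" using r(1) Suc.prems(5) by (simp add: mult_left_le)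
      then have "r * \<delta> \<le> sim_ratio (S e)" using re(1) by linarith
      ultimately show ?thesis using e True by (intro exI[of _ "head G e"] exI[of _ "[e]"] exI[of _ b]) auto
    next
      case False
      define \<delta>' where "\<delta>' = \<delta> / sim_ratio (S e)"
      have \<delta>': "0 < \<delta>'" "\<delta>' \<le> 1" "sim_ratio (S e) * \<delta>' = \<delta>"
        using False re(3) Suc.prems(4) by (auto simp: \<delta>'_def)
      have "R * R ^ n < R * \<delta>'"
      proof -
        have "R * R ^ n < sim_ratio (S e) * \<delta>'" using Suc.prems(1) \<delta>'(3) by simp
        also have "\<dots> \<le> R * \<delta>'" using re(2) \<delta>'(1) by (intro mult_right_mono) auto
        finally show ?thesis .
      qed
      then have "R ^ n < \<delta>'" using r(3) by simp
      from Suc.IH[OF this _ e(3) \<delta>'(1,2)] e(1) obtain j p x where p: "p \<in> paths G (head G e) j" "x \<in> F j"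
        "b = path_map S p x" "r * \<delta>' \<le> sim_ratio (path_map S p)" "sim_ratio (path_map S p) \<le> \<delta>'"
        by auto
      have rp: "sim_ratio (path_map S (e # p)) = sim_ratio (S e) * sim_ratio (path_map S p)"
        unfolding path_map_simps by (rule sim_ratio_comp[OF similarity_arc[OF e(1)] similarity_paths[OF p(1)]])
      have "e # p \<in> paths G i j" using p(1) e by (auto simp: paths_def awalk_Cons_iff)
      moreover have "r * \<delta> \<le> sim_ratio (path_map S (e # p))"
      proof -
        have "r * \<delta> = sim_ratio (S e) * (r * \<delta>')" unfolding \<delta>'(3)[symmetric] by simp
        then show ?thesis using mult_left_mono[OF p(4), of "sim_ratio (S e)"] re(3) unfolding rp by linarith
      qed
      moreover have "sim_ratio (path_map S (e # p)) \<le> \<delta>"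
        using mult_left_mono[OF p(5), of "sim_ratio (S e)"] re(3) \<delta>'(3) unfolding rp by simp
      moreover have "a = path_map S (e # p) x" using p(3) e(4) by simp
      ultimately show ?thesis using p(2) by blast
    qed
  qed
qed

lemma loop_semigroup_loops:
  assumes i: "i \<in> verts G"
  shows "loop_semigroup (loops i) (F i)"
proof
  fix A B assume A: "A \<in> loops i"
  then obtain p where p: "p \<in> paths G i i" "A = path_map S p" by (auto simp: loops_def)
  show "similarity_map A" using similarity_paths[OF p(1)] p(2) by simp
  show "sim_ratio A < 1"
    using ratio_path_less_1[OF paths_subset_arcs[OF p(1)]] p by (simp add: paths_def)
  show "A x \<in> F i" if "x \<in> F i" for x using awalk_maps[of i p i x] p that by (simp add: paths_def)
  assume "B \<in> loops i"
  then obtain q where q: "q \<in> paths G i i" "B = path_map S q" by (auto simp: loops_def)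
  show "A \<circ> B \<in> loops i" using paths_append[OF p(1) q(1)] p q by (force simp: loops_def path_map_append)
next
  show "compact (F i)" "F i \<noteq> {}" using compact_attractor attractor_nonempty i by auto
next
  obtain r R where r: "0 < r" "R < 1" "0 < R" "\<forall>e\<in>arcs G. r \<le> sim_ratio (S e) \<and> sim_ratio (S e) \<le> R"
    using arc_ratio_bounds by blast
  have "\<forall>j\<in>verts G. \<exists>g q. g \<in> paths G j i \<and> q \<in> paths G i j" using exists_path i by blast
  then obtain g q where gq: "\<And>j. j \<in> verts G \<Longrightarrow> g j \<in> paths G j i" "\<And>j. j \<in> verts G \<Longrightarrow> q j \<in> paths G i j"
    by metis
  define \<B> where "\<B> = (\<lambda>j. path_map S (q j @ g j)) ` verts G"
  define m where "m = Min (insert 1 ((\<lambda>j. sim_ratio (path_map S (g j))) ` verts G))"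
  have m: "0 < m" "\<And>j. j \<in> verts G \<Longrightarrow> m \<le> sim_ratio (path_map S (g j))"
    using sim_ratio_pos[OF similarity_paths[OF gq(1)]] by (auto simp: m_def)
  have fin: "finite \<B>" by (simp add: \<B>_def)
  have sub: "\<B> \<subseteq> loops i"
    unfolding \<B>_def loops_def by (intro image_subsetI imageI paths_append[OF gq(2) gq(1)])
  have cov: "\<exists>A\<in>loops i. \<exists>B\<in>\<B>. \<exists>z. (r * m) * \<delta> \<le> sim_ratio A \<and> sim_ratio A \<le> \<delta> \<and> B z \<in> F i \<and> A z = a"
    if a: "a \<in> F i" and \<delta>: "0 < \<delta>" "\<delta> \<le> 1" for a \<delta>
  proof -
    obtain j p x where p: "p \<in> paths G i j" "x \<in> F j" "a = path_map S p x"
      "r * \<delta> \<le> sim_ratio (path_map S p)" "sim_ratio (path_map S p) \<le> \<delta>"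
      using path_decomposition[OF r i a \<delta>] by blast
    have j: "j \<in> verts G" using p(1) awalk_last_in_verts by (auto simp: paths_def)
    note sg = similarity_paths[OF gq(1)[OF j]] and sp = similarity_paths[OF p(1)]
    \<comment> \<open>Usually not a point of \<open>F i\<close>. Both closed paths end with
      \<open>g j\<close>, which undoes this inverse: one map then sends z to
      \<open>path_map S p x = a\<close>, the other to a point of \<open>F i\<close>.\<close>
    define z where "z = inv (path_map S (g j)) x"
    have gz: "path_map S (g j) z = x" using sg by (simp add: z_def)
    have rA: "sim_ratio (path_map S (p @ g j)) = sim_ratio (path_map S p) * sim_ratio (path_map S (g j))"
      unfolding path_map_append by (rule sim_ratio_comp[OF sp sg])
    have 1: "(r * \<delta>) * m \<le> sim_ratio (path_map S (p @ g j))"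
      unfolding rA using p(4) m(1) m(2)[OF j] r(1) \<delta> sim_ratio_pos[OF sp] by (intro mult_mono) auto
    have 2: "sim_ratio (path_map S (p @ g j)) \<le> \<delta> * 1"
      unfolding rA using p(5) ratio_path_le_1[OF paths_subset_arcs[OF gq(1)[OF j]]] \<delta> sim_ratio_pos[OF sg]
      by (intro mult_mono) auto
    have 3: "path_map S (q j @ g j) z \<in> F i"
      using awalk_maps[of i "q j" j x] gq(2)[OF j] p(2) by (simp add: path_map_append gz paths_def)
    have 4: "path_map S (p @ g j) z = a" by (simp add: path_map_append gz p(3))
    have 5: "path_map S (p @ g j) \<in> loops i" using paths_append[OF p(1) gq(1)[OF j]] by (simp add: loops_def)
    have 6: "path_map S (q j @ g j) \<in> \<B>" using j by (simp add: \<B>_def)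
    have "(r * m) * \<delta> = (r * \<delta>) * m" by simp
    then show ?thesis using 1 2
      by (intro bexI[OF _ 5] bexI[OF _ 6] exI[of _ z] conjI 3 4) (simp_all only: mult_1_right)
  qed
  have pos: "0 < r * m" using r(1) m(1) by simp
  show "\<exists>\<B> c. finite \<B> \<and> \<B> \<subseteq> loops i \<and> 0 < c \<and> (\<forall>a\<in>F i. \<forall>\<delta>. 0 < \<delta> \<and> \<delta> \<le> 1 \<longrightarrow>
      (\<exists>A\<in>loops i. \<exists>B\<in>\<B>. \<exists>z. c * \<delta> \<le> sim_ratio A \<and> sim_ratio A \<le> \<delta> \<and> B z \<in> F i \<and> A z = a))"
    by (rule exI[of _ \<B>], rule exI[of _ "r * m"], intro conjI ballI allI impI fin sub pos, elim conjE, rule cov)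
qed

lemma loops_conjugate:
  assumes "p \<in> paths G i j" "q \<in> paths G j i" "A \<in> loops j"
  shows "path_map S p \<circ> A \<circ> path_map S q \<in> loops i"
proof -
  obtain a where a: "a \<in> paths G j j" "A = path_map S a" using assms(3) by (auto simp: loops_def)
  have "(p @ a) @ q \<in> paths G i i" using paths_append assms a by blast
  then show ?thesis unfolding loops_def a(2) path_map_append[symmetric] by (rule imageI)
qed

lemma return_maps_loops: "return_maps G S i = {inv C \<circ> D | C D. C \<in> loops i \<and> D \<in> loops i}"
  by (auto simp: return_maps_def loops_def)

lemma id_in_return_maps:
  assumes "i \<in> verts G" shows "id \<in> return_maps G S i"
proof -
  interpret loop_semigroup "loops i" "F i" by (rule loop_semigroup_loops[OF assms])
  obtain C where C: "C \<in> loops i" using L_nonempty by blast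
  then have "inv C \<circ> C = id" using sim by (auto simp: fun_eq_iff)
  then show ?thesis unfolding return_maps_loops using C by (metis (mono_tags, lifting) mem_Collect_eq)
qed

section \<open>Translation of the graph directed notions\<close>

lemma gdwsp_id_isolated:
  assumes "gdwsp G S" "j \<in> verts G"
  shows "loop_semigroup.id_isolated (loops j)"
proof -
  obtain i where i: "i \<in> verts G" "id isolated_in return_maps G S i" using assms(1) by (auto simp: gdwsp_def)
  interpret loop_semigroup "loops i" "F i" by (rule loop_semigroup_loops[OF i(1)])
  obtain P \<epsilon> where P: "finite P" "0 < \<epsilon>" "\<forall>h\<in>return_maps G S i. (\<forall>x\<in>P. norm (h x - x) < \<epsilon>) \<longrightarrow> h = id"
    using isolated_id_finite[OF i(2)] by blast
  from P(1,2) have "id_isolated"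
    unfolding id_isolated_def
  proof (intro exI[of _ P] exI[of _ \<epsilon>] conjI ballI impI)
    fix C D assume CD: "C \<in> loops i" "D \<in> loops i" "\<forall>x\<in>P. norm (inv C (D x) - x) < \<epsilon>"
    then have "inv C \<circ> D \<in> return_maps G S i" unfolding return_maps_loops by blast
    moreover have "\<forall>x\<in>P. norm ((inv C \<circ> D) x - x) < \<epsilon>" using CD(3) by simp
    ultimately show "inv C \<circ> D = id" by (rule bspec[OF P(3), THEN mp])
  qed
  obtain p q where pq: "p \<in> paths G i j" "q \<in> paths G j i" using exists_path i(1) assms(2) by blast
  show ?thesis
  proof (rule id_isolated_transfer[OF loop_semigroup_axioms loop_semigroup_loops[OF assms(2)]])
    show "similarity_map (path_map S q)" "similarity_map (path_map S p)" using similarity_paths pq by blast+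
    show "path_map S p \<circ> A \<circ> path_map S q \<in> loops i" if "A \<in> loops j" for A
      by (rule loops_conjugate[OF pq that])
  qed fact
qed

lemma assouad_dim_attractor_eq:
  assumes "i \<in> verts G" "j \<in> verts G"
  shows "assouad_dim (F i) = assouad_dim (F j)"
proof -
  have "assouad_exponents (F i) \<subseteq> assouad_exponents (F j)" if ij: "i \<in> verts G" "j \<in> verts G" for i j
  proof -
    obtain p where p: "p \<in> paths G i j" using exists_path ij by blast
    show ?thesis
      using awalk_maps[of i p j] p compact_attractor[OF ij(1)]
      by (intro assouad_exponents_similarity[OF similarity_paths[OF p]]) (auto simp: paths_def compact_imp_bounded)
  qed
  then show ?thesis unfolding assouad_dim_eq_Inf using assms by (metis subset_antisym)
qed

lemma not_gdwsp_small_return: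
  assumes "\<not> gdwsp G S" "i \<in> verts G" "0 < \<epsilon>"
  shows "\<exists>C\<in>loops i. \<exists>D\<in>loops i. inv C \<circ> D \<noteq> id \<and> (\<forall>b\<in>insert 0 Basis. norm (inv C (D b) - b) \<le> \<epsilon>)"
proof -
  have "\<not> id isolated_in return_maps G S i" using assms(1,2) by (auto simp: gdwsp_def)
  then obtain h where h: "h \<in> return_maps G S i" "h \<noteq> id" "\<forall>x\<in>insert 0 Basis. norm (h x - x) < \<epsilon>"
    using not_isolated_id[OF _ id_in_return_maps[OF assms(2)] _ assms(3), of "insert 0 Basis"] by auto
  then obtain C D where "C \<in> loops i" "D \<in> loops i" "h = inv C \<circ> D" unfolding return_maps_loops by blast
  then show ?thesis using h(2,3) by (intro bexI[of _ C] bexI[of _ D]) (auto intro: less_imp_le)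
qed

text \<open>In one direction whatever base point and radius the definition provides will do, in the
  other any point of \<open>F i\<close> with radius 1; so the directions do not depend on these
  choices.\<close>

lemma overlapping_direction_iff:
  assumes i: "i \<in> verts G"
  shows "overlapping_direction G S F i \<omega> \<longleftrightarrow> norm \<omega> = 1 \<and> \<omega> \<in> loop_semigroup.translation_space (loops i)"
proof -
  interpret loop_semigroup "loops i" "F i" by (rule loop_semigroup_loops[OF i])
  show ?thesis
  proof
    assume "overlapping_direction G S F i \<omega>"
    then obtain e f \<Phi> a \<rho> y where *: "norm \<omega> = 1"
      "\<forall>k. e k \<in> paths G i i \<and> f k \<in> paths G i i \<and>
         \<Phi> k = (\<lambda>x. (inv (path_map S (e k)) \<circ> path_map S (f k)) x - x)"
      "(\<lambda>k::nat. cube_sup_norm (\<Phi> k)) \<longlonglongrightarrow> 0" "a \<in> F i" "0 < \<rho>"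
      "(\<lambda>k. \<Phi> k a /\<^sub>R norm (\<Phi> k a)) \<longlonglongrightarrow> \<omega>"
      "\<forall>k. is_arg_min (\<lambda>x. norm (\<Phi> k x)) (\<lambda>x. x \<in> cball a \<rho>) (y k) \<and>
         \<rho> * onorm (frechet_derivative (\<Phi> k) (at a)) \<le> norm (\<Phi> k (y k))"
      unfolding overlapping_direction_def by (elim exE conjE bexE)
    have "\<omega> \<in> translation_space"
    proof (rule direction_imp_translation_space[OF *(1) _ *(3-6)])
      show "path_map S (e k) \<in> loops i \<and> path_map S (f k) \<in> loops i \<and>
        \<Phi> k = (\<lambda>x. inv (path_map S (e k)) (path_map S (f k) x) - x)" for k
        using *(2) by (simp add: loops_def)
    qed (use *(7) in auto)
    then show "norm \<omega> = 1 \<and> \<omega> \<in> translation_space" using *(1) by simp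
  next
    assume \<omega>: "norm \<omega> = 1 \<and> \<omega> \<in> translation_space"
    obtain a where a: "a \<in> F i" using F_nonempty by blast
    obtain C D \<Phi> where *: "\<forall>k::nat. C k \<in> loops i \<and> D k \<in> loops i \<and> \<Phi> k = (\<lambda>x. inv (C k) (D k x) - x)"
      "\<forall>k. 0 < cube_sup_norm (\<Phi> k)" "(\<lambda>k. cube_sup_norm (\<Phi> k)) \<longlonglongrightarrow> 0"
      "(\<lambda>k. \<Phi> k a /\<^sub>R norm (\<Phi> k a)) \<longlonglongrightarrow> \<omega>"
      "\<exists>y. \<forall>k. is_arg_min (\<lambda>x. norm (\<Phi> k x)) (\<lambda>x. x \<in> cball a 1) (y k) \<and>
       1 * onorm (frechet_derivative (\<Phi> k) (at a)) \<le> norm (\<Phi> k (y k))"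
      using translation_space_imp_direction[OF conjunct1[OF \<omega>] conjunct2[OF \<omega>] a]
      by (elim exE conjE) (rule that, assumption+, rule exI, assumption)
    have "\<forall>k. \<exists>e f. e \<in> paths G i i \<and> f \<in> paths G i i \<and> C k = path_map S e \<and> D k = path_map S f"
      using *(1) unfolding loops_def by blast
    then obtain e f where ef: "\<forall>k. e k \<in> paths G i i \<and> f k \<in> paths G i i \<and>
        C k = path_map S (e k) \<and> D k = path_map S (f k)" by metis
    show "overlapping_direction G S F i \<omega>"
      unfolding overlapping_direction_def
    proof (rule conjI, use \<omega> in simp, rule exI[of _ e], rule exI[of _ f], rule exI[of _ \<Phi>],
        intro conjI bexI[OF _ a] exI[of _ "1::real"])
      show "\<forall>k. e k \<in> paths G i i \<and> f k \<in> paths G i i \<and>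
        \<Phi> k = (\<lambda>x. (inv (path_map S (e k)) \<circ> path_map S (f k)) x - x)"
        using ef *(1) by simp
    qed (use \<omega> *(2-5) in simp_all)
  qed
qed

text \<open>The delicate vector is 0: it is a multiple of an overlapping direction only if there is
  one at all. Failure of the GDWSP provides one, since F spans.\<close>

lemma overlap_space_eq:
  assumes i: "i \<in> verts G" and span: "\<And>a b. a \<noteq> 0 \<Longrightarrow> \<not> F i \<subseteq> {x. a \<bullet> x = b}" and ng: "\<not> gdwsp G S"
  shows "overlap_space G S F i = loop_semigroup.translation_space (loops i)"
proof -
  interpret loop_semigroup "loops i" "F i" by (rule loop_semigroup_loops[OF i])
  obtain \<omega>0 where \<omega>0: "\<omega>0 \<in> translation_space" "norm \<omega>0 = 1"
    using exists_translation[OF span not_gdwsp_small_return[OF ng i]] by blast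
  show ?thesis
  proof (intro subset_antisym subsetI)
    fix w assume "w \<in> overlap_space G S F i"
    then show "w \<in> translation_space"
      using subspace_scale[OF subspace_translation_space] by (auto simp: overlap_space_def overlapping_direction_iff[OF i])
  next
    fix w assume w: "w \<in> translation_space"
    show "w \<in> overlap_space G S F i"
    proof (cases "w = 0")
      case True
      then have "w = 0 *\<^sub>R \<omega>0" by simp
      then show ?thesis using \<omega>0 unfolding overlap_space_def overlapping_direction_iff[OF i] by blast
    next
      case False
      have "w /\<^sub>R norm w \<in> translation_space" using subspace_scale[OF subspace_translation_space w] .
      moreover have "w = norm w *\<^sub>R (w /\<^sub>R norm w)" "norm (w /\<^sub>R norm w) = 1" using False by auto
      ultimately show ?thesis unfolding overlap_space_def overlapping_direction_iff[OF i] by blast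
    qed
  qed
qed

lemma weak_tangent_parallelotope:
  assumes i: "i \<in> verts G" and \<Omega>: "\<Omega> \<subseteq> Collect (overlapping_direction G S F i)" "independent \<Omega>"
  shows "\<exists>K. weak_tangent (F i) K \<and> {w + x | w x. w \<in> parallelotope \<Omega> \<and> x \<in> F i} \<subseteq> K"
proof -
  interpret loop_semigroup "loops i" "F i" by (rule loop_semigroup_loops[OF i])
  have sub: "\<Omega> \<subseteq> translation_space" "\<forall>\<omega>\<in>\<Omega>. norm \<omega> = 1"
    using \<Omega>(1) by (auto simp: overlapping_direction_iff[OF i])
  show ?thesis
  proof (rule weak_tangent_translates)
    have "norm w \<le> real (card \<Omega>)" if "w \<in> parallelotope \<Omega>" for w
    proof -
      obtain t where t: "w = (\<Sum>\<omega>\<in>\<Omega>. t \<omega> *\<^sub>R \<omega>)" "\<forall>\<omega>\<in>\<Omega>. 0 \<le> t \<omega> \<and> t \<omega> \<le> 1"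
        using \<open>w \<in> parallelotope \<Omega>\<close> by (auto simp: parallelotope_def)
      have "norm w \<le> (\<Sum>\<omega>\<in>\<Omega>. 1)"
        unfolding t(1) using t(2) sub(2) by (intro sum_norm_le) auto
      then show ?thesis by simp
    qed
    then show "bounded (parallelotope \<Omega>)" unfolding bounded_iff by blast
    show "parallelotope \<Omega> \<subseteq> limit_translations"
    proof
      fix w assume "w \<in> parallelotope \<Omega>"
      then obtain t where "w = (\<Sum>\<omega>\<in>\<Omega>. t \<omega> *\<^sub>R \<omega>)" by (auto simp: parallelotope_def)
      then have "w \<in> translation_space"
        using sub(1) subspace_translation_space by (auto intro!: subspace_sum subspace_scale)
      then show "w \<in> limit_translations" by (rule translation_spaceD)
    qed
    show "0 \<in> parallelotope \<Omega>" by (auto simp: parallelotope_def intro!: exI[of _ "\<lambda>_. 0"])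
  qed
qed

lemma dim_translation_space_loops:
  assumes "i \<in> verts G" "j \<in> verts G"
  shows "dim (loop_semigroup.translation_space (loops i)) = dim (loop_semigroup.translation_space (loops j))"
proof -
  have "dim (loop_semigroup.translation_space (loops i)) \<le> dim (loop_semigroup.translation_space (loops j))"
    if ij: "i \<in> verts G" "j \<in> verts G" for i j
  proof -
    obtain p q where pq: "p \<in> paths G i j" "q \<in> paths G j i" using exists_path ij by blast
    show ?thesis
    proof (rule dim_translation_space_le[OF loop_semigroup_loops[OF ij(1)] loop_semigroup_loops[OF ij(2)]])
      show "similarity_map (path_map S q)" "similarity_map (path_map S p)" using similarity_paths pq by blast+
      show "path_map S p \<circ> A \<circ> path_map S q \<in> loops i" if "A \<in> loops j" for A
        by (rule loops_conjugate[OF pq that])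
      show "path_map S q \<circ> A \<circ> path_map S p \<in> loops j" if "A \<in> loops i" for A
        by (rule loops_conjugate[OF pq(2,1) that])
    qed
  qed
  then show ?thesis using assms by (meson le_antisym)
qed

end

theorem theorem6p2:
  fixes G :: "('v, 'e) pre_digraph"
    and S :: "'e \<Rightarrow> real ^ 'd \<Rightarrow> real ^ 'd"
    and F :: "'v \<Rightarrow> (real ^ 'd) set"
  assumes "graph_directed_ifs G S"
    and "ifs_strongly_connected G"
    and "is_attractor G S F"
    and "\<And>i. i \<in> verts G \<Longrightarrow>
           \<not> (\<exists>H. affine H \<and> aff_dim H = int CARD('d) - 1 \<and> F i \<subseteq> H)"
  shows "(gdwsp G S \<longrightarrow>
            (\<exists>s. \<forall>i\<in>verts G. hausdorff_dim (F i) = s \<and> 0 < hausdorff_measure s (F i) \<and>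
                              hausdorff_dim (F i) = assouad_dim (F i)))
       \<and> (\<not> gdwsp G S \<longrightarrow>
            (\<forall>i\<in>verts G.
               (\<forall>\<Omega>. maximal_independent_directions G S F i \<Omega> \<longrightarrow>
                  (\<exists>K. weak_tangent (F i) K \<and> {w + x | w x. w \<in> parallelotope \<Omega> \<and> x \<in> F i} \<subseteq> K))
             \<and> subspace (overlap_space G S F i)
             \<and> (\<forall>V. subspace V \<and> V \<subseteq> overlap_space G S F i \<longrightarrow>
                  assouad_dim (F i) = real (dim V) + assouad_dim (orth_proj (V\<^sup>\<bottom>) ` F i))
             \<and> (dim (overlap_space G S F i) < CARD('d) \<longrightarrow>
                  real (dim (overlap_space G S F i)) < assouad_dim (F i)))
          \<and> (\<forall>i\<in>verts G. \<forall>j\<in>verts G.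
               dim (overlap_space G S F i) = dim (overlap_space G S F j)))"
proof -
  interpret attractor_system G S F by unfold_locales fact+
  \<comment> \<open>Hyperplanes enter the proof only as level sets of linear functionals.\<close>
  have span: "\<not> F i \<subseteq> {x. a \<bullet> x = b}" if "i \<in> verts G" "a \<noteq> 0" for i a b
  proof
    assume "F i \<subseteq> {x. a \<bullet> x = b}"
    moreover have "aff_dim {x. a \<bullet> x = b} = int CARD('d) - 1" using aff_dim_hyperplane[OF \<open>a \<noteq> 0\<close>, of b] by simp
    ultimately show False using assms(4)[OF \<open>i \<in> verts G\<close>] affine_hyperplane by blast
  qed
  show ?thesis
  proof (intro conjI impI)
    assume wsp: "gdwsp G S"
    obtain i0 where i0: "i0 \<in> verts G" using assms(1) by (auto simp: graph_directed_ifs_def)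
    show "\<exists>s. \<forall>i\<in>verts G. hausdorff_dim (F i) = s \<and> 0 < hausdorff_measure s (F i) \<and>
        hausdorff_dim (F i) = assouad_dim (F i)"
    \<comment> \<open>The common value is the Assouad dimension at one vertex; these dimensions
      agree because each attractor set contains similar copies of all the others.\<close>
    proof (intro exI[of _ "assouad_dim (F i0)"] ballI)
      fix i assume i: "i \<in> verts G"
      interpret loop_semigroup "loops i" "F i" by (rule loop_semigroup_loops[OF i])
      have "assouad_dim (F i) = assouad_dim (F i0)" by (rule assouad_dim_attractor_eq[OF i i0])
      then show "hausdorff_dim (F i) = assouad_dim (F i0) \<and> 0 < hausdorff_measure (assouad_dim (F i0)) (F i) \<and>
          hausdorff_dim (F i) = assouad_dim (F i)"
        using isolated_dimensions[OF gdwsp_id_isolated[OF wsp i]] by simp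
    qed
  next
    assume ng: "\<not> gdwsp G S"
    have eq: "overlap_space G S F i = loop_semigroup.translation_space (loops i)" if "i \<in> verts G" for i
      using overlap_space_eq[OF that span[OF that] ng] .
    show "\<forall>i\<in>verts G. \<forall>j\<in>verts G. dim (overlap_space G S F i) = dim (overlap_space G S F j)"
    proof (intro ballI)
      fix i j assume ij: "i \<in> verts G" "j \<in> verts G"
      show "dim (overlap_space G S F i) = dim (overlap_space G S F j)"
        unfolding eq[OF ij(1)] eq[OF ij(2)] by (rule dim_translation_space_loops[OF ij])
    qed
    show "\<forall>i\<in>verts G.
         (\<forall>\<Omega>. maximal_independent_directions G S F i \<Omega> \<longrightarrow>
            (\<exists>K. weak_tangent (F i) K \<and> {w + x | w x. w \<in> parallelotope \<Omega> \<and> x \<in> F i} \<subseteq> K))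
       \<and> subspace (overlap_space G S F i)
       \<and> (\<forall>V. subspace V \<and> V \<subseteq> overlap_space G S F i \<longrightarrow>
            assouad_dim (F i) = real (dim V) + assouad_dim (orth_proj (V\<^sup>\<bottom>) ` F i))
       \<and> (dim (overlap_space G S F i) < CARD('d) \<longrightarrow>
            real (dim (overlap_space G S F i)) < assouad_dim (F i))"
    proof (rule ballI)
      fix i assume i: "i \<in> verts G"
      interpret loop_semigroup "loops i" "F i" by (rule loop_semigroup_loops[OF i])
      show "(\<forall>\<Omega>. maximal_independent_directions G S F i \<Omega> \<longrightarrow>
            (\<exists>K. weak_tangent (F i) K \<and> {w + x | w x. w \<in> parallelotope \<Omega> \<and> x \<in> F i} \<subseteq> K))
       \<and> subspace (overlap_space G S F i)
       \<and> (\<forall>V. subspace V \<and> V \<subseteq> overlap_space G S F i \<longrightarrow>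
            assouad_dim (F i) = real (dim V) + assouad_dim (orth_proj (V\<^sup>\<bottom>) ` F i))
       \<and> (dim (overlap_space G S F i) < CARD('d) \<longrightarrow>
            real (dim (overlap_space G S F i)) < assouad_dim (F i))"
        unfolding eq[OF i]
      proof (intro conjI allI impI)
        fix \<Omega> assume "maximal_independent_directions G S F i \<Omega>"
        then show "\<exists>K. weak_tangent (F i) K \<and> {w + x | w x. w \<in> parallelotope \<Omega> \<and> x \<in> F i} \<subseteq> K"
          using weak_tangent_parallelotope[OF i] by (simp add: maximal_independent_directions_def)
      next
        show "subspace translation_space" by (rule subspace_translation_space)
      next
        fix V assume "subspace V \<and> V \<subseteq> translation_space"
        then show "assouad_dim (F i) = real (dim V) + assouad_dim (orth_proj (V\<^sup>\<bottom>) ` F i)"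
          using assouad_dim_projection by blast
      next
        assume "dim translation_space < CARD('d)"
        then show "real (dim translation_space) < assouad_dim (F i)"
          by (intro dim_translation_space_less span[OF i]) simp_all
      qed
    qed
  qed
qed

end
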